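(* Let $\Bbbk$ be a field, let $f,g:A\to B$ be two morphisms of Hopf braces over $\Bbbk$, and let $I_0\subseteq B$ be the linear span of $\{f(a)-g(a)\mid a\in A\}$. Let $I:=\widetilde{I_0}$ be the subspace of $B$ obtained from $I_0$ by the iterative procedure described in the context. Then $I$ is a Hopf brace ideal of $B$, and the quotient Hopf brace $B/I$ together with the projection $\pi:B\to B/I$ is the coequalizer of $f$ and $g$ in the category of Hopf braces (and likewise in the category of cocommutative Hopf braces when $A$ and $B$ are cocommutative).
   Context: All structures are linear over a field $\Bbbk$. Sweedler notation: $\Delta(c)=c_{(1)}\otimes c_{(2)}$. A Hopf brace over a coalgebra $(H,\Delta,\varepsilon)$ consists of two Hopf algebra structures $(H,\cdot,1,\Delta,\varepsilon,S)$ and $(H,\diamond,1_\diamond,\Delta,\varepsilon,T)$ such that for all $x,y,z\in H$: $x\diamond(y\cdot z)=(x_{(1)}\diamond y)\cdot S(x_{(2)})\cdot(x_{(3)}\diamond z)$ (this forces $1=1_\diamond$). A morphism of Hopf braces is a linear map that is a Hopf algebra morphism for both structures. A Hopf brace is cocommutative if its underlying coalgebra is. A Hopf brace ideal is a coideal which is a Hopf ideal with respect to both Hopf algebra structures; the quotient by such an ideal is again a Hopf brace and the quotient map is a morphism of Hopf braces. Iterative procedure: for a subspace $J$ of a Hopf brace $(H,\cdot,\diamond,1,\Delta,\varepsilon,S,T)$, put $J_0:=J$. For odd $n\ge 1$ let $J_n$ be the two-sided ideal of $(H,\cdot,1)$ generated by $J_{n-1},S(J_{n-1}),S^2(J_{n-1}),\dots$,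 and for even $n\ge 2$ let $J_n$ be the two-sided ideal of $(H,\diamond,1)$ generated by $J_{n-1},T(J_{n-1}),T^2(J_{n-1}),\dots$. This gives an ascending chain $J_0\subseteq J_1\subseteq J_2\subseteq\cdots$, and $\widetilde J:=\bigcup_{n\in\mathbb N}J_n$. *)

theory Defs
  imports "HOL-Algebra.Module" "HOL-Algebra.QuotRing"
begin

section \<open>Vector spaces, spans, quotients\<close>

text \<open>A vector space over a field \<open>K\<close> is a \<^locale>\<open>module\<close> over \<open>K\<close>, a linear subspace is a
  \<^locale>\<open>submodule\<close>.\<close>

definition module_hom ::
  "('k, 'r) ring_scheme \<Rightarrow> ('k, 'v, 'm) module_scheme \<Rightarrow> ('k, 'w, 'n) module_scheme \<Rightarrow> ('v \<Rightarrow> 'w) set"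
  where "module_hom K V W =
    {f \<in> hom (add_monoid V) (add_monoid W).
       \<forall>a\<in>carrier K. \<forall>v\<in>carrier V. f (a \<odot>\<^bsub>V\<^esub> v) = a \<odot>\<^bsub>W\<^esub> f v}"

definition module_span ::
  "('k, 'r) ring_scheme \<Rightarrow> ('k, 'v, 'm) module_scheme \<Rightarrow> 'v set \<Rightarrow> 'v set"
  where "module_span K V X = \<Inter>{N. submodule N K V \<and> X \<subseteq> N}"

definition quotient_smult ::
  "('k, 'v, 'm) module_scheme \<Rightarrow> 'v set \<Rightarrow> 'k \<Rightarrow> 'v set \<Rightarrow> 'v set"
  where "quotient_smult V N a X = the_elem ((\<lambda>x. N +>\<^bsub>V\<^esub> (a \<odot>\<^bsub>V\<^esub> x)) ` X)"

definition quotient_module ::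
  "('k, 'v, 'm) module_scheme \<Rightarrow> 'v set \<Rightarrow> ('k, 'v set) module"
  where "quotient_module V N =
    \<lparr>carrier = a_rcosets\<^bsub>V\<^esub> N, mult = undefined, one = undefined,
     zero = N, add = set_add V, smult = quotient_smult V N\<rparr>"


section \<open>Tensor products\<close>

definition free_module :: "('k, 'r) ring_scheme \<Rightarrow> 'x set \<Rightarrow> ('k, 'x \<Rightarrow> 'k) module"
  where "free_module K X =
    \<lparr>carrier = {r. (\<forall>x. r x \<in> carrier K) \<and> (\<forall>x. x \<notin> X \<longrightarrow> r x = \<zero>\<^bsub>K\<^esub>) \<and> finite {x. r x \<noteq> \<zero>\<^bsub>K\<^esub>}},
     mult = undefined, one = undefined,
     zero = (\<lambda>x. \<zero>\<^bsub>K\<^esub>), add = (\<lambda>r s x. r x \<oplus>\<^bsub>K\<^esub> s x), smult = (\<lambda>a r x. a \<otimes>\<^bsub>K\<^esub> r x)\<rparr>"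

definition free_gen :: "('k, 'r) ring_scheme \<Rightarrow> 'x \<Rightarrow> 'x \<Rightarrow> 'k"
  where "free_gen K x = (\<lambda>y. if y = x then \<one>\<^bsub>K\<^esub> else \<zero>\<^bsub>K\<^esub>)"

text \<open>\<open>V \<otimes> W\<close> is the free module on \<open>V \<times> W\<close> modulo the bilinearity relations.\<close>

definition bilinear_relations ::
  "('k, 'r) ring_scheme \<Rightarrow> ('k, 'v, 'm) module_scheme \<Rightarrow> ('k, 'w, 'n) module_scheme
    \<Rightarrow> ('v \<times> 'w \<Rightarrow> 'k) set"
  where "bilinear_relations K V W =
    (let F = free_module K (carrier V \<times> carrier W); e = free_gen K in
       {e (v \<oplus>\<^bsub>V\<^esub> v', w) \<ominus>\<^bsub>F\<^esub> (e (v, w) \<oplus>\<^bsub>F\<^esub> e (v', w)) | v v' w.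
          v \<in> carrier V \<and> v' \<in> carrier V \<and> w \<in> carrier W}
     \<union> {e (v, w \<oplus>\<^bsub>W\<^esub> w') \<ominus>\<^bsub>F\<^esub> (e (v, w) \<oplus>\<^bsub>F\<^esub> e (v, w')) | v w w'.
          v \<in> carrier V \<and> w \<in> carrier W \<and> w' \<in> carrier W}
     \<union> {e (a \<odot>\<^bsub>V\<^esub> v, w) \<ominus>\<^bsub>F\<^esub> a \<odot>\<^bsub>F\<^esub> e (v, w) | a v w.
          a \<in> carrier K \<and> v \<in> carrier V \<and> w \<in> carrier W}
     \<union> {e (v, a \<odot>\<^bsub>W\<^esub> w) \<ominus>\<^bsub>F\<^esub> a \<odot>\<^bsub>F\<^esub> e (v, w) | a v w.
          a \<in> carrier K \<and> v \<in> carrier V \<and> w \<in> carrier W})"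

definition tensor_null ::
  "('k, 'r) ring_scheme \<Rightarrow> ('k, 'v, 'm) module_scheme \<Rightarrow> ('k, 'w, 'n) module_scheme
    \<Rightarrow> ('v \<times> 'w \<Rightarrow> 'k) set"
  where "tensor_null K V W =
    module_span K (free_module K (carrier V \<times> carrier W)) (bilinear_relations K V W)"

type_synonym ('k, 'v, 'w) tensor = "('v \<times> 'w \<Rightarrow> 'k) set"

definition tensor_product ::
  "('k, 'r) ring_scheme \<Rightarrow> ('k, 'v, 'm) module_scheme \<Rightarrow> ('k, 'w, 'n) module_scheme
    \<Rightarrow> ('k, ('k, 'v, 'w) tensor) module"
  where "tensor_product K V W =
    quotient_module (free_module K (carrier V \<times> carrier W)) (tensor_null K V W)"

definition pure_tensor ::
  "('k, 'r) ring_scheme \<Rightarrow> ('k, 'v, 'm) module_scheme \<Rightarrow> ('k, 'w, 'n) module_scheme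
    \<Rightarrow> 'v \<Rightarrow> 'w \<Rightarrow> ('k, 'v, 'w) tensor"
  where "pure_tensor K V W v w =
    tensor_null K V W +>\<^bsub>free_module K (carrier V \<times> carrier W)\<^esub> free_gen K (v, w)"

text \<open>The linear map \<open>V \<otimes> W \<rightarrow> U\<close> induced by a bilinear map \<open>\<phi> : V \<times> W \<rightarrow> U\<close>. In Sweedler
  notation \<open>tensor_lift K U \<phi> (\<Delta> c)\<close> is \<open>\<phi>(c\<^sub>1, c\<^sub>2)\<close>. The set under \<^const>\<open>the_elem\<close> is a
  singleton whenever \<open>\<phi>\<close> is bilinear.\<close>

definition tensor_lift ::
  "('k, 'r) ring_scheme \<Rightarrow> ('k, 'u, 'm) module_scheme \<Rightarrow> ('v \<Rightarrow> 'w \<Rightarrow> 'u)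
    \<Rightarrow> ('k, 'v, 'w) tensor \<Rightarrow> 'u"
  where "tensor_lift K U \<phi> t =
    the_elem ((\<lambda>r. \<Oplus>\<^bsub>U\<^esub>p\<in>{p. r p \<noteq> \<zero>\<^bsub>K\<^esub>}. r p \<odot>\<^bsub>U\<^esub> \<phi> (fst p) (snd p)) ` t)"

text \<open>The map \<open>f \<otimes> g : V \<otimes> W \<rightarrow> V' \<otimes> W'\<close>, given only the target spaces \<open>V'\<close>, \<open>W'\<close>.\<close>

definition tensor_map ::
  "('k, 'r) ring_scheme \<Rightarrow> ('k, 'x, 'm) module_scheme \<Rightarrow> ('k, 'y, 'n) module_scheme
    \<Rightarrow> ('v \<Rightarrow> 'x) \<Rightarrow> ('w \<Rightarrow> 'y) \<Rightarrow> ('k, 'v, 'w) tensor \<Rightarrow> ('k, 'x, 'y) tensor"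
  where "tensor_map K V' W' f g =
    tensor_lift K (tensor_product K V' W') (\<lambda>v w. pure_tensor K V' W' (f v) (g w))"

definition tensor_mult ::
  "('k, 'r) ring_scheme \<Rightarrow> ('k, 'h, 'm) module_scheme
    \<Rightarrow> ('k, 'h, 'h) tensor \<Rightarrow> ('k, 'h, 'h) tensor \<Rightarrow> ('k, 'h, 'h) tensor"
  where "tensor_mult K H s t =
    tensor_lift K (tensor_product K H H) (\<lambda>a b.
      tensor_lift K (tensor_product K H H) (\<lambda>c d.
        pure_tensor K H H (a \<otimes>\<^bsub>H\<^esub> c) (b \<otimes>\<^bsub>H\<^esub> d)) t) s"


section \<open>Coalgebras and Hopf algebras\<close>

record ('k, 'h) coalgebra = "('k, 'h) module" +
  comult :: "'h \<Rightarrow> ('k, 'h, 'h) tensor"  (\<open>\<Delta>\<index>\<close>)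
  counit :: "'h \<Rightarrow> 'k"  (\<open>\<epsilon>\<index>\<close>)

record ('k, 'h) hopf_algebra = "('k, 'h) coalgebra" +
  antipode :: "'h \<Rightarrow> 'h"

locale coalgebra =
  fixes K :: "('k, 'r) ring_scheme" and H :: "('k, 'h, 'm) coalgebra_scheme"
  assumes field: "field K"
    and module: "module K H"
    and comult_linear: "\<Delta>\<^bsub>H\<^esub> \<in> module_hom K H (tensor_product K H H)"
    and counit_add_hom: "\<epsilon>\<^bsub>H\<^esub> \<in> hom (add_monoid H) (add_monoid K)"
    and counit_smult: "\<And>a x. \<lbrakk>a \<in> carrier K; x \<in> carrier H\<rbrakk> \<Longrightarrow> \<epsilon>\<^bsub>H\<^esub> (a \<odot>\<^bsub>H\<^esub> x) = a \<otimes>\<^bsub>K\<^esub> \<epsilon>\<^bsub>H\<^esub> x"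
    \<comment> \<open>both sides in \<open>H \<otimes> (H \<otimes> H)\<close>: \<open>x\<^sub>1\<^sub>1 \<otimes> (x\<^sub>1\<^sub>2 \<otimes> x\<^sub>2) = x\<^sub>1 \<otimes> \<Delta>(x\<^sub>2)\<close>\<close>
    and coassoc: "\<And>x. x \<in> carrier H \<Longrightarrow>
      tensor_lift K (tensor_product K H (tensor_product K H H)) (\<lambda>y z.
        tensor_lift K (tensor_product K H (tensor_product K H H)) (\<lambda>u v.
          pure_tensor K H (tensor_product K H H) u (pure_tensor K H H v z)) (\<Delta>\<^bsub>H\<^esub> y)) (\<Delta>\<^bsub>H\<^esub> x)
      = tensor_lift K (tensor_product K H (tensor_product K H H)) (\<lambda>y z.
          pure_tensor K H (tensor_product K H H) y (\<Delta>\<^bsub>H\<^esub> z)) (\<Delta>\<^bsub>H\<^esub> x)"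
    and counit_left: "\<And>x. x \<in> carrier H \<Longrightarrow> tensor_lift K H (\<lambda>y z. \<epsilon>\<^bsub>H\<^esub> y \<odot>\<^bsub>H\<^esub> z) (\<Delta>\<^bsub>H\<^esub> x) = x"
    and counit_right: "\<And>x. x \<in> carrier H \<Longrightarrow> tensor_lift K H (\<lambda>y z. \<epsilon>\<^bsub>H\<^esub> z \<odot>\<^bsub>H\<^esub> y) (\<Delta>\<^bsub>H\<^esub> x) = x"

definition cocommutative :: "('k, 'r) ring_scheme \<Rightarrow> ('k, 'h, 'm) coalgebra_scheme \<Rightarrow> bool"
  where "cocommutative K H \<longleftrightarrow> (\<forall>x\<in>carrier H.
    tensor_lift K (tensor_product K H H) (\<lambda>y z. pure_tensor K H H z y) (\<Delta>\<^bsub>H\<^esub> x) = \<Delta>\<^bsub>H\<^esub> x)"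

text \<open>The locale \<^locale>\<open>algebra\<close> of the library is about commutative algebras, so the
  associative unital algebra structure is spelled out as a ring with compatible scalars.\<close>

locale hopf_algebra = coalgebra K H
  for K :: "('k, 'r) ring_scheme" and H :: "('k, 'h, 'm) hopf_algebra_scheme" +
  assumes ring: "ring H"
    and smult_mult_left: "\<And>a x y. \<lbrakk>a \<in> carrier K; x \<in> carrier H; y \<in> carrier H\<rbrakk> \<Longrightarrow>
      (a \<odot>\<^bsub>H\<^esub> x) \<otimes>\<^bsub>H\<^esub> y = a \<odot>\<^bsub>H\<^esub> (x \<otimes>\<^bsub>H\<^esub> y)"
    and smult_mult_right: "\<And>a x y. \<lbrakk>a \<in> carrier K; x \<in> carrier H; y \<in> carrier H\<rbrakk> \<Longrightarrow>
      x \<otimes>\<^bsub>H\<^esub> (a \<odot>\<^bsub>H\<^esub> y) = a \<odot>\<^bsub>H\<^esub> (x \<otimes>\<^bsub>H\<^esub> y)"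
    and comult_mult: "\<And>x y. \<lbrakk>x \<in> carrier H; y \<in> carrier H\<rbrakk> \<Longrightarrow>
      \<Delta>\<^bsub>H\<^esub> (x \<otimes>\<^bsub>H\<^esub> y) = tensor_mult K H (\<Delta>\<^bsub>H\<^esub> x) (\<Delta>\<^bsub>H\<^esub> y)"
    and comult_one: "\<Delta>\<^bsub>H\<^esub> \<one>\<^bsub>H\<^esub> = pure_tensor K H H \<one>\<^bsub>H\<^esub> \<one>\<^bsub>H\<^esub>"
    and counit_mult: "\<And>x y. \<lbrakk>x \<in> carrier H; y \<in> carrier H\<rbrakk> \<Longrightarrow>
      \<epsilon>\<^bsub>H\<^esub> (x \<otimes>\<^bsub>H\<^esub> y) = \<epsilon>\<^bsub>H\<^esub> x \<otimes>\<^bsub>K\<^esub> \<epsilon>\<^bsub>H\<^esub> y"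
    and counit_one: "\<epsilon>\<^bsub>H\<^esub> \<one>\<^bsub>H\<^esub> = \<one>\<^bsub>K\<^esub>"
    and antipode_linear: "antipode H \<in> module_hom K H H"
    and antipode_left: "\<And>x. x \<in> carrier H \<Longrightarrow>
      tensor_lift K H (\<lambda>y z. antipode H y \<otimes>\<^bsub>H\<^esub> z) (\<Delta>\<^bsub>H\<^esub> x) = \<epsilon>\<^bsub>H\<^esub> x \<odot>\<^bsub>H\<^esub> \<one>\<^bsub>H\<^esub>"
    and antipode_right: "\<And>x. x \<in> carrier H \<Longrightarrow>
      tensor_lift K H (\<lambda>y z. y \<otimes>\<^bsub>H\<^esub> antipode H z) (\<Delta>\<^bsub>H\<^esub> x) = \<epsilon>\<^bsub>H\<^esub> x \<odot>\<^bsub>H\<^esub> \<one>\<^bsub>H\<^esub>"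

text \<open>Structure-preserving linear maps. Compatibility with the antipodes is listed with the other
  operations; it is automatic for bialgebra maps between Hopf algebras.\<close>

definition hopf_algebra_hom ::
  "('k, 'r) ring_scheme \<Rightarrow> ('k, 'g, 'm) hopf_algebra_scheme \<Rightarrow> ('k, 'h, 'n) hopf_algebra_scheme
    \<Rightarrow> ('g \<Rightarrow> 'h) set"
  where "hopf_algebra_hom K G H =
    {f. f \<in> module_hom K G H \<and> f \<in> ring_hom G H \<and>
       (\<forall>x\<in>carrier G. \<Delta>\<^bsub>H\<^esub> (f x) = tensor_map K H H f f (\<Delta>\<^bsub>G\<^esub> x)) \<and>
       (\<forall>x\<in>carrier G. \<epsilon>\<^bsub>H\<^esub> (f x) = \<epsilon>\<^bsub>G\<^esub> x) \<and>
       (\<forall>x\<in>carrier G. f (antipode G x) = antipode H (f x))}"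

definition coideal :: "('k, 'r) ring_scheme \<Rightarrow> ('k, 'h, 'm) coalgebra_scheme \<Rightarrow> 'h set \<Rightarrow> bool"
  where "coideal K H I \<longleftrightarrow> submodule I K H \<and>
    (let HH = tensor_product K H H;
         IH = module_span K HH {pure_tensor K H H i x | i x. i \<in> I \<and> x \<in> carrier H};
         HI = module_span K HH {pure_tensor K H H x i | i x. i \<in> I \<and> x \<in> carrier H}
     in \<Delta>\<^bsub>H\<^esub> ` I \<subseteq> IH <+>\<^bsub>HH\<^esub> HI) \<and>
    (\<forall>i\<in>I. \<epsilon>\<^bsub>H\<^esub> i = \<zero>\<^bsub>K\<^esub>)"

definition hopf_ideal :: "('k, 'r) ring_scheme \<Rightarrow> ('k, 'h, 'm) hopf_algebra_scheme \<Rightarrow> 'h set \<Rightarrow> bool"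
  where "hopf_ideal K H I \<longleftrightarrow> ideal I H \<and> coideal K H I \<and> antipode H ` I \<subseteq> I"


section \<open>Hopf braces\<close>

record ('k, 'h) hopf_brace = "('k, 'h) hopf_algebra" +
  dia_mult :: "'h \<Rightarrow> 'h \<Rightarrow> 'h"  (infixl \<open>\<diamondop>\<index>\<close> 70)
  dia_one :: "'h"
  dia_antipode :: "'h \<Rightarrow> 'h"

definition diamond :: "('k, 'h) hopf_brace \<Rightarrow> ('k, 'h) hopf_algebra"
  where "diamond H =
    \<lparr>carrier = carrier H, mult = dia_mult H, one = dia_one H, zero = zero H, add = add H,
     smult = smult H, comult = comult H, counit = counit H, antipode = dia_antipode H\<rparr>"

locale hopf_brace = hopf_algebra K H + diamond: hopf_algebra K "diamond H"
  for K :: "('k, 'r) ring_scheme" and H :: "('k, 'h) hopf_brace" +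
  assumes brace: "\<And>x y z. \<lbrakk>x \<in> carrier H; y \<in> carrier H; z \<in> carrier H\<rbrakk> \<Longrightarrow>
      x \<diamondop>\<^bsub>H\<^esub> (y \<otimes>\<^bsub>H\<^esub> z) =
        tensor_lift K H (\<lambda>x\<^sub>1 x'.
          tensor_lift K H (\<lambda>x\<^sub>2 x\<^sub>3.
            (x\<^sub>1 \<diamondop>\<^bsub>H\<^esub> y) \<otimes>\<^bsub>H\<^esub> antipode H x\<^sub>2 \<otimes>\<^bsub>H\<^esub> (x\<^sub>3 \<diamondop>\<^bsub>H\<^esub> z)) (\<Delta>\<^bsub>H\<^esub> x')) (\<Delta>\<^bsub>H\<^esub> x)"

definition hopf_brace_hom ::
  "('k, 'r) ring_scheme \<Rightarrow> ('k, 'g) hopf_brace \<Rightarrow> ('k, 'h) hopf_brace \<Rightarrow> ('g \<Rightarrow> 'h) set"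
  where "hopf_brace_hom K G H =
    hopf_algebra_hom K G H \<inter> hopf_algebra_hom K (diamond G) (diamond H)"

definition hopf_brace_ideal :: "('k, 'r) ring_scheme \<Rightarrow> ('k, 'h) hopf_brace \<Rightarrow> 'h set \<Rightarrow> bool"
  where "hopf_brace_ideal K H I \<longleftrightarrow>
    coideal K H I \<and> hopf_ideal K H I \<and> hopf_ideal K (diamond H) I"

definition quotient_hopf_brace ::
  "('k, 'r) ring_scheme \<Rightarrow> ('k, 'h) hopf_brace \<Rightarrow> 'h set \<Rightarrow> ('k, 'h set) hopf_brace"
  where "quotient_hopf_brace K H I =
    (let V = quotient_module H I; \<pi> = (\<lambda>x. I +>\<^bsub>H\<^esub> x) in
     \<lparr>carrier = carrier V, mult = rcoset_mult H I, one = \<pi> \<one>\<^bsub>H\<^esub>,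
      zero = zero V, add = add V, smult = smult V,
      comult = (\<lambda>X. the_elem ((\<lambda>x. tensor_map K V V \<pi> \<pi> (\<Delta>\<^bsub>H\<^esub> x)) ` X)),
      counit = (\<lambda>X. the_elem (\<epsilon>\<^bsub>H\<^esub> ` X)),
      antipode = (\<lambda>X. the_elem ((\<lambda>x. \<pi> (antipode H x)) ` X)),
      dia_mult = rcoset_mult (diamond H) I, dia_one = \<pi> (dia_one H),
      dia_antipode = (\<lambda>X. the_elem ((\<lambda>x. \<pi> (dia_antipode H x)) ` X))\<rparr>)"

text \<open>The iterative procedure: stage \<open>n + 1\<close> is odd exactly when \<open>n\<close> is even.\<close>

primrec brace_stage :: "('k, 'h) hopf_brace \<Rightarrow> 'h set \<Rightarrow> nat \<Rightarrow> 'h set" where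
  "brace_stage H J 0 = J"
| "brace_stage H J (Suc n) =
     (if even n
      then Idl\<^bsub>H\<^esub> (\<Union>m. (antipode H ^^ m) ` brace_stage H J n)
      else Idl\<^bsub>diamond H\<^esub> (\<Union>m. (dia_antipode H ^^ m) ` brace_stage H J n))"

definition brace_closure :: "('k, 'h) hopf_brace \<Rightarrow> 'h set \<Rightarrow> 'h set"
  where "brace_closure H J = (\<Union>n. brace_stage H J n)"


section \<open>Coequalizers\<close>

text \<open>The argument \<open>TYPE('c)\<close> is the type of the elements of the test objects \<open>C\<close>; it cannot be
  quantified inside a definition. Maps out of \<open>Q\<close> are made extensional because functions that
  agree on the carrier represent the same morphism.\<close>

definition hopf_brace_coequalizer ::
  "'c itself \<Rightarrow> ('k, 'r) ring_scheme \<Rightarrow> ('k, 'a) hopf_brace \<Rightarrow> ('k, 'b) hopf_brace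
    \<Rightarrow> ('a \<Rightarrow> 'b) \<Rightarrow> ('a \<Rightarrow> 'b) \<Rightarrow> ('k, 'q) hopf_brace \<Rightarrow> ('b \<Rightarrow> 'q) \<Rightarrow> bool"
  where "hopf_brace_coequalizer (ty :: 'c itself) K A B f g Q p \<longleftrightarrow>
    hopf_brace K Q \<and> p \<in> hopf_brace_hom K B Q \<and> (\<forall>a\<in>carrier A. p (f a) = p (g a)) \<and>
    (\<forall>(C :: ('k, 'c) hopf_brace) h.
       hopf_brace K C \<and> h \<in> hopf_brace_hom K B C \<and> (\<forall>a\<in>carrier A. h (f a) = h (g a)) \<longrightarrow>
       (\<exists>!u. u \<in> hopf_brace_hom K Q C \<and> u \<in> extensional (carrier Q) \<and>
             (\<forall>b\<in>carrier B. u (p b) = h b)))"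

text \<open>The same in the full subcategory of cocommutative Hopf braces.\<close>

definition cocommutative_hopf_brace_coequalizer ::
  "'c itself \<Rightarrow> ('k, 'r) ring_scheme \<Rightarrow> ('k, 'a) hopf_brace \<Rightarrow> ('k, 'b) hopf_brace
    \<Rightarrow> ('a \<Rightarrow> 'b) \<Rightarrow> ('a \<Rightarrow> 'b) \<Rightarrow> ('k, 'q) hopf_brace \<Rightarrow> ('b \<Rightarrow> 'q) \<Rightarrow> bool"
  where "cocommutative_hopf_brace_coequalizer (ty :: 'c itself) K A B f g Q p \<longleftrightarrow>
    hopf_brace K Q \<and> cocommutative K Q \<and>
    p \<in> hopf_brace_hom K B Q \<and> (\<forall>a\<in>carrier A. p (f a) = p (g a)) \<and>
    (\<forall>(C :: ('k, 'c) hopf_brace) h.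
       hopf_brace K C \<and> cocommutative K C \<and>
       h \<in> hopf_brace_hom K B C \<and> (\<forall>a\<in>carrier A. h (f a) = h (g a)) \<longrightarrow>
       (\<exists>!u. u \<in> hopf_brace_hom K Q C \<and> u \<in> extensional (carrier Q) \<and>
             (\<forall>b\<in>carrier B. u (p b) = h b)))"

end

(* The antipodes reverse the comultiplication and preserve the counit. So for a subspace I that is
   an ideal for both products and stable under both antipodes, the elements x with
   Delta x in I (x) B + B (x) I and eps x = 0 form a set with the same closure properties. For
   I = brace_closure B I0 this set contains every f a - g a, because
   f a1 (x) f a2 - g a1 (x) g a2 = (f a1 - g a1) (x) f a2 + g a1 (x) (f a2 - g a2),
   hence it contains I, and I is a coideal. A morphism that equalizes f and g has a kernel with
   these closure properties, so it vanishes on I and factors through B/I. The Hopf brace axioms of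
   B/I and the compatibilities of the factorization are inherited along the surjection B -> B/I. *)

theory Submission
  imports Defs
begin

section \<open>Linear maps, spans and quotients\<close>

text \<open>A tensor is a coset of finitely supported functions, so a Sweedler sum over x1, x2 is a
  \<open>tensor_lift\<close> applied to the comultiplication, and it is known to be well defined
  only for a bilinear summand. Every Sweedler calculation therefore becomes a chain of equations
  between lifts, each with its own proof of bilinearity, and is finally checked on pure tensors.

  The coideal condition is not carried from stage to stage: an odd stage is built as an ideal for
  one product, an even one for the other, and neither has to be stable under all operations. The
  condition is tested against the union I, and the elements that pass the test compete with I in the
  minimality of \<open>brace_closure\<close>.

  That an antipode reverses the comultiplication follows from the uniqueness of convolution inverses
  among the linear maps from H to H \<otimes> H. The comultiplication of B/I is well defined because
  \<pi> \<otimes> \<pi> visibly kills I \<otimes> B + B \<otimes> I. Facts about one Hopf algebra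
  structure are proved once and instantiated both at \<open>H\<close> and at
  \<open>diamond H\<close>.\<close>

lemma module_homI:
  assumes "\<And>x. x \<in> carrier V \<Longrightarrow> f x \<in> carrier W"
    and "\<And>x y. \<lbrakk>x \<in> carrier V; y \<in> carrier V\<rbrakk> \<Longrightarrow> f (x \<oplus>\<^bsub>V\<^esub> y) = f x \<oplus>\<^bsub>W\<^esub> f y"
    and "\<And>a x. \<lbrakk>a \<in> carrier K; x \<in> carrier V\<rbrakk> \<Longrightarrow> f (a \<odot>\<^bsub>V\<^esub> x) = a \<odot>\<^bsub>W\<^esub> f x"
  shows "f \<in> module_hom K V W"
  using assms by (auto simp: module_hom_def hom_def)

lemma module_hom_closed: "f \<in> module_hom K V W \<Longrightarrow> x \<in> carrier V \<Longrightarrow> f x \<in> carrier W"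
  by (auto simp: module_hom_def hom_def)

lemma module_hom_add:
  "f \<in> module_hom K V W \<Longrightarrow> x \<in> carrier V \<Longrightarrow> y \<in> carrier V \<Longrightarrow> f (x \<oplus>\<^bsub>V\<^esub> y) = f x \<oplus>\<^bsub>W\<^esub> f y"
  by (auto simp: module_hom_def hom_def)

lemma module_hom_smult:
  "f \<in> module_hom K V W \<Longrightarrow> a \<in> carrier K \<Longrightarrow> x \<in> carrier V \<Longrightarrow> f (a \<odot>\<^bsub>V\<^esub> x) = a \<odot>\<^bsub>W\<^esub> f x"
  by (auto simp: module_hom_def)

text \<open>\<open>module_hom\<close> speaks only of sums and scalars, so the zero is reached as the
  multiple of itself by the scalar 0.\<close>

lemma module_hom_zero:
  assumes "module K V" "module K W" "f \<in> module_hom K V W"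
  shows "f \<zero>\<^bsub>V\<^esub> = \<zero>\<^bsub>W\<^esub>"
proof -
  interpret V: module K V by fact
  interpret W: module K W by fact
  have "f (\<zero>\<^bsub>K\<^esub> \<odot>\<^bsub>V\<^esub> \<zero>\<^bsub>V\<^esub>) = \<zero>\<^bsub>K\<^esub> \<odot>\<^bsub>W\<^esub> f \<zero>\<^bsub>V\<^esub>"
    using assms(3) by (rule module_hom_smult) auto
  then show ?thesis
    using module_hom_closed[OF assms(3) V.M.zero_closed] by simp
qed

lemma module_hom_a_inv:
  assumes "module K V" "module K W" "f \<in> module_hom K V W" "x \<in> carrier V"
  shows "f (\<ominus>\<^bsub>V\<^esub> x) = \<ominus>\<^bsub>W\<^esub> f x"
proof -
  interpret V: module K V by fact
  interpret W: module K W by fact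
  have "f (\<ominus>\<^bsub>V\<^esub> x) \<oplus>\<^bsub>W\<^esub> f x = f (\<ominus>\<^bsub>V\<^esub> x \<oplus>\<^bsub>V\<^esub> x)"
    using assms by (simp add: module_hom_add)
  also have "\<dots> = \<zero>\<^bsub>W\<^esub>"
    using assms V.M.l_neg module_hom_zero by metis
  finally show ?thesis
    using assms module_hom_closed[OF assms(3)] by (simp add: W.M.minus_equality)
qed

lemma module_hom_minus:
  assumes "module K V" "module K W" "f \<in> module_hom K V W" "x \<in> carrier V" "y \<in> carrier V"
  shows "f (x \<ominus>\<^bsub>V\<^esub> y) = f x \<ominus>\<^bsub>W\<^esub> f y"
proof -
  interpret V: module K V by fact
  show ?thesis
    using assms by (simp add: a_minus_def module_hom_add[OF assms(3)] module_hom_a_inv[OF assms(1-3)])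
qed

text \<open>The carrier of \<open>V\<close> is closed under the operations; this is why agreement on
  the carrier suffices also at sums and multiples.\<close>

lemma module_hom_cong:
  assumes "module K V" "\<And>x. x \<in> carrier V \<Longrightarrow> f x = g x"
  shows "f \<in> module_hom K V W \<longleftrightarrow> g \<in> module_hom K V W"
proof -
  interpret V: module K V by fact
  show ?thesis
    using assms(2) by (auto simp: module_hom_def hom_def Pi_def)
qed

lemma module_hom_comp:
  assumes "f \<in> module_hom K U V" "g \<in> module_hom K V W"
  shows "(\<lambda>x. g (f x)) \<in> module_hom K U W"
  using assms by (auto intro!: module_homI
      simp: module_hom_closed[OF assms(1)] module_hom_closed[OF assms(2)]
            module_hom_add[OF assms(1)] module_hom_add[OF assms(2)]
            module_hom_smult[OF assms(1)] module_hom_smult[OF assms(2)])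

lemma module_hom_add_fun:
  assumes "module K W" "f \<in> module_hom K V W" "g \<in> module_hom K V W"
  shows "(\<lambda>x. f x \<oplus>\<^bsub>W\<^esub> g x) \<in> module_hom K V W"
proof -
  interpret W: module K W by fact
  show ?thesis
    by (rule module_homI)
      (use assms in \<open>auto simp: module_hom_closed module_hom_add module_hom_smult
         W.smult_r_distr W.M.add.m_ac\<close>)
qed

lemma module_hom_smult_fun:
  assumes "module K W" "f \<in> module_hom K V W" "a \<in> carrier K"
  shows "(\<lambda>x. a \<odot>\<^bsub>W\<^esub> f x) \<in> module_hom K V W"
proof -
  interpret W: module K W by fact
  show ?thesis
    by (rule module_homI)
      (use assms in \<open>auto simp: module_hom_closed module_hom_add module_hom_smult
         W.smult_r_distr W.smult_assoc1[symmetric] W.R.m_comm\<close>)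
qed

lemma module_hom_id: "(\<lambda>x. x) \<in> module_hom K V V"
  by (auto intro: module_homI)

lemma (in abelian_group) minus_eq_zero_iff:
  "x \<in> carrier G \<Longrightarrow> y \<in> carrier G \<Longrightarrow> x \<ominus> y = \<zero> \<longleftrightarrow> x = y"
  using add.inv_solve_right[of \<zero> x y] by (auto simp: a_minus_def)

section \<open>Submodules, their sums, and spans\<close>

lemma submodule_zero: "submodule N K V \<Longrightarrow> \<zero>\<^bsub>V\<^esub> \<in> N"
  using subgroup.one_closed[OF submodule.axioms(1)] by force

text \<open>This is how spans are handled throughout: a linear map sends a span into
  \<open>N\<close> as soon as the preimage of \<open>N\<close>, a submodule, contains the
  generators.\<close>

lemma submodule_vimage:
  assumes "module K V" "module K W" "f \<in> module_hom K V W" "submodule N K W"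
  shows "submodule {x \<in> carrier V. f x \<in> N} K V"
proof -
  interpret V: module K V by fact
  interpret W: module K W by fact
  note N = W.submoduleE[OF assms(4)] submodule_zero[OF assms(4)]
  show ?thesis
    by (rule V.submoduleI)
      (use N assms(3) in \<open>auto simp: module_hom_zero[OF assms(1-3)] module_hom_a_inv[OF assms(1-3)]
         module_hom_add module_hom_smult\<close>)
qed

lemma submodule_zero_singleton:
  assumes "module K V"
  shows "submodule {\<zero>\<^bsub>V\<^esub>} K V"
proof -
  interpret V: module K V by fact
  show ?thesis by (rule V.submoduleI) auto
qed

lemma submodule_Int:
  assumes "module K V" "submodule M K V" "submodule N K V"
  shows "submodule (M \<inter> N) K V"
proof -
  interpret V: module K V by fact
  show ?thesis
    by (rule V.submoduleI)
      (use V.submoduleE[OF assms(2)] V.submoduleE[OF assms(3)] submodule_zero[OF assms(2)]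
         submodule_zero[OF assms(3)] in auto)
qed

lemma set_addI: "m \<in> M \<Longrightarrow> n \<in> N \<Longrightarrow> m \<oplus>\<^bsub>V\<^esub> n \<in> M <+>\<^bsub>V\<^esub> N"
  by (auto simp: set_add_def')

lemma submodule_set_add:
  assumes "module K V" "submodule M K V" "submodule N K V"
  shows "submodule (M <+>\<^bsub>V\<^esub> N) K V"
proof -
  interpret V: module K V by fact
  note M = V.submoduleE[OF assms(2)] submodule_zero[OF assms(2)]
  note N = V.submoduleE[OF assms(3)] submodule_zero[OF assms(3)]
  have MN: "\<And>x. x \<in> M \<Longrightarrow> x \<in> carrier V" "\<And>x. x \<in> N \<Longrightarrow> x \<in> carrier V"
    using M(1) N(1) by auto
  show ?thesis
  proof (rule V.submoduleI)
    show "M <+>\<^bsub>V\<^esub> N \<subseteq> carrier V"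
      using MN by (auto simp: set_add_def')
    show "\<zero>\<^bsub>V\<^esub> \<in> M <+>\<^bsub>V\<^esub> N"
      using M N by (force simp: set_add_def')
  next
    fix x assume "x \<in> M <+>\<^bsub>V\<^esub> N"
    then obtain m n where *: "m \<in> M" "n \<in> N" "x = m \<oplus>\<^bsub>V\<^esub> n"
      by (auto simp: set_add_def')
    then have "\<ominus>\<^bsub>V\<^esub> x = \<ominus>\<^bsub>V\<^esub> m \<oplus>\<^bsub>V\<^esub> \<ominus>\<^bsub>V\<^esub> n"
      using MN by (simp add: V.M.minus_add)
    then show "\<ominus>\<^bsub>V\<^esub> x \<in> M <+>\<^bsub>V\<^esub> N"
      using * M N by (auto intro!: set_addI)
    fix a assume a: "a \<in> carrier K"
    then have "a \<odot>\<^bsub>V\<^esub> x = a \<odot>\<^bsub>V\<^esub> m \<oplus>\<^bsub>V\<^esub> a \<odot>\<^bsub>V\<^esub> n"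
      using MN * by (simp add: V.smult_r_distr)
    then show "a \<odot>\<^bsub>V\<^esub> x \<in> M <+>\<^bsub>V\<^esub> N"
      using * M N a by (auto intro!: set_addI)
  next
    fix x y assume "x \<in> M <+>\<^bsub>V\<^esub> N" "y \<in> M <+>\<^bsub>V\<^esub> N"
    then obtain m n m' n' where *: "m \<in> M" "n \<in> N" "x = m \<oplus>\<^bsub>V\<^esub> n"
        "m' \<in> M" "n' \<in> N" "y = m' \<oplus>\<^bsub>V\<^esub> n'"
      by (auto simp: set_add_def')
    then have "x \<oplus>\<^bsub>V\<^esub> y = (m \<oplus>\<^bsub>V\<^esub> m') \<oplus>\<^bsub>V\<^esub> (n \<oplus>\<^bsub>V\<^esub> n')"
      using MN by (simp add: V.M.add.m_ac)
    then show "x \<oplus>\<^bsub>V\<^esub> y \<in> M <+>\<^bsub>V\<^esub> N"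
      using * M N by (auto intro!: set_addI)
  qed
qed

lemma subset_set_add:
  assumes "module K V" "submodule M K V" "submodule N K V"
  shows "M \<subseteq> M <+>\<^bsub>V\<^esub> N" "N \<subseteq> M <+>\<^bsub>V\<^esub> N"
proof -
  interpret V: module K V by fact
  have "x \<in> M <+>\<^bsub>V\<^esub> N" if "x \<in> M" for x
  proof -
    have "x = x \<oplus>\<^bsub>V\<^esub> \<zero>\<^bsub>V\<^esub>"
      using that V.submoduleE(1)[OF assms(2)] by auto
    then show ?thesis
      using that submodule_zero[OF assms(3)] by (auto simp: set_add_def')
  qed
  moreover have "x \<in> M <+>\<^bsub>V\<^esub> N" if "x \<in> N" for x
  proof -
    have "x = \<zero>\<^bsub>V\<^esub> \<oplus>\<^bsub>V\<^esub> x"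
      using that V.submoduleE(1)[OF assms(3)] by auto
    then show ?thesis
      using that submodule_zero[OF assms(2)] by (auto simp: set_add_def')
  qed
  ultimately show "M \<subseteq> M <+>\<^bsub>V\<^esub> N" "N \<subseteq> M <+>\<^bsub>V\<^esub> N"
    by auto
qed

lemma module_span_incl: "X \<subseteq> module_span K V X"
  by (auto simp: module_span_def)

lemma module_span_least: "submodule N K V \<Longrightarrow> X \<subseteq> N \<Longrightarrow> module_span K V X \<subseteq> N"
  by (auto simp: module_span_def)

lemma module_span_submodule:
  assumes "module K V" "X \<subseteq> carrier V"
  shows "submodule (module_span K V X) K V"
proof -
  interpret V: module K V by fact
  \<comment> \<open>The carrier is a member of the intersected family, because it contains
    \<open>X\<close>. Hence the intersection lies in the carrier.\<close>
  have "submodule (carrier V) K V" by (rule V.carrier_is_submodule)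
  then show ?thesis
    using assms(2) unfolding module_span_def
    by (intro V.submoduleI)
      (auto simp: submodule_zero intro: V.submoduleE)
qed

section \<open>Module and ring axioms along surjections\<close>

lemma module_surj_image:
  assumes "module K V" "p \<in> module_hom K V W" "p ` carrier V = carrier W" "p \<zero>\<^bsub>V\<^esub> = \<zero>\<^bsub>W\<^esub>"
  shows "module K W"
proof -
  interpret V: module K V by fact
  \<comment> \<open>The equations are oriented from \<open>W\<close> back to \<open>V\<close>, so
    that each axiom becomes the image of the same axiom in \<open>V\<close>. The equation for zero
    comes from an assumption: \<open>W\<close> is not yet known to be a module, so
    \<open>module_hom_zero\<close> does not apply.\<close>
  note hom = module_hom_closed[OF assms(2)]
    module_hom_add[OF assms(2), symmetric] module_hom_smult[OF assms(2), symmetric]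
    assms(4)[symmetric]
  have sur: "\<exists>x\<in>carrier V. y = p x" if "y \<in> carrier W" for y
    using that assms(3) by auto
  have ag: "abelian_group W"
  proof (rule abelian_groupI)
    fix x assume "x \<in> carrier W"
    then obtain x' where "x' \<in> carrier V" "x = p x'" using sur by blast
    then show "\<exists>y\<in>carrier W. y \<oplus>\<^bsub>W\<^esub> x = \<zero>\<^bsub>W\<^esub>"
      by (intro bexI[of _ "p (\<ominus>\<^bsub>V\<^esub> x')"]) (auto simp: hom V.M.l_neg)
  qed (auto dest!: sur simp: hom V.M.add.m_ac)
  show ?thesis
    by (rule moduleI)
      (auto dest!: sur intro: ag V.R.is_cring
        simp: hom V.smult_l_distr V.smult_r_distr V.smult_assoc1)
qed

lemma ring_surj_image:
  assumes "ring R" "p \<in> ring_hom R S" "p ` carrier R = carrier S" "p \<zero>\<^bsub>R\<^esub> = \<zero>\<^bsub>S\<^esub>"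
  shows "ring S"
proof -
  interpret R: ring R by fact
  note hom = ring_hom_closed[OF assms(2)] ring_hom_add[OF assms(2), symmetric]
    ring_hom_mult[OF assms(2), symmetric] ring_hom_one[OF assms(2), symmetric] assms(4)[symmetric]
  have sur: "\<exists>x\<in>carrier R. y = p x" if "y \<in> carrier S" for y
    using that assms(3) by auto
  have "abelian_group S"
  proof (rule abelian_groupI)
    fix x assume "x \<in> carrier S"
    then obtain x' where "x' \<in> carrier R" "x = p x'" using sur by blast
    then show "\<exists>y\<in>carrier S. y \<oplus>\<^bsub>S\<^esub> x = \<zero>\<^bsub>S\<^esub>"
      by (intro bexI[of _ "p (\<ominus>\<^bsub>R\<^esub> x')"]) (auto simp: hom R.l_neg)
  qed (auto dest!: sur simp: hom R.add.m_ac)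
  moreover have "monoid S"
    by (rule monoidI) (auto dest!: sur simp: hom R.m_assoc)
  ultimately show ?thesis
    by (rule ringI) (auto dest!: sur simp: hom R.l_distr R.r_distr)
qed

section \<open>Quotients of modules\<close>

locale module_quotient = module K V for K (structure) and V (structure) +
  fixes N
  assumes submodule: "submodule N K V"
begin

sublocale N: abelian_subgroup N V
  by (rule abelian_subgroupI3) (use submodule in \<open>auto intro!: additive_subgroupI submodule.axioms(1) abelian_group_axioms\<close>)

lemma coset_eq_iff:
  assumes "x \<in> carrier V" "y \<in> carrier V"
  shows "N +>\<^bsub>V\<^esub> x = N +>\<^bsub>V\<^esub> y \<longleftrightarrow> x \<ominus>\<^bsub>V\<^esub> y \<in> N"
  using assms N.a_rcos_module[of y x] N.a_repr_independence'[of x y] N.a_rcos_self[of x]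
  by (auto simp: a_minus_def)

lemma mem_coset_iff:
  assumes "y \<in> carrier V"
  shows "x \<in> N +>\<^bsub>V\<^esub> y \<longleftrightarrow> x \<in> carrier V \<and> N +>\<^bsub>V\<^esub> x = N +>\<^bsub>V\<^esub> y"
  using assms N.a_repr_independence'[of x y] N.a_rcos_self[of x] N.a_elemrcos_carrier[of y x]
  by auto

text \<open>Scalar multiplication in a quotient, \<open>tensor_lift\<close> and the coalgebra
  operations of a quotient brace are all given as \<open>the_elem\<close> of the image of a coset.
  Such an expression is well defined when the function is constant on the coset.\<close>

lemma image_coset:
  assumes "y \<in> carrier V"
    and "\<And>x. x \<in> carrier V \<Longrightarrow> N +>\<^bsub>V\<^esub> x = N +>\<^bsub>V\<^esub> y \<Longrightarrow> f x = f y"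
  shows "the_elem (f ` (N +>\<^bsub>V\<^esub> y)) = f y"
proof -
  have "f x = f y" if "x \<in> N +>\<^bsub>V\<^esub> y" for x
    using assms that mem_coset_iff by blast
  moreover have "y \<in> N +>\<^bsub>V\<^esub> y"
    using assms(1) N.a_rcos_self by blast
  ultimately have "f ` (N +>\<^bsub>V\<^esub> y) = {f y}"
    by blast
  then show ?thesis by simp
qed

text \<open>Two representatives differ by an element of \<open>N\<close>, which a linear map killing
  \<open>N\<close> does not see.\<close>

lemma image_coset_hom:
  assumes "module K W" "f \<in> module_hom K V W" "\<And>n. n \<in> N \<Longrightarrow> f n = \<zero>\<^bsub>W\<^esub>" "y \<in> carrier V"
  shows "the_elem (f ` (N +>\<^bsub>V\<^esub> y)) = f y"
proof (rule image_coset)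
  interpret W: module K W by fact
  fix x assume *: "x \<in> carrier V" "N +>\<^bsub>V\<^esub> x = N +>\<^bsub>V\<^esub> y"
  then have "f (x \<ominus>\<^bsub>V\<^esub> y) = \<zero>\<^bsub>W\<^esub>"
    using coset_eq_iff[of x y] assms by auto
  then show "f x = f y"
    using * assms by (simp add: module_hom_minus[OF module_axioms assms(1)] module_hom_closed[OF assms(2)]
      W.M.minus_eq_zero_iff)
qed fact

lemma quotient_carrier: "carrier (quotient_module V N) = (\<lambda>x. N +>\<^bsub>V\<^esub> x) ` carrier V"
  by (auto simp: quotient_module_def A_RCOSETS_def')

lemma quotient_add:
  "x \<in> carrier V \<Longrightarrow> y \<in> carrier V \<Longrightarrow>
    (N +>\<^bsub>V\<^esub> x) \<oplus>\<^bsub>quotient_module V N\<^esub> (N +>\<^bsub>V\<^esub> y) = N +>\<^bsub>V\<^esub> (x \<oplus>\<^bsub>V\<^esub> y)"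
  by (simp add: quotient_module_def N.a_rcos_sum)

lemma quotient_zero: "\<zero>\<^bsub>quotient_module V N\<^esub> = N +>\<^bsub>V\<^esub> \<zero>\<^bsub>V\<^esub>"
  using N.a_subset by (simp add: quotient_module_def)

lemma quotient_smult:
  assumes "a \<in> carrier K" "x \<in> carrier V"
  shows "a \<odot>\<^bsub>quotient_module V N\<^esub> (N +>\<^bsub>V\<^esub> x) = N +>\<^bsub>V\<^esub> (a \<odot>\<^bsub>V\<^esub> x)"
proof -
  have "the_elem ((\<lambda>x. N +>\<^bsub>V\<^esub> a \<odot>\<^bsub>V\<^esub> x) ` (N +>\<^bsub>V\<^esub> x)) = N +>\<^bsub>V\<^esub> a \<odot>\<^bsub>V\<^esub> x"
  proof (rule image_coset)
    fix y assume y: "y \<in> carrier V" "N +>\<^bsub>V\<^esub> y = N +>\<^bsub>V\<^esub> x"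
    then have "a \<odot>\<^bsub>V\<^esub> (y \<ominus>\<^bsub>V\<^esub> x) \<in> N"
      using coset_eq_iff assms submodule.smult_closed[OF submodule] by auto
    moreover have "a \<odot>\<^bsub>V\<^esub> (y \<ominus>\<^bsub>V\<^esub> x) = a \<odot>\<^bsub>V\<^esub> y \<ominus>\<^bsub>V\<^esub> a \<odot>\<^bsub>V\<^esub> x"
      using y assms by (simp add: a_minus_def smult_r_distr smult_r_minus)
    ultimately show "N +>\<^bsub>V\<^esub> a \<odot>\<^bsub>V\<^esub> y = N +>\<^bsub>V\<^esub> a \<odot>\<^bsub>V\<^esub> x"
      using coset_eq_iff assms y by simp
  qed fact
  then show ?thesis
    by (simp add: quotient_module_def quotient_smult_def)
qed

lemma projection_hom: "(\<lambda>x. N +>\<^bsub>V\<^esub> x) \<in> module_hom K V (quotient_module V N)"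
  by (rule module_homI) (auto simp: quotient_carrier quotient_add quotient_smult)

lemma quotient_is_module: "module K (quotient_module V N)"
  by (rule module_surj_image[OF module_axioms projection_hom])
    (simp_all add: quotient_carrier quotient_zero)

end

section \<open>Tensor products\<close>

lemma free_module_module:
  assumes "cring K"
  shows "module K (free_module K X)"
proof -
  interpret K: cring K by fact
  let ?F = "free_module K X"
  \<comment> \<open>The support of a pointwise combination lies in the union of the two supports
    because \<open>h\<close> preserves 0. Sum, negation and scalar multiplication are all instances;
    the last two ignore the second argument.\<close>
  have fin: "finite {x. h (r x) (s x) \<noteq> \<zero>\<^bsub>K\<^esub>}"
    if "finite {x. r x \<noteq> \<zero>\<^bsub>K\<^esub>}" "finite {x. s x \<noteq> \<zero>\<^bsub>K\<^esub>}" "h \<zero>\<^bsub>K\<^esub> \<zero>\<^bsub>K\<^esub> = \<zero>\<^bsub>K\<^esub>"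
    for r s and h :: "'a \<Rightarrow> 'a \<Rightarrow> 'a"
    by (rule finite_subset[OF _ finite_UnI[OF that(1,2)]]) (use that(3) in force)
  have ag: "abelian_group ?F"
  proof (rule abelian_groupI)
    fix r assume r: "r \<in> carrier ?F"
    show "\<exists>s\<in>carrier ?F. s \<oplus>\<^bsub>?F\<^esub> r = \<zero>\<^bsub>?F\<^esub>"
      by (rule bexI[of _ "\<lambda>x. \<ominus>\<^bsub>K\<^esub> r x"])
        (use r fin[of r r "\<lambda>a b. \<ominus>\<^bsub>K\<^esub> a"] in \<open>auto simp: free_module_def fun_eq_iff K.l_neg\<close>)
  qed (use fin[of _ _ "\<lambda>a b. a \<oplus>\<^bsub>K\<^esub> b"] in \<open>auto simp: free_module_def fun_eq_iff K.add.m_ac\<close>)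
  show ?thesis
  proof (rule moduleI[OF assms ag])
    fix a r assume "a \<in> carrier K" "r \<in> carrier ?F"
    then show "a \<odot>\<^bsub>?F\<^esub> r \<in> carrier ?F"
      using fin[of r r "\<lambda>b c. a \<otimes>\<^bsub>K\<^esub> b"] by (auto simp: free_module_def)
  qed (auto simp: free_module_def fun_eq_iff K.l_distr K.r_distr K.m_assoc)
qed

lemma free_gen_carrier:
  assumes "cring K" "x \<in> X"
  shows "free_gen K x \<in> carrier (free_module K X)"
proof -
  interpret K: cring K by fact
  have "finite {y. free_gen K x y \<noteq> \<zero>\<^bsub>K\<^esub>}"
    by (rule finite_subset[of _ "{x}"]) (auto simp: free_gen_def)
  then show ?thesis
    using assms(2) by (auto simp: free_module_def free_gen_def)
qed

lemma free_gen_pair_carrier: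
  "\<lbrakk>cring K; v \<in> V; w \<in> W\<rbrakk> \<Longrightarrow> free_gen K (v, w) \<in> carrier (free_module K (V \<times> W))"
  by (rule free_gen_carrier) auto

text \<open>This is the sum inside \<open>tensor_lift\<close>, before the passage to cosets. On the
  free module its linearity can be proved without any condition of bilinearity.\<close>

definition free_lift ::
  "('k, 'r) ring_scheme \<Rightarrow> ('k, 'u, 'm) module_scheme \<Rightarrow> ('x \<Rightarrow> 'u) \<Rightarrow> ('x \<Rightarrow> 'k) \<Rightarrow> 'u"
  where "free_lift K U \<phi> r = (\<Oplus>\<^bsub>U\<^esub>p\<in>{p. r p \<noteq> \<zero>\<^bsub>K\<^esub>}. r p \<odot>\<^bsub>U\<^esub> \<phi> p)"

text \<open>Cancellation can make the support of a sum smaller than the union of the supports.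
  Additivity is therefore proved over a common finite index set, where the extra terms are
  zero.\<close>

lemma free_lift_superset:
  assumes "module K U" "r \<in> carrier (free_module K X)" "\<phi> \<in> X \<rightarrow> carrier U"
    and "finite A" "A \<subseteq> X" "{p. r p \<noteq> \<zero>\<^bsub>K\<^esub>} \<subseteq> A"
  shows "free_lift K U \<phi> r = (\<Oplus>\<^bsub>U\<^esub>p\<in>A. r p \<odot>\<^bsub>U\<^esub> \<phi> p)"
proof -
  interpret U: module K U by fact
  have "r p \<odot>\<^bsub>U\<^esub> \<phi> p \<in> carrier U" if "p \<in> A" for p
    using assms that by (auto simp: free_module_def Pi_def)
  moreover have "r p \<odot>\<^bsub>U\<^esub> \<phi> p = \<zero>\<^bsub>U\<^esub>" if "p \<in> A - {p. r p \<noteq> \<zero>\<^bsub>K\<^esub>}" for p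
  proof -
    have "\<phi> p \<in> carrier U" "r p = \<zero>\<^bsub>K\<^esub>" using assms that by auto
    then show ?thesis by simp
  qed
  ultimately show ?thesis
    unfolding free_lift_def
    using assms(4,6) by (intro U.M.add.finprod_mono_neutral_cong_left) auto
qed

lemma free_lift_hom:
  assumes "module K U" "\<phi> \<in> X \<rightarrow> carrier U"
  shows "free_lift K U \<phi> \<in> module_hom K (free_module K X) U"
proof -
  interpret U: module K U by fact
  let ?F = "free_module K X"
  interpret F: module K ?F by (rule free_module_module) (rule U.R.is_cring)
  let ?supp = "\<lambda>r. {p. r p \<noteq> \<zero>\<^bsub>K\<^esub>}"
  have supp: "finite (?supp r)" "?supp r \<subseteq> X" if "r \<in> carrier ?F" for r
    using that by (auto simp: free_module_def)
  have val: "r p \<in> carrier K" if "r \<in> carrier ?F" for r p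
    using that by (auto simp: free_module_def)
  have cl: "r p \<odot>\<^bsub>U\<^esub> \<phi> p \<in> carrier U" if "r \<in> carrier ?F" "p \<in> X" for r p
    using that assms val by auto
  show ?thesis
  proof (rule module_homI)
    fix r assume r: "r \<in> carrier ?F"
    then show "free_lift K U \<phi> r \<in> carrier U"
      unfolding free_lift_def using cl[OF r] supp[OF r] by (intro U.M.finsum_closed) (auto simp: subset_eq)
    fix s assume s: "s \<in> carrier ?F"
    let ?A = "?supp r \<union> ?supp s"
    have A: "finite ?A" "?A \<subseteq> X"
      using supp[OF r] supp[OF s] by auto
    have "?supp (r \<oplus>\<^bsub>?F\<^esub> s) \<subseteq> ?A"
      by (auto simp: free_module_def)
    then have "free_lift K U \<phi> (r \<oplus>\<^bsub>?F\<^esub> s) = (\<Oplus>\<^bsub>U\<^esub>p\<in>?A. (r \<oplus>\<^bsub>?F\<^esub> s) p \<odot>\<^bsub>U\<^esub> \<phi> p)"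
      using A assms r s by (intro free_lift_superset) auto
    also have "\<dots> = (\<Oplus>\<^bsub>U\<^esub>p\<in>?A. r p \<odot>\<^bsub>U\<^esub> \<phi> p \<oplus>\<^bsub>U\<^esub> s p \<odot>\<^bsub>U\<^esub> \<phi> p)"
    proof (rule U.M.add.finprod_cong')
      fix p assume "p \<in> ?A"
      then have "p \<in> X" using A by auto
      then have "\<phi> p \<in> carrier U" using assms by auto
      then show "(r \<oplus>\<^bsub>?F\<^esub> s) p \<odot>\<^bsub>U\<^esub> \<phi> p = r p \<odot>\<^bsub>U\<^esub> \<phi> p \<oplus>\<^bsub>U\<^esub> s p \<odot>\<^bsub>U\<^esub> \<phi> p"
        using val r s U.smult_l_distr[of "r p" "s p" "\<phi> p"] by (simp add: free_module_def)
    qed (use A cl r s in auto)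
    also have "\<dots> = (\<Oplus>\<^bsub>U\<^esub>p\<in>?A. r p \<odot>\<^bsub>U\<^esub> \<phi> p) \<oplus>\<^bsub>U\<^esub> (\<Oplus>\<^bsub>U\<^esub>p\<in>?A. s p \<odot>\<^bsub>U\<^esub> \<phi> p)"
      using A cl r s by (intro U.M.add.finprod_multf) auto
    also have "\<dots> = free_lift K U \<phi> r \<oplus>\<^bsub>U\<^esub> free_lift K U \<phi> s"
      using free_lift_superset[OF assms(1) r assms(2) A] free_lift_superset[OF assms(1) s assms(2) A]
      by auto
    finally show "free_lift K U \<phi> (r \<oplus>\<^bsub>?F\<^esub> s) = free_lift K U \<phi> r \<oplus>\<^bsub>U\<^esub> free_lift K U \<phi> s" .
  next
    fix a r assume a: "a \<in> carrier K" and r: "r \<in> carrier ?F"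
    note A = supp[OF r]
    have "?supp (a \<odot>\<^bsub>?F\<^esub> r) \<subseteq> ?supp r"
      using a by (auto simp: free_module_def)
    then have "free_lift K U \<phi> (a \<odot>\<^bsub>?F\<^esub> r) = (\<Oplus>\<^bsub>U\<^esub>p\<in>?supp r. (a \<odot>\<^bsub>?F\<^esub> r) p \<odot>\<^bsub>U\<^esub> \<phi> p)"
      using A assms r a by (intro free_lift_superset) auto
    also have "\<dots> = (\<Oplus>\<^bsub>U\<^esub>p\<in>?supp r. a \<odot>\<^bsub>U\<^esub> (r p \<odot>\<^bsub>U\<^esub> \<phi> p))"
    proof (rule U.M.add.finprod_cong')
      fix p assume "p \<in> ?supp r"
      then have "p \<in> X" using A by auto
      then have "\<phi> p \<in> carrier U" using assms by auto
      then show "(a \<odot>\<^bsub>?F\<^esub> r) p \<odot>\<^bsub>U\<^esub> \<phi> p = a \<odot>\<^bsub>U\<^esub> (r p \<odot>\<^bsub>U\<^esub> \<phi> p)"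
        using val r a U.smult_assoc1[of a "r p" "\<phi> p"] by (simp add: free_module_def)
    qed (use A cl r a in auto)
    also have "\<dots> = a \<odot>\<^bsub>U\<^esub> (\<Oplus>\<^bsub>U\<^esub>p\<in>?supp r. r p \<odot>\<^bsub>U\<^esub> \<phi> p)"
      using A cl r a by (intro U.finsum_smult_ldistr[symmetric]) auto
    finally show "free_lift K U \<phi> (a \<odot>\<^bsub>?F\<^esub> r) = a \<odot>\<^bsub>U\<^esub> free_lift K U \<phi> r"
      by (simp add: free_lift_def)
  qed
qed

lemma free_lift_gen:
  assumes "module K U" "\<phi> \<in> X \<rightarrow> carrier U" "x \<in> X"
  shows "free_lift K U \<phi> (free_gen K x) = \<phi> x"
proof -
  interpret U: module K U by fact
  have "\<phi> x \<in> carrier U" using assms by auto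
  moreover have "free_lift K U \<phi> (free_gen K x) = (\<Oplus>\<^bsub>U\<^esub>p\<in>{x}. free_gen K x p \<odot>\<^bsub>U\<^esub> \<phi> p)"
    by (rule free_lift_superset[OF assms(1) free_gen_carrier[OF U.R.is_cring assms(3)] assms(2)])
      (use assms(3) in \<open>auto simp: free_gen_def\<close>)
  ultimately show ?thesis
    by (simp add: free_gen_def U.M.add.finprod_insert)
qed

text \<open>Induction on the finite support. Since the generators carry a coefficient, no separate
  case for scalar multiples arises.\<close>

lemma free_module_induct [consumes 2, case_names zero add gen]:
  assumes "cring K" "r \<in> carrier (free_module K X)"
    and zero: "P \<zero>\<^bsub>free_module K X\<^esub>"
    and add: "\<And>r s. \<lbrakk>r \<in> carrier (free_module K X); s \<in> carrier (free_module K X); P r; P s\<rbrakk>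
      \<Longrightarrow> P (r \<oplus>\<^bsub>free_module K X\<^esub> s)"
    and gen: "\<And>a x. \<lbrakk>a \<in> carrier K; x \<in> X\<rbrakk> \<Longrightarrow> P (a \<odot>\<^bsub>free_module K X\<^esub> free_gen K x)"
  shows "P r"
proof -
  interpret K: cring K by fact
  let ?F = "free_module K X"
  interpret F: module K ?F by (rule free_module_module) fact
  have "P r" if "finite A" "r \<in> carrier ?F" "{p. r p \<noteq> \<zero>\<^bsub>K\<^esub>} = A" for A r
    using that
  proof (induction A arbitrary: r rule: finite_induct)
    case empty
    then have "r = \<zero>\<^bsub>?F\<^esub>"
      by (auto simp: free_module_def fun_eq_iff)
    then show ?case using zero by simp
  next
    case (insert x A)
    \<comment> \<open>\<open>?s\<close> is \<open>r\<close> with its value at \<open>x\<close>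
      erased, so its support is \<open>A\<close> and the induction hypothesis applies;
      \<open>?e\<close> restores the erased term.\<close>
    let ?s = "r(x := \<zero>\<^bsub>K\<^esub>)" and ?e = "r x \<odot>\<^bsub>?F\<^esub> free_gen K x"
    have x: "x \<in> X" "r x \<in> carrier K"
      using insert.prems by (auto simp: free_module_def)
    have supp: "{p. ?s p \<noteq> \<zero>\<^bsub>K\<^esub>} = A"
      using insert by auto
    moreover have s: "?s \<in> carrier ?F"
      using insert.prems(1) supp insert.hyps(1) by (auto simp: free_module_def)
    ultimately have "P ?s"
      using insert.IH by blast
    moreover have "r = ?s \<oplus>\<^bsub>?F\<^esub> ?e"
    proof
      fix y
      have "r y \<in> carrier K"
        using insert.prems(1) by (auto simp: free_module_def)
      then show "r y = (?s \<oplus>\<^bsub>?F\<^esub> ?e) y"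
        using x by (simp add: free_module_def free_gen_def)
    qed
    moreover have "?e \<in> carrier ?F"
      using x free_gen_carrier[OF assms(1) x(1)] by simp
    ultimately show ?case
      using add[of ?s ?e] gen x s by simp
  qed
  then show ?thesis
    using assms(2) by (auto simp: free_module_def)
qed

section \<open>Bilinear maps\<close>

definition bilinear ::
  "('k, 'r) ring_scheme \<Rightarrow> ('k, 'v, 'm) module_scheme \<Rightarrow> ('k, 'w, 'n) module_scheme
    \<Rightarrow> ('k, 'u, 'o) module_scheme \<Rightarrow> ('v \<Rightarrow> 'w \<Rightarrow> 'u) \<Rightarrow> bool"
  where "bilinear K V W U \<phi> \<longleftrightarrow>
    (\<forall>v\<in>carrier V. (\<lambda>w. \<phi> v w) \<in> module_hom K W U) \<and>
    (\<forall>w\<in>carrier W. (\<lambda>v. \<phi> v w) \<in> module_hom K V U)"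

lemma bilinearI:
  assumes "\<And>v. v \<in> carrier V \<Longrightarrow> (\<lambda>w. \<phi> v w) \<in> module_hom K W U"
    and "\<And>w. w \<in> carrier W \<Longrightarrow> (\<lambda>v. \<phi> v w) \<in> module_hom K V U"
  shows "bilinear K V W U \<phi>"
  using assms by (auto simp: bilinear_def)

lemma bilinear_right: "bilinear K V W U \<phi> \<Longrightarrow> v \<in> carrier V \<Longrightarrow> (\<lambda>w. \<phi> v w) \<in> module_hom K W U"
  and bilinear_left: "bilinear K V W U \<phi> \<Longrightarrow> w \<in> carrier W \<Longrightarrow> (\<lambda>v. \<phi> v w) \<in> module_hom K V U"
  by (auto simp: bilinear_def)

lemma bilinear_closed:
  "bilinear K V W U \<phi> \<Longrightarrow> v \<in> carrier V \<Longrightarrow> w \<in> carrier W \<Longrightarrow> \<phi> v w \<in> carrier U"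
  by (rule module_hom_closed[OF bilinear_right])

lemma bilinear_simps:
  assumes "bilinear K V W U \<phi>"
  shows "\<lbrakk>v \<in> carrier V; w \<in> carrier W; w' \<in> carrier W\<rbrakk> \<Longrightarrow> \<phi> v (w \<oplus>\<^bsub>W\<^esub> w') = \<phi> v w \<oplus>\<^bsub>U\<^esub> \<phi> v w'"
    and "\<lbrakk>a \<in> carrier K; v \<in> carrier V; w \<in> carrier W\<rbrakk> \<Longrightarrow> \<phi> v (a \<odot>\<^bsub>W\<^esub> w) = a \<odot>\<^bsub>U\<^esub> \<phi> v w"
    and "\<lbrakk>v \<in> carrier V; v' \<in> carrier V; w \<in> carrier W\<rbrakk> \<Longrightarrow> \<phi> (v \<oplus>\<^bsub>V\<^esub> v') w = \<phi> v w \<oplus>\<^bsub>U\<^esub> \<phi> v' w"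
    and "\<lbrakk>a \<in> carrier K; v \<in> carrier V; w \<in> carrier W\<rbrakk> \<Longrightarrow> \<phi> (a \<odot>\<^bsub>V\<^esub> v) w = a \<odot>\<^bsub>U\<^esub> \<phi> v w"
  using module_hom_add[OF bilinear_right[OF assms]] module_hom_smult[OF bilinear_right[OF assms]]
    module_hom_add[OF bilinear_left[OF assms]] module_hom_smult[OF bilinear_left[OF assms]]
  by auto

lemma bilinear_precomp:
  assumes "bilinear K V' W' U \<phi>" "f \<in> module_hom K V V'" "g \<in> module_hom K W W'"
  shows "bilinear K V W U (\<lambda>v w. \<phi> (f v) (g w))"
  using module_hom_comp[OF assms(2) bilinear_left[OF assms(1)]]
    module_hom_comp[OF assms(3) bilinear_right[OF assms(1)]]
    module_hom_closed[OF assms(2)] module_hom_closed[OF assms(3)]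
  by (intro bilinearI) auto

lemma bilinear_postcomp:
  assumes "bilinear K V W U \<phi>" "f \<in> module_hom K U U'"
  shows "bilinear K V W U' (\<lambda>v w. f (\<phi> v w))"
  by (intro bilinearI module_hom_comp[OF bilinear_left[OF assms(1)] assms(2)]
      module_hom_comp[OF bilinear_right[OF assms(1)] assms(2)])

lemma bilinear_swap: "bilinear K V W U \<phi> \<Longrightarrow> bilinear K W V U (\<lambda>w v. \<phi> v w)"
  by (auto simp: bilinear_def)

lemma bilinear_cong:
  assumes "module K V" "module K W"
    and "\<And>v w. \<lbrakk>v \<in> carrier V; w \<in> carrier W\<rbrakk> \<Longrightarrow> \<phi> v w = \<psi> v w"
  shows "bilinear K V W U \<phi> \<longleftrightarrow> bilinear K V W U \<psi>"
proof -
  have "(\<lambda>w. \<phi> v w) \<in> module_hom K W U \<longleftrightarrow> (\<lambda>w. \<psi> v w) \<in> module_hom K W U" if "v \<in> carrier V" for v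
    using assms that by (intro module_hom_cong) auto
  moreover have "(\<lambda>v. \<phi> v w) \<in> module_hom K V U \<longleftrightarrow> (\<lambda>v. \<psi> v w) \<in> module_hom K V U"
    if "w \<in> carrier W" for w
    using assms that by (intro module_hom_cong) auto
  ultimately show ?thesis
    by (auto simp: bilinear_def)
qed

section \<open>The tensor product as a quotient\<close>

lemma bilinear_relations_carrier:
  assumes "module K V" "module K W"
  shows "bilinear_relations K V W \<subseteq> carrier (free_module K (carrier V \<times> carrier W))"
proof -
  interpret V: module K V by fact
  interpret W: module K W by fact
  interpret F: module K "free_module K (carrier V \<times> carrier W)"
    by (rule free_module_module) (rule V.R.is_cring)
  show ?thesis
    by (auto simp: bilinear_relations_def Let_def free_gen_pair_carrier[OF V.R.is_cring])
qed

lemma tensor_null_quotient: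
  assumes "module K V" "module K W"
  shows "module_quotient K (free_module K (carrier V \<times> carrier W)) (tensor_null K V W)"
proof -
  interpret V: module K V by fact
  have F: "module K (free_module K (carrier V \<times> carrier W))"
    by (rule free_module_module) (rule V.R.is_cring)
  show ?thesis
    unfolding tensor_null_def
    by (intro module_quotient.intro module_quotient_axioms.intro F module_span_submodule
        bilinear_relations_carrier assms)
qed

lemma tensor_product_module [intro]:
  assumes "module K V" "module K W"
  shows "module K (tensor_product K V W)"
  unfolding tensor_product_def
  by (rule module_quotient.quotient_is_module[OF tensor_null_quotient[OF assms]])

text \<open>Each of the four families in \<open>bilinear_relations\<close> puts the difference of
  the two sides of one linearity law into \<open>tensor_null\<close>, hence makes their cosets
  equal.\<close>

lemma pure_tensor_bilinear:
  assumes "module K V" "module K W"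
  shows "bilinear K V W (tensor_product K V W) (pure_tensor K V W)"
proof -
  interpret V: module K V by fact
  interpret W: module K W by fact
  let ?F = "free_module K (carrier V \<times> carrier W)" and ?T = "tensor_product K V W"
  interpret Q: module_quotient K ?F "tensor_null K V W"
    by (rule tensor_null_quotient) fact+
  have e: "free_gen K (v, w) \<in> carrier ?F" if "v \<in> carrier V" "w \<in> carrier W" for v w
    using free_gen_pair_carrier V.R.is_cring that .
  have null: "x \<in> tensor_null K V W" if "x \<in> bilinear_relations K V W" for x
    using module_span_incl that by (force simp: tensor_null_def)
  have T: "?T = quotient_module ?F (tensor_null K V W)"
    by (simp add: tensor_product_def)
  have cl: "pure_tensor K V W v w \<in> carrier ?T" if "v \<in> carrier V" "w \<in> carrier W" for v w
    using e[OF that] by (simp add: T pure_tensor_def Q.quotient_carrier)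
  have 1: "pure_tensor K V W (v \<oplus>\<^bsub>V\<^esub> v') w = pure_tensor K V W v w \<oplus>\<^bsub>?T\<^esub> pure_tensor K V W v' w"
    if "v \<in> carrier V" "v' \<in> carrier V" "w \<in> carrier W" for v v' w
  proof -
    have "free_gen K (v \<oplus>\<^bsub>V\<^esub> v', w) \<ominus>\<^bsub>?F\<^esub> (free_gen K (v, w) \<oplus>\<^bsub>?F\<^esub> free_gen K (v', w))
        \<in> tensor_null K V W"
      using that by (intro null, unfold bilinear_relations_def Let_def) blast
    then show ?thesis
      using that e by (simp add: T pure_tensor_def Q.quotient_add Q.coset_eq_iff)
  qed
  have 2: "pure_tensor K V W v (w \<oplus>\<^bsub>W\<^esub> w') = pure_tensor K V W v w \<oplus>\<^bsub>?T\<^esub> pure_tensor K V W v w'"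
    if "v \<in> carrier V" "w \<in> carrier W" "w' \<in> carrier W" for v w w'
  proof -
    have "free_gen K (v, w \<oplus>\<^bsub>W\<^esub> w') \<ominus>\<^bsub>?F\<^esub> (free_gen K (v, w) \<oplus>\<^bsub>?F\<^esub> free_gen K (v, w'))
        \<in> tensor_null K V W"
      using that by (intro null, unfold bilinear_relations_def Let_def) blast
    then show ?thesis
      using that e by (simp add: T pure_tensor_def Q.quotient_add Q.coset_eq_iff)
  qed
  have 3: "pure_tensor K V W (a \<odot>\<^bsub>V\<^esub> v) w = a \<odot>\<^bsub>?T\<^esub> pure_tensor K V W v w"
    if "a \<in> carrier K" "v \<in> carrier V" "w \<in> carrier W" for a v w
  proof -
    have "free_gen K (a \<odot>\<^bsub>V\<^esub> v, w) \<ominus>\<^bsub>?F\<^esub> a \<odot>\<^bsub>?F\<^esub> free_gen K (v, w) \<in> tensor_null K V W"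
      using that by (intro null, unfold bilinear_relations_def Let_def) blast
    then show ?thesis
      using that e by (simp add: T pure_tensor_def Q.quotient_smult Q.coset_eq_iff)
  qed
  have 4: "pure_tensor K V W v (a \<odot>\<^bsub>W\<^esub> w) = a \<odot>\<^bsub>?T\<^esub> pure_tensor K V W v w"
    if "a \<in> carrier K" "v \<in> carrier V" "w \<in> carrier W" for a v w
  proof -
    have "free_gen K (v, a \<odot>\<^bsub>W\<^esub> w) \<ominus>\<^bsub>?F\<^esub> a \<odot>\<^bsub>?F\<^esub> free_gen K (v, w) \<in> tensor_null K V W"
      using that by (intro null, unfold bilinear_relations_def Let_def) blast
    then show ?thesis
      using that e by (simp add: T pure_tensor_def Q.quotient_smult Q.coset_eq_iff)
  qed
  show ?thesis
    by (intro bilinearI module_homI) (auto simp: cl 1 2 3 4)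
qed

lemma pure_tensor_closed:
  "\<lbrakk>module K V; module K W; v \<in> carrier V; w \<in> carrier W\<rbrakk>
    \<Longrightarrow> pure_tensor K V W v w \<in> carrier (tensor_product K V W)"
  by (rule bilinear_closed[OF pure_tensor_bilinear])

text \<open>There is no case for scalars or for zero: a coefficient moves into the left factor, a (v
  \<otimes> w) = (a v) \<otimes> w, and zero arises in this way from the coefficient 0.\<close>

lemma tensor_induct [consumes 3, case_names pure add]:
  assumes "module K V" "module K W" "t \<in> carrier (tensor_product K V W)"
    and pure: "\<And>v w. \<lbrakk>v \<in> carrier V; w \<in> carrier W\<rbrakk> \<Longrightarrow> P (pure_tensor K V W v w)"
    and add: "\<And>s t. \<lbrakk>s \<in> carrier (tensor_product K V W); t \<in> carrier (tensor_product K V W); P s; P t\<rbrakk>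
      \<Longrightarrow> P (s \<oplus>\<^bsub>tensor_product K V W\<^esub> t)"
  shows "P t"
proof -
  interpret V: module K V by fact
  interpret W: module K W by fact
  let ?F = "free_module K (carrier V \<times> carrier W)" and ?T = "tensor_product K V W"
    and ?N = "tensor_null K V W"
  interpret Q: module_quotient K ?F ?N
    by (rule tensor_null_quotient) fact+
  have T: "?T = quotient_module ?F ?N"
    by (simp add: tensor_product_def)
  have gen: "P (?N +>\<^bsub>?F\<^esub> (a \<odot>\<^bsub>?F\<^esub> free_gen K (v, w)))"
    if "a \<in> carrier K" "v \<in> carrier V" "w \<in> carrier W" for a v w
  proof -
    have "?N +>\<^bsub>?F\<^esub> (a \<odot>\<^bsub>?F\<^esub> free_gen K (v, w)) = a \<odot>\<^bsub>?T\<^esub> pure_tensor K V W v w"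
      using that free_gen_pair_carrier[OF V.R.is_cring, of v _ w]
      by (simp add: T pure_tensor_def Q.quotient_smult)
    also have "\<dots> = pure_tensor K V W (a \<odot>\<^bsub>V\<^esub> v) w"
      using that bilinear_simps(4)[OF pure_tensor_bilinear[OF assms(1,2)]] by simp
    finally show ?thesis
      using that pure by simp
  qed
  have "P (?N +>\<^bsub>?F\<^esub> r)" if "r \<in> carrier ?F" for r
    using V.R.is_cring that
  proof (induction r rule: free_module_induct)
    case zero
    have "\<zero>\<^bsub>?F\<^esub> = \<zero>\<^bsub>K\<^esub> \<odot>\<^bsub>?F\<^esub> free_gen K (\<zero>\<^bsub>V\<^esub>, \<zero>\<^bsub>W\<^esub>)"
      by (intro Q.smult_l_null[symmetric] free_gen_pair_carrier V.R.is_cring) auto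
    then show ?case
      using gen[of "\<zero>\<^bsub>K\<^esub>" "\<zero>\<^bsub>V\<^esub>" "\<zero>\<^bsub>W\<^esub>"] by simp
  next
    case (add r s)
    then show ?case
      using assms(5)[of "?N +>\<^bsub>?F\<^esub> r" "?N +>\<^bsub>?F\<^esub> s"]
      by (simp add: T Q.quotient_add Q.quotient_carrier)
  next
    case (gen a x)
    then show ?case
      using \<open>\<And>a v w. _ \<Longrightarrow> _ \<Longrightarrow> _ \<Longrightarrow> P (?N +>\<^bsub>?F\<^esub> (a \<odot>\<^bsub>?F\<^esub> free_gen K (v, w)))\<close> by (cases x) auto
  qed
  then show ?thesis
    using assms(3) by (auto simp: T Q.quotient_carrier)
qed

section \<open>The universal property of the tensor product\<close>

lemma tensor_lift_eq_free_lift: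
  "tensor_lift K U \<phi> t = the_elem (free_lift K U (\<lambda>p. \<phi> (fst p) (snd p)) ` t)"
  by (simp add: tensor_lift_def free_lift_def)

text \<open>This makes \<open>tensor_lift\<close> well defined. The kernel of the lift is a
  submodule, and bilinearity of \<phi> says precisely that it contains the four families of
  relations, so it contains their span.\<close>

lemma free_lift_tensor_null:
  assumes "module K V" "module K W" "module K U" "bilinear K V W U \<phi>" "n \<in> tensor_null K V W"
  shows "free_lift K U (\<lambda>p. \<phi> (fst p) (snd p)) n = \<zero>\<^bsub>U\<^esub>"
proof -
  interpret V: module K V by fact
  interpret W: module K W by fact
  interpret U: module K U by fact
  let ?F = "free_module K (carrier V \<times> carrier W)" and ?L = "free_lift K U (\<lambda>p. \<phi> (fst p) (snd p))"
  interpret F: module K ?F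
    by (rule free_module_module) (rule V.R.is_cring)
  have e: "free_gen K (v, w) \<in> carrier ?F" if "v \<in> carrier V" "w \<in> carrier W" for v w
    using free_gen_pair_carrier V.R.is_cring that .
  have \<phi>: "(\<lambda>p. \<phi> (fst p) (snd p)) \<in> carrier V \<times> carrier W \<rightarrow> carrier U"
    using assms(4) by (auto simp: bilinear_closed)
  have L: "?L \<in> module_hom K ?F U"
    by (rule free_lift_hom) fact+
  have Le: "?L (free_gen K (v, w)) = \<phi> v w" if "v \<in> carrier V" "w \<in> carrier W" for v w
    using free_lift_gen[OF assms(3) \<phi>, of "(v, w)"] that by simp
  have cl: "\<phi> v w \<in> carrier U" if "v \<in> carrier V" "w \<in> carrier W" for v w
    using bilinear_closed assms(4) that .
  have "submodule {r \<in> carrier ?F. ?L r \<in> {\<zero>\<^bsub>U\<^esub>}} K ?F"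
    by (rule submodule_vimage[OF F.module_axioms assms(3) L submodule_zero_singleton[OF assms(3)]])
  moreover have "bilinear_relations K V W \<subseteq> {r \<in> carrier ?F. ?L r \<in> {\<zero>\<^bsub>U\<^esub>}}"
  proof
    fix r assume "r \<in> bilinear_relations K V W"
    moreover from this have "r \<in> carrier ?F"
      using bilinear_relations_carrier assms(1,2) by blast
    ultimately show "r \<in> {r \<in> carrier ?F. ?L r \<in> {\<zero>\<^bsub>U\<^esub>}}"
      by (auto simp: bilinear_relations_def Let_def e Le cl module_hom_add[OF L] module_hom_smult[OF L]
          module_hom_minus[OF F.module_axioms assms(3) L] bilinear_simps[OF assms(4)] U.M.minus_eq_zero_iff)
  qed
  ultimately show ?thesis
    using assms(5) module_span_least unfolding tensor_null_def by blast
qed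

context
  fixes K :: "('k, 'r) ring_scheme" and V :: "('k, 'v, 'm) module_scheme"
    and W :: "('k, 'w, 'n) module_scheme" and U :: "('k, 'u, 'o) module_scheme"
    and \<phi> :: "'v \<Rightarrow> 'w \<Rightarrow> 'u"
  assumes modules: "module K V" "module K W" "module K U" and \<phi>: "bilinear K V W U \<phi>"
begin

interpretation V: module K V by (rule modules)
interpretation W: module K W by (rule modules)
interpretation Q: module_quotient K "free_module K (carrier V \<times> carrier W)" "tensor_null K V W"
  by (rule tensor_null_quotient) (rule modules)+

lemma tensor_lift_coset:
  assumes "r \<in> carrier (free_module K (carrier V \<times> carrier W))"
  shows "tensor_lift K U \<phi> (tensor_null K V W +>\<^bsub>free_module K (carrier V \<times> carrier W)\<^esub> r)
    = free_lift K U (\<lambda>p. \<phi> (fst p) (snd p)) r"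
  unfolding tensor_lift_eq_free_lift
  by (rule Q.image_coset_hom[OF modules(3) free_lift_hom])
    (use modules \<phi> assms in \<open>auto simp: bilinear_closed free_lift_tensor_null\<close>)

lemma tensor_lift_hom: "tensor_lift K U \<phi> \<in> module_hom K (tensor_product K V W) U"
proof -
  have L: "free_lift K U (\<lambda>p. \<phi> (fst p) (snd p))
      \<in> module_hom K (free_module K (carrier V \<times> carrier W)) U"
    by (rule free_lift_hom[OF modules(3)]) (use \<phi> in \<open>auto simp: bilinear_closed\<close>)
  show ?thesis
    unfolding tensor_product_def
    by (rule module_homI)
      (auto simp: Q.quotient_carrier Q.quotient_add Q.quotient_smult tensor_lift_coset
        module_hom_closed[OF L] module_hom_add[OF L] module_hom_smult[OF L])
qed

lemma tensor_lift_pure: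
  assumes "v \<in> carrier V" "w \<in> carrier W"
  shows "tensor_lift K U \<phi> (pure_tensor K V W v w) = \<phi> v w"
proof -
  have "(\<lambda>p. \<phi> (fst p) (snd p)) \<in> carrier V \<times> carrier W \<rightarrow> carrier U"
    using \<phi> by (auto simp: bilinear_closed)
  from free_lift_gen[OF modules(3) this, of "(v, w)"] show ?thesis
    using assms free_gen_pair_carrier[OF V.R.is_cring assms]
    by (simp add: pure_tensor_def tensor_lift_coset)
qed

end

text \<open>This is the uniqueness half of the universal property. Most identities between lifts
  below are reduced to pure tensors by it.\<close>

lemma tensor_hom_eqI:
  assumes "module K V" "module K W" "f \<in> module_hom K (tensor_product K V W) U"
    "g \<in> module_hom K (tensor_product K V W) U" "t \<in> carrier (tensor_product K V W)"
    and "\<And>v w. \<lbrakk>v \<in> carrier V; w \<in> carrier W\<rbrakk> \<Longrightarrow> f (pure_tensor K V W v w) = g (pure_tensor K V W v w)"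
  shows "f t = g t"
  using assms(1,2,5)
  by (induction t rule: tensor_induct) (use assms in \<open>auto simp: module_hom_add\<close>)

text \<open>\<phi> and \<psi> are compared only on the carriers, so this congruence takes the place
  of rewriting under the binders of \<open>tensor_lift\<close>. Bilinearity is asked of one side and
  passes to the other.\<close>

lemma tensor_lift_cong:
  assumes "module K V" "module K W" "module K U" "bilinear K V W U \<phi>"
    and "t \<in> carrier (tensor_product K V W)"
    and eq: "\<And>v w. \<lbrakk>v \<in> carrier V; w \<in> carrier W\<rbrakk> \<Longrightarrow> \<phi> v w = \<psi> v w"
  shows "tensor_lift K U \<phi> t = tensor_lift K U \<psi> t"
proof -
  have \<psi>: "bilinear K V W U \<psi>"
    using assms(4) bilinear_cong[OF assms(1,2), of \<phi> \<psi> U] eq by simp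
  show ?thesis
    by (rule tensor_hom_eqI[OF assms(1,2) tensor_lift_hom tensor_lift_hom])
      (use assms \<psi> in \<open>auto simp: tensor_lift_pure\<close>)
qed

text \<open>Both sides are linear in \<open>t\<close> and have the same value on pure tensors. In
  Sweedler calculations this moves a linear map into or out of a sum.\<close>

lemma hom_tensor_lift:
  assumes "module K V" "module K W" "module K U" "module K U'" "bilinear K V W U \<phi>"
    and "f \<in> module_hom K U U'" "t \<in> carrier (tensor_product K V W)"
  shows "f (tensor_lift K U \<phi> t) = tensor_lift K U' (\<lambda>v w. f (\<phi> v w)) t"
proof -
  note b = bilinear_postcomp[OF assms(5,6)]
  show ?thesis
    by (rule tensor_hom_eqI[OF assms(1,2) module_hom_comp[OF tensor_lift_hom assms(6)] tensor_lift_hom])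
      (use assms b in \<open>auto simp: tensor_lift_pure\<close>)
qed

text \<open>In nested lifts the inner lift depends on the variables of the outer one. This gives the
  linearity in such a variable that the outer lift requires.\<close>

lemma tensor_lift_param_hom:
  assumes "module K V" "module K W" "module K U" "module K X"
    and "t \<in> carrier (tensor_product K V W)"
    and \<psi>: "\<And>x. x \<in> carrier X \<Longrightarrow> bilinear K V W U (\<psi> x)"
      "\<And>v w. \<lbrakk>v \<in> carrier V; w \<in> carrier W\<rbrakk> \<Longrightarrow> (\<lambda>x. \<psi> x v w) \<in> module_hom K X U"
  shows "(\<lambda>x. tensor_lift K U (\<psi> x) t) \<in> module_hom K X U"
proof -
  interpret X: module K X by fact
  have lift: "tensor_lift K U (\<psi> x) \<in> module_hom K (tensor_product K V W) U"
    if "x \<in> carrier X" for x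
    using assms \<psi> that by (intro tensor_lift_hom)
  show ?thesis
  proof (rule module_homI)
    fix x y assume xy: "x \<in> carrier X" "y \<in> carrier X"
    show "tensor_lift K U (\<psi> (x \<oplus>\<^bsub>X\<^esub> y)) t = tensor_lift K U (\<psi> x) t \<oplus>\<^bsub>U\<^esub> tensor_lift K U (\<psi> y) t"
      by (rule tensor_hom_eqI[OF assms(1,2) lift module_hom_add_fun[OF assms(3) lift[OF xy(1)] lift[OF xy(2)]] assms(5)])
        (use assms(1-4) \<psi>(1) xy in \<open>auto simp: tensor_lift_pure module_hom_add[OF \<psi>(2)]\<close>)
  next
    fix a x assume ax: "a \<in> carrier K" "x \<in> carrier X"
    show "tensor_lift K U (\<psi> (a \<odot>\<^bsub>X\<^esub> x)) t = a \<odot>\<^bsub>U\<^esub> tensor_lift K U (\<psi> x) t"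
      by (rule tensor_hom_eqI[OF assms(1,2) lift module_hom_smult_fun[OF assms(3) lift[OF ax(2)] ax(1)] assms(5)])
        (use assms(1-4) \<psi>(1) ax in \<open>auto simp: tensor_lift_pure module_hom_smult[OF \<psi>(2)]\<close>)
  qed (rule module_hom_closed[OF lift assms(5)])
qed

section \<open>Functoriality of the tensor product\<close>

context
  fixes K :: "('k, 'r) ring_scheme" and V :: "('k, 'v, 'm) module_scheme"
    and W :: "('k, 'w, 'n) module_scheme" and V' :: "('k, 'x, 'o) module_scheme"
    and W' :: "('k, 'y, 'p) module_scheme"
    and f :: "'v \<Rightarrow> 'x" and g :: "'w \<Rightarrow> 'y"
  assumes modules: "module K V" "module K W" "module K V'" "module K W'"
    and f: "f \<in> module_hom K V V'" and g: "g \<in> module_hom K W W'"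
begin

lemma tensor_map_bilinear:
  "bilinear K V W (tensor_product K V' W') (\<lambda>v w. pure_tensor K V' W' (f v) (g w))"
  by (rule bilinear_precomp[OF pure_tensor_bilinear f g]) (rule modules)+

lemma tensor_map_hom:
  "tensor_map K V' W' f g \<in> module_hom K (tensor_product K V W) (tensor_product K V' W')"
  unfolding tensor_map_def
  by (rule tensor_lift_hom) (use modules tensor_map_bilinear in auto)

lemma tensor_map_pure:
  "v \<in> carrier V \<Longrightarrow> w \<in> carrier W \<Longrightarrow>
    tensor_map K V' W' f g (pure_tensor K V W v w) = pure_tensor K V' W' (f v) (g w)"
  unfolding tensor_map_def
  by (rule tensor_lift_pure) (use modules tensor_map_bilinear in auto)

lemma tensor_lift_tensor_map:
  assumes "module K U" "bilinear K V' W' U \<phi>" "t \<in> carrier (tensor_product K V W)"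
  shows "tensor_lift K U \<phi> (tensor_map K V' W' f g t) = tensor_lift K U (\<lambda>v w. \<phi> (f v) (g w)) t"
proof -
  note b = bilinear_precomp[OF assms(2) f g]
  show ?thesis
    by (rule tensor_hom_eqI[OF modules(1,2) module_hom_comp[OF tensor_map_hom tensor_lift_hom] tensor_lift_hom])
      (use modules assms b module_hom_closed[OF f] module_hom_closed[OF g] in
        \<open>auto simp: tensor_lift_pure tensor_map_pure\<close>)
qed

end

section \<open>Sweedler calculus\<close>

text \<open>Sums over x1, x2, x3 are nested lifts, so maps of three variables stay curried; the
  triple tensor product appears only where \<open>coassoc\<close> mentions it.\<close>

definition trilinear ::
  "('k, 'r) ring_scheme \<Rightarrow> ('k, 'x, 'l) module_scheme \<Rightarrow> ('k, 'v, 'm) module_scheme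
    \<Rightarrow> ('k, 'w, 'n) module_scheme \<Rightarrow> ('k, 'u, 'o) module_scheme \<Rightarrow> ('x \<Rightarrow> 'v \<Rightarrow> 'w \<Rightarrow> 'u) \<Rightarrow> bool"
  where "trilinear K X V W U \<phi> \<longleftrightarrow>
    (\<forall>x\<in>carrier X. bilinear K V W U (\<phi> x)) \<and>
    (\<forall>v\<in>carrier V. \<forall>w\<in>carrier W. (\<lambda>x. \<phi> x v w) \<in> module_hom K X U)"

lemma trilinearI:
  assumes "\<And>v w. \<lbrakk>v \<in> carrier V; w \<in> carrier W\<rbrakk> \<Longrightarrow> (\<lambda>x. \<phi> x v w) \<in> module_hom K X U"
    and "\<And>x w. \<lbrakk>x \<in> carrier X; w \<in> carrier W\<rbrakk> \<Longrightarrow> (\<lambda>v. \<phi> x v w) \<in> module_hom K V U"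
    and "\<And>x v. \<lbrakk>x \<in> carrier X; v \<in> carrier V\<rbrakk> \<Longrightarrow> (\<lambda>w. \<phi> x v w) \<in> module_hom K W U"
  shows "trilinear K X V W U \<phi>"
  using assms by (auto simp: trilinear_def bilinear_def)

lemma trilinearD:
  assumes "trilinear K X V W U \<phi>"
  shows "\<lbrakk>v \<in> carrier V; w \<in> carrier W\<rbrakk> \<Longrightarrow> (\<lambda>x. \<phi> x v w) \<in> module_hom K X U"
    and "x \<in> carrier X \<Longrightarrow> bilinear K V W U (\<phi> x)"
    and "w \<in> carrier W \<Longrightarrow> bilinear K X V U (\<lambda>x v. \<phi> x v w)"
  using assms by (auto simp: trilinear_def bilinear_def)

text \<open>Summing over the first two of three variables leaves a bilinear map;
  \<open>tensor_lift_trilinear_right\<close> sums over the last two. After composition with \<Delta>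
  these become the two sides of coassociativity.\<close>

lemma tensor_lift_trilinear_left:
  assumes "module K X" "module K V" "module K W" "module K U" and \<phi>: "trilinear K X V W U \<phi>"
  shows "bilinear K (tensor_product K X V) W U (\<lambda>t w. tensor_lift K U (\<lambda>x v. \<phi> x v w) t)"
proof (rule bilinearI)
  fix t assume "t \<in> carrier (tensor_product K X V)"
  then show "(\<lambda>w. tensor_lift K U (\<lambda>x v. \<phi> x v w) t) \<in> module_hom K W U"
    using trilinearD(3)[OF \<phi>] bilinear_right[OF trilinearD(2)[OF \<phi>]]
    by (intro tensor_lift_param_hom[OF assms(1,2,4,3)]) auto
qed (rule tensor_lift_hom[OF assms(1,2,4) trilinearD(3)[OF \<phi>]])

lemma tensor_lift_trilinear_right:
  assumes "module K X" "module K V" "module K W" "module K U" and \<phi>: "trilinear K X V W U \<phi>"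
  shows "bilinear K X (tensor_product K V W) U (\<lambda>x t. tensor_lift K U (\<phi> x) t)"
proof (rule bilinearI)
  fix t assume "t \<in> carrier (tensor_product K V W)"
  then show "(\<lambda>x. tensor_lift K U (\<phi> x) t) \<in> module_hom K X U"
    using trilinearD(1,2)[OF \<phi>]
    by (intro tensor_lift_param_hom[OF assms(2,3,4,1)]) auto
qed (rule tensor_lift_hom[OF assms(2,3,4) trilinearD(2)[OF \<phi>]])

text \<open>This is the universal trilinear map, the one for which the axiom \<open>coassoc\<close>
  is stated.\<close>

lemma trilinear_pure_tensor:
  assumes "module K X" "module K V" "module K W"
  shows "trilinear K X V W (tensor_product K X (tensor_product K V W))
    (\<lambda>x v w. pure_tensor K X (tensor_product K V W) x (pure_tensor K V W v w))"
proof -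
  note b = pure_tensor_bilinear[OF assms(1) tensor_product_module[OF assms(2,3)]]
  show ?thesis
    unfolding trilinear_def
    using bilinear_postcomp[OF pure_tensor_bilinear[OF assms(2,3)] bilinear_right[OF b]]
      bilinear_left[OF b pure_tensor_closed[OF assms(2,3)]]
    by blast
qed

section \<open>Coalgebra identities with values in an arbitrary module\<close>

context coalgebra
begin

sublocale module K H by (rule module)

abbreviation HH where "HH \<equiv> tensor_product K H H"

lemma HH_module: "module K HH"
  using module by (rule tensor_product_module[OF module])

lemma comult_closed: "x \<in> carrier H \<Longrightarrow> \<Delta>\<^bsub>H\<^esub> x \<in> carrier HH"
  using comult_linear by (rule module_hom_closed)

lemma counit_closed: "x \<in> carrier H \<Longrightarrow> \<epsilon>\<^bsub>H\<^esub> x \<in> carrier K"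
  using counit_add_hom by (auto simp: hom_def)

lemma counit_add:
  "x \<in> carrier H \<Longrightarrow> y \<in> carrier H \<Longrightarrow> \<epsilon>\<^bsub>H\<^esub> (x \<oplus>\<^bsub>H\<^esub> y) = \<epsilon>\<^bsub>H\<^esub> x \<oplus>\<^bsub>K\<^esub> \<epsilon>\<^bsub>H\<^esub> y"
  using counit_add_hom by (auto simp: hom_def)

text \<open>The target \<open>K\<close> of \<epsilon> is a ring record and not a module record, so
  \<epsilon> is no member of a \<open>module_hom\<close> and the general facts do not apply.
  Negation is obtained as the scalar -1.\<close>

lemma counit_a_inv:
  assumes "x \<in> carrier H"
  shows "\<epsilon>\<^bsub>H\<^esub> (\<ominus>\<^bsub>H\<^esub> x) = \<ominus>\<^bsub>K\<^esub> \<epsilon>\<^bsub>H\<^esub> x"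
proof -
  have "\<ominus>\<^bsub>H\<^esub> x = (\<ominus>\<^bsub>K\<^esub> \<one>\<^bsub>K\<^esub>) \<odot>\<^bsub>H\<^esub> x"
    using assms by (simp add: smult_l_minus)
  then show ?thesis
    using assms by (simp add: counit_smult counit_closed R.l_minus)
qed

lemma counit_kernel_submodule: "submodule {x \<in> carrier H. \<epsilon>\<^bsub>H\<^esub> x = \<zero>\<^bsub>K\<^esub>} K H"
proof (rule submoduleI)
  have "\<epsilon>\<^bsub>H\<^esub> (\<zero>\<^bsub>K\<^esub> \<odot>\<^bsub>H\<^esub> \<zero>\<^bsub>H\<^esub>) = \<zero>\<^bsub>K\<^esub> \<otimes>\<^bsub>K\<^esub> \<epsilon>\<^bsub>H\<^esub> \<zero>\<^bsub>H\<^esub>"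
    by (rule counit_smult) auto
  then show "\<zero>\<^bsub>H\<^esub> \<in> {x \<in> carrier H. \<epsilon>\<^bsub>H\<^esub> x = \<zero>\<^bsub>K\<^esub>}"
    by (simp add: counit_closed)
qed (auto simp: counit_a_inv counit_add counit_smult)

text \<open>Inside lifts the counit occurs as a coefficient of a vector; in this form it is a linear
  map between modules.\<close>

lemma counit_smult_hom:
  assumes "module K U" "u \<in> carrier U"
  shows "(\<lambda>x. \<epsilon>\<^bsub>H\<^esub> x \<odot>\<^bsub>U\<^esub> u) \<in> module_hom K H U"
proof -
  interpret U: module K U by fact
  show ?thesis
    by (rule module_homI)
      (use assms(2) in \<open>auto simp: counit_closed counit_add counit_smult U.smult_l_distr U.smult_assoc1\<close>)
qed

lemma counit_smult_bilinear:
  assumes "module K U" "f \<in> module_hom K V U"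
  shows "bilinear K H V U (\<lambda>x v. \<epsilon>\<^bsub>H\<^esub> x \<odot>\<^bsub>U\<^esub> f v)"
  using assms by (intro bilinearI module_hom_smult_fun counit_smult_hom)
    (auto simp: counit_closed module_hom_closed[OF assms(2)])

text \<open>The axiom \<open>counit_left\<close> is the case of the identity; applying f to it gives
  the general case.\<close>

lemma counit_left_hom:
  assumes "module K U" "f \<in> module_hom K H U" "x \<in> carrier H"
  shows "tensor_lift K U (\<lambda>y z. \<epsilon>\<^bsub>H\<^esub> y \<odot>\<^bsub>U\<^esub> f z) (\<Delta>\<^bsub>H\<^esub> x) = f x"
proof -
  have "f x = f (tensor_lift K H (\<lambda>y z. \<epsilon>\<^bsub>H\<^esub> y \<odot>\<^bsub>H\<^esub> z) (\<Delta>\<^bsub>H\<^esub> x))"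
    using assms(3) by (simp add: counit_left)
  also have "\<dots> = tensor_lift K U (\<lambda>y z. f (\<epsilon>\<^bsub>H\<^esub> y \<odot>\<^bsub>H\<^esub> z)) (\<Delta>\<^bsub>H\<^esub> x)"
    by (rule hom_tensor_lift[OF module module module assms(1)
          counit_smult_bilinear[OF module module_hom_id] assms(2) comult_closed[OF assms(3)]])
  also have "\<dots> = tensor_lift K U (\<lambda>y z. \<epsilon>\<^bsub>H\<^esub> y \<odot>\<^bsub>U\<^esub> f z) (\<Delta>\<^bsub>H\<^esub> x)"
    by (rule tensor_lift_cong[OF module module assms(1) bilinear_postcomp[OF
          counit_smult_bilinear[OF module module_hom_id] assms(2)] comult_closed[OF assms(3)]])
      (simp add: module_hom_smult[OF assms(2)] counit_closed)
  finally show ?thesis ..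
qed

lemma counit_right_hom:
  assumes "module K U" "f \<in> module_hom K H U" "x \<in> carrier H"
  shows "tensor_lift K U (\<lambda>y z. \<epsilon>\<^bsub>H\<^esub> z \<odot>\<^bsub>U\<^esub> f y) (\<Delta>\<^bsub>H\<^esub> x) = f x"
proof -
  have "f x = f (tensor_lift K H (\<lambda>y z. \<epsilon>\<^bsub>H\<^esub> z \<odot>\<^bsub>H\<^esub> y) (\<Delta>\<^bsub>H\<^esub> x))"
    using assms(3) by (simp add: counit_right)
  also have "\<dots> = tensor_lift K U (\<lambda>y z. f (\<epsilon>\<^bsub>H\<^esub> z \<odot>\<^bsub>H\<^esub> y)) (\<Delta>\<^bsub>H\<^esub> x)"
    by (rule hom_tensor_lift[OF module module module assms(1)
          bilinear_swap[OF counit_smult_bilinear[OF module module_hom_id]] assms(2) comult_closed[OF assms(3)]])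
  also have "\<dots> = tensor_lift K U (\<lambda>y z. \<epsilon>\<^bsub>H\<^esub> z \<odot>\<^bsub>U\<^esub> f y) (\<Delta>\<^bsub>H\<^esub> x)"
    by (rule tensor_lift_cong[OF module module assms(1) bilinear_postcomp[OF
          bilinear_swap[OF counit_smult_bilinear[OF module module_hom_id]] assms(2)] comult_closed[OF assms(3)]])
      (simp add: module_hom_smult[OF assms(2)] counit_closed)
  finally show ?thesis ..
qed

lemma bilinear_comult_left:
  assumes "module K U" "module K V" "trilinear K H H V U \<phi>"
  shows "bilinear K H V U (\<lambda>y z. tensor_lift K U (\<lambda>u v. \<phi> u v z) (\<Delta>\<^bsub>H\<^esub> y))"
  by (rule bilinear_precomp[OF tensor_lift_trilinear_left[OF module module assms(2,1,3)]
        comult_linear module_hom_id])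

lemma bilinear_comult_right:
  assumes "module K U" "module K V" "trilinear K V H H U \<phi>"
  shows "bilinear K V H U (\<lambda>y z. tensor_lift K U (\<phi> y) (\<Delta>\<^bsub>H\<^esub> z))"
  by (rule bilinear_precomp[OF tensor_lift_trilinear_right[OF assms(2) module module assms(1,3)]
        module_hom_id comult_linear])

text \<open>\<phi> induces a linear map \<open>L\<close> on H \<otimes> (H \<otimes> H), which sends
  u \<otimes> (v \<otimes> z) to \<phi> u v z. Applying \<open>L\<close> to the axiom
  \<open>coassoc\<close>, the case of the universal trilinear map, yields the claim.\<close>

lemma coassoc_trilinear:
  assumes U: "module K U" and \<phi>: "trilinear K H H H U \<phi>" and x: "x \<in> carrier H"
  shows "tensor_lift K U (\<lambda>y z. tensor_lift K U (\<lambda>u v. \<phi> u v z) (\<Delta>\<^bsub>H\<^esub> y)) (\<Delta>\<^bsub>H\<^esub> x)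
    = tensor_lift K U (\<lambda>y z. tensor_lift K U (\<phi> y) (\<Delta>\<^bsub>H\<^esub> z)) (\<Delta>\<^bsub>H\<^esub> x)"
proof -
  let ?M = "tensor_product K H HH"
  let ?p = "\<lambda>u v z. pure_tensor K H HH u (pure_tensor K H H v z)"
  have M: "module K ?M"
    using module HH_module by (rule tensor_product_module)
  have p: "trilinear K H H H ?M ?p"
    by (rule trilinear_pure_tensor) (rule module)+
  have b: "bilinear K H HH U (\<lambda>u. tensor_lift K U (\<phi> u))"
    by (rule tensor_lift_trilinear_right[OF module module module U \<phi>])
  define L where "L = tensor_lift K U (\<lambda>u. tensor_lift K U (\<phi> u))"
  have L: "L \<in> module_hom K ?M U"
    unfolding L_def by (rule tensor_lift_hom[OF module HH_module U b])
  have Lp: "L (?p u v z) = \<phi> u v z" if "u \<in> carrier H" "v \<in> carrier H" "z \<in> carrier H" for u v z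
    unfolding L_def using that
    by (simp add: tensor_lift_pure[OF module HH_module U b] pure_tensor_closed[OF module module]
        tensor_lift_pure[OF module module U trilinearD(2)[OF \<phi>]])
  have L_left: "L (tensor_lift K ?M (\<lambda>u v. ?p u v z) (\<Delta>\<^bsub>H\<^esub> y)) = tensor_lift K U (\<lambda>u v. \<phi> u v z) (\<Delta>\<^bsub>H\<^esub> y)"
    if "y \<in> carrier H" "z \<in> carrier H" for y z
    by (subst hom_tensor_lift[OF module module M U trilinearD(3)[OF p that(2)] L comult_closed[OF that(1)]],
        rule tensor_lift_cong[OF module module U bilinear_postcomp[OF trilinearD(3)[OF p that(2)] L]
          comult_closed[OF that(1)] Lp[OF _ _ that(2)]])
  have L_right: "L (pure_tensor K H HH y (\<Delta>\<^bsub>H\<^esub> z)) = tensor_lift K U (\<phi> y) (\<Delta>\<^bsub>H\<^esub> z)"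
    if "y \<in> carrier H" "z \<in> carrier H" for y z
    unfolding L_def by (rule tensor_lift_pure[OF module HH_module U b that(1) comult_closed[OF that(2)]])
  note bl = bilinear_comult_left[OF M module p]
  have br: "bilinear K H H ?M (\<lambda>y z. pure_tensor K H HH y (\<Delta>\<^bsub>H\<^esub> z))"
    by (rule bilinear_precomp[OF pure_tensor_bilinear[OF module HH_module] module_hom_id comult_linear])
  have "tensor_lift K U (\<lambda>y z. tensor_lift K U (\<lambda>u v. \<phi> u v z) (\<Delta>\<^bsub>H\<^esub> y)) (\<Delta>\<^bsub>H\<^esub> x)
      = tensor_lift K U (\<lambda>y z. L (tensor_lift K ?M (\<lambda>u v. ?p u v z) (\<Delta>\<^bsub>H\<^esub> y))) (\<Delta>\<^bsub>H\<^esub> x)"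
    by (rule tensor_lift_cong[OF module module U bilinear_comult_left[OF U module \<phi>] comult_closed[OF x]
          L_left[symmetric]])
  also have "\<dots> = L (tensor_lift K ?M (\<lambda>y z. tensor_lift K ?M (\<lambda>u v. ?p u v z) (\<Delta>\<^bsub>H\<^esub> y)) (\<Delta>\<^bsub>H\<^esub> x))"
    by (rule hom_tensor_lift[OF module module M U bl L comult_closed[OF x], symmetric])
  also have "\<dots> = L (tensor_lift K ?M (\<lambda>y z. pure_tensor K H HH y (\<Delta>\<^bsub>H\<^esub> z)) (\<Delta>\<^bsub>H\<^esub> x))"
    using coassoc[OF x] by simp
  also have "\<dots> = tensor_lift K U (\<lambda>y z. L (pure_tensor K H HH y (\<Delta>\<^bsub>H\<^esub> z))) (\<Delta>\<^bsub>H\<^esub> x)"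
    by (rule hom_tensor_lift[OF module module M U br L comult_closed[OF x]])
  also have "\<dots> = tensor_lift K U (\<lambda>y z. tensor_lift K U (\<phi> y) (\<Delta>\<^bsub>H\<^esub> z)) (\<Delta>\<^bsub>H\<^esub> x)"
    by (rule tensor_lift_cong[OF module module U bilinear_postcomp[OF br L] comult_closed[OF x] L_right])
  finally show ?thesis .
qed

text \<open>In the convolution algebra of linear maps from H to U a left inverse \<chi> and a right
  inverse \<phi> of \<psi> agree, both being equal to \<chi> * \<psi> * \<phi>. The product of U is
  passed as a function \<mu> because the main instance is U = H \<otimes> H, whose record has no
  meaningful \<open>mult\<close> field.\<close>

lemma convolution_inverse_unique:
  assumes U: "module K U" and \<mu>: "bilinear K U U U \<mu>"
    and assoc: "\<And>a b c. \<lbrakk>a \<in> carrier U; b \<in> carrier U; c \<in> carrier U\<rbrakk> \<Longrightarrow> \<mu> (\<mu> a b) c = \<mu> a (\<mu> b c)"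
    and e: "e \<in> carrier U" "\<And>a. a \<in> carrier U \<Longrightarrow> \<mu> e a = a" "\<And>a. a \<in> carrier U \<Longrightarrow> \<mu> a e = a"
    and homs: "\<chi> \<in> module_hom K H U" "\<psi> \<in> module_hom K H U" "\<phi> \<in> module_hom K H U"
    and left: "\<And>x. x \<in> carrier H \<Longrightarrow> tensor_lift K U (\<lambda>y z. \<mu> (\<chi> y) (\<psi> z)) (\<Delta>\<^bsub>H\<^esub> x) = \<epsilon>\<^bsub>H\<^esub> x \<odot>\<^bsub>U\<^esub> e"
    and right: "\<And>x. x \<in> carrier H \<Longrightarrow> tensor_lift K U (\<lambda>y z. \<mu> (\<psi> y) (\<phi> z)) (\<Delta>\<^bsub>H\<^esub> x) = \<epsilon>\<^bsub>H\<^esub> x \<odot>\<^bsub>U\<^esub> e"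
    and x: "x \<in> carrier H"
  shows "\<chi> x = \<phi> x"
proof -
  note cl = module_hom_closed[OF homs(1)] module_hom_closed[OF homs(2)] module_hom_closed[OF homs(3)]
  note bl = bilinear_precomp[OF \<mu> homs(1,2)] and br = bilinear_precomp[OF \<mu> homs(2,3)]
  \<comment> \<open>The summand of \<chi> * \<psi> * \<phi>, bracketed to the right:
    \<open>inner_right\<close> then only pulls out a linear map, and associativity enters only in
    \<open>inner_left\<close>.\<close>
  define T where "T u v z = \<mu> (\<chi> u) (\<mu> (\<psi> v) (\<phi> z))" for u v z
  have T: "trilinear K H H H U T"
    unfolding trilinear_def
  proof (intro conjI ballI)
    fix u assume "u \<in> carrier H"
    then show "bilinear K H H U (T u)"
      using bilinear_postcomp[OF br bilinear_right[OF \<mu> cl(1)]] by (simp add: T_def[abs_def])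
  next
    fix v z assume "v \<in> carrier H" "z \<in> carrier H"
    then show "(\<lambda>u. T u v z) \<in> module_hom K H U"
      using module_hom_comp[OF homs(1) bilinear_left[OF \<mu> bilinear_closed[OF br]]]
      by (simp add: T_def)
  qed
  have inner_left: "tensor_lift K U (\<lambda>u v. T u v z) (\<Delta>\<^bsub>H\<^esub> y) = \<epsilon>\<^bsub>H\<^esub> y \<odot>\<^bsub>U\<^esub> \<phi> z"
    if y: "y \<in> carrier H" and z: "z \<in> carrier H" for y z
  proof -
    note r = bilinear_left[OF \<mu> cl(3)[OF z]]
    have "tensor_lift K U (\<lambda>u v. T u v z) (\<Delta>\<^bsub>H\<^esub> y) = tensor_lift K U (\<lambda>u v. \<mu> (\<mu> (\<chi> u) (\<psi> v)) (\<phi> z)) (\<Delta>\<^bsub>H\<^esub> y)"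
      by (rule tensor_lift_cong[OF module module U trilinearD(3)[OF T z] comult_closed[OF y]])
        (use z in \<open>auto simp: T_def assoc cl\<close>)
    also have "\<dots> = \<mu> (tensor_lift K U (\<lambda>u v. \<mu> (\<chi> u) (\<psi> v)) (\<Delta>\<^bsub>H\<^esub> y)) (\<phi> z)"
      by (rule hom_tensor_lift[OF module module U U bl r comult_closed[OF y], symmetric])
    also have "\<dots> = \<epsilon>\<^bsub>H\<^esub> y \<odot>\<^bsub>U\<^esub> \<phi> z"
      using y z by (simp add: left bilinear_simps(4)[OF \<mu>] counit_closed e cl)
    finally show ?thesis .
  qed
  have inner_right: "tensor_lift K U (T y) (\<Delta>\<^bsub>H\<^esub> z) = \<epsilon>\<^bsub>H\<^esub> z \<odot>\<^bsub>U\<^esub> \<chi> y"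
    if y: "y \<in> carrier H" and z: "z \<in> carrier H" for y z
  proof -
    note r = bilinear_right[OF \<mu> cl(1)[OF y]]
    have "tensor_lift K U (T y) (\<Delta>\<^bsub>H\<^esub> z) = \<mu> (\<chi> y) (tensor_lift K U (\<lambda>u v. \<mu> (\<psi> u) (\<phi> v)) (\<Delta>\<^bsub>H\<^esub> z))"
      unfolding T_def
      by (rule hom_tensor_lift[OF module module U U br r comult_closed[OF z], symmetric])
    also have "\<dots> = \<epsilon>\<^bsub>H\<^esub> z \<odot>\<^bsub>U\<^esub> \<chi> y"
      using y z by (simp add: right bilinear_simps(2)[OF \<mu>] counit_closed e cl)
    finally show ?thesis .
  qed
  have "\<phi> x = tensor_lift K U (\<lambda>y z. \<epsilon>\<^bsub>H\<^esub> y \<odot>\<^bsub>U\<^esub> \<phi> z) (\<Delta>\<^bsub>H\<^esub> x)"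
    by (rule counit_left_hom[OF U homs(3) x, symmetric])
  also have "\<dots> = tensor_lift K U (\<lambda>y z. tensor_lift K U (\<lambda>u v. T u v z) (\<Delta>\<^bsub>H\<^esub> y)) (\<Delta>\<^bsub>H\<^esub> x)"
    by (rule tensor_lift_cong[OF module module U counit_smult_bilinear[OF U homs(3)] comult_closed[OF x]
          inner_left[symmetric]])
  also have "\<dots> = tensor_lift K U (\<lambda>y z. tensor_lift K U (T y) (\<Delta>\<^bsub>H\<^esub> z)) (\<Delta>\<^bsub>H\<^esub> x)"
    by (rule coassoc_trilinear[OF U T x])
  also have "\<dots> = tensor_lift K U (\<lambda>y z. \<epsilon>\<^bsub>H\<^esub> z \<odot>\<^bsub>U\<^esub> \<chi> y) (\<Delta>\<^bsub>H\<^esub> x)"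
    by (rule tensor_lift_cong[OF module module U bilinear_comult_right[OF U module T] comult_closed[OF x]
          inner_right])
  also have "\<dots> = \<chi> x"
    by (rule counit_right_hom[OF U homs(1) x])
  finally show ?thesis ..
qed

end

section \<open>The algebra structure on H \<otimes> H\<close>

context hopf_algebra
begin

sublocale H: ring H by (rule ring)

lemma mult_bilinear: "bilinear K H H H (\<lambda>x y. x \<otimes>\<^bsub>H\<^esub> y)"
  by (intro bilinearI module_homI) (auto simp: H.l_distr H.r_distr smult_mult_left smult_mult_right)

lemmas pure_bilinear = pure_tensor_bilinear[OF module module]
lemmas pure_closed = pure_tensor_closed[OF module module]

text \<open>The product of two pure tensors is linear in each of four variables. One of them is
  fixed here so that the facts on trilinear maps apply.\<close>

lemma tensor_mult_inner_trilinear: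
  assumes "a \<in> carrier H"
  shows "trilinear K H H H HH (\<lambda>b c d. pure_tensor K H H (a \<otimes>\<^bsub>H\<^esub> c) (b \<otimes>\<^bsub>H\<^esub> d))"
  using assms
  by (intro trilinearI module_homI)
    (auto simp: pure_closed H.l_distr H.r_distr smult_mult_left smult_mult_right bilinear_simps[OF pure_bilinear])

text \<open>The outer lift in \<open>tensor_mult\<close> makes sense once the inner one is bilinear
  in its parameters \<open>a\<close> and \<open>b\<close>.\<close>

lemma tensor_mult_outer_bilinear:
  assumes "t \<in> carrier HH"
  shows "bilinear K H H HH (\<lambda>a b. tensor_lift K HH (\<lambda>c d. pure_tensor K H H (a \<otimes>\<^bsub>H\<^esub> c) (b \<otimes>\<^bsub>H\<^esub> d)) t)"
proof (rule bilinearI)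
  fix a assume a: "a \<in> carrier H"
  show "(\<lambda>b. tensor_lift K HH (\<lambda>c d. pure_tensor K H H (a \<otimes>\<^bsub>H\<^esub> c) (b \<otimes>\<^bsub>H\<^esub> d)) t) \<in> module_hom K H HH"
    by (rule tensor_lift_param_hom[OF module module HH_module module assms])
      (use tensor_mult_inner_trilinear[OF a] in \<open>auto simp: trilinear_def\<close>)
next
  fix b assume b: "b \<in> carrier H"
  show "(\<lambda>a. tensor_lift K HH (\<lambda>c d. pure_tensor K H H (a \<otimes>\<^bsub>H\<^esub> c) (b \<otimes>\<^bsub>H\<^esub> d)) t) \<in> module_hom K H HH"
  proof (rule tensor_lift_param_hom[OF module module HH_module module assms])
    fix c d assume "c \<in> carrier H" "d \<in> carrier H"
    then show "(\<lambda>a. pure_tensor K H H (a \<otimes>\<^bsub>H\<^esub> c) (b \<otimes>\<^bsub>H\<^esub> d)) \<in> module_hom K H HH"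
      using b by (intro module_homI) (auto simp: pure_closed H.l_distr smult_mult_left bilinear_simps[OF pure_bilinear])
  qed (use tensor_mult_inner_trilinear b in \<open>auto simp: trilinear_def\<close>)
qed

lemma tensor_mult_pure_left:
  assumes "a \<in> carrier H" "b \<in> carrier H" "t \<in> carrier HH"
  shows "tensor_mult K H (pure_tensor K H H a b) t
    = tensor_lift K HH (\<lambda>c d. pure_tensor K H H (a \<otimes>\<^bsub>H\<^esub> c) (b \<otimes>\<^bsub>H\<^esub> d)) t"
  unfolding tensor_mult_def
  by (rule tensor_lift_pure[OF module module HH_module tensor_mult_outer_bilinear[OF assms(3)] assms(1,2)])

lemma tensor_mult_pure:
  assumes "a \<in> carrier H" "b \<in> carrier H" "c \<in> carrier H" "d \<in> carrier H"
  shows "tensor_mult K H (pure_tensor K H H a b) (pure_tensor K H H c d)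
    = pure_tensor K H H (a \<otimes>\<^bsub>H\<^esub> c) (b \<otimes>\<^bsub>H\<^esub> d)"
  using assms tensor_lift_pure[OF module module HH_module
      trilinearD(2)[OF tensor_mult_inner_trilinear[OF assms(1)] assms(2)] assms(3,4)]
  by (simp add: tensor_mult_pure_left pure_closed)

lemma tensor_mult_bilinear: "bilinear K HH HH HH (tensor_mult K H)"
proof (rule bilinearI)
  fix s assume "s \<in> carrier HH"
  then show "(\<lambda>t. tensor_mult K H s t) \<in> module_hom K HH HH"
    unfolding tensor_mult_def
    using tensor_mult_outer_bilinear
      tensor_lift_hom[OF module module HH_module trilinearD(2)[OF tensor_mult_inner_trilinear]]
    by (intro tensor_lift_param_hom[OF module module HH_module HH_module]) auto
next
  fix t assume "t \<in> carrier HH"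
  then show "(\<lambda>s. tensor_mult K H s t) \<in> module_hom K HH HH"
    unfolding tensor_mult_def
    by (rule tensor_lift_hom[OF module module HH_module tensor_mult_outer_bilinear])
qed

lemmas tensor_mult_closed = bilinear_closed[OF tensor_mult_bilinear]
lemmas tensor_mult_simps = bilinear_simps[OF tensor_mult_bilinear]

lemma tensor_mult_one:
  assumes "t \<in> carrier HH"
  shows "tensor_mult K H (pure_tensor K H H \<one>\<^bsub>H\<^esub> \<one>\<^bsub>H\<^esub>) t = t"
    and "tensor_mult K H t (pure_tensor K H H \<one>\<^bsub>H\<^esub> \<one>\<^bsub>H\<^esub>) = t"
  using module module assms
  by (induction t rule: tensor_induct) (auto simp: tensor_mult_pure tensor_mult_simps pure_closed)

lemma tensor_mult_assoc:
  assumes "r \<in> carrier HH" "s \<in> carrier HH" "t \<in> carrier HH"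
  shows "tensor_mult K H (tensor_mult K H r s) t = tensor_mult K H r (tensor_mult K H s t)"
  using module module assms(1)
proof (induction r rule: tensor_induct)
  case (pure a b)
  show ?case
    using module module assms(2)
  proof (induction s rule: tensor_induct)
    case p: (pure c d)
    show ?case
      using module module assms(3)
      by (induction t rule: tensor_induct)
        (use pure p in \<open>auto simp: tensor_mult_pure tensor_mult_simps tensor_mult_closed pure_closed H.m_assoc\<close>)
  qed (use pure assms(3) in \<open>auto simp: tensor_mult_simps tensor_mult_closed pure_closed\<close>)
qed (use assms in \<open>auto simp: tensor_mult_simps tensor_mult_closed\<close>)

section \<open>The antipode against comultiplication and counit\<close>

lemmas antipode_closed = module_hom_closed[OF antipode_linear]

lemma antipode_swap_bilinear:
  "bilinear K H H HH (\<lambda>a b. pure_tensor K H H (antipode H b) (antipode H a))"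
  by (rule bilinear_swap[OF bilinear_precomp[OF pure_bilinear antipode_linear antipode_linear]])

text \<open>Both sides are convolution inverses of \<open>\<Delta> : H \<rightarrow> H \<otimes> H\<close>.\<close>

lemma comult_antipode:
  assumes x: "x \<in> carrier H"
  shows "\<Delta>\<^bsub>H\<^esub> (antipode H x)
    = tensor_lift K HH (\<lambda>a b. pure_tensor K H H (antipode H b) (antipode H a)) (\<Delta>\<^bsub>H\<^esub> x)"
proof -
  let ?S = "antipode H" and ?p = "pure_tensor K H H" and ?lift = "tensor_lift K HH"
  let ?m = "tensor_mult K H" and ?e = "pure_tensor K H H \<one>\<^bsub>H\<^esub> \<one>\<^bsub>H\<^esub>"
  let ?\<chi> = "\<lambda>x. ?lift (\<lambda>a b. ?p (?S b) (?S a)) (\<Delta>\<^bsub>H\<^esub> x)"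
  note SS = antipode_swap_bilinear
  note lin = H.l_distr H.r_distr smult_mult_left smult_mult_right bilinear_simps[OF pure_bilinear]
    module_hom_add[OF antipode_linear] module_hom_smult[OF antipode_linear]
    module_hom_add[OF comult_linear] module_hom_smult[OF comult_linear]
    pure_closed antipode_closed comult_closed tensor_mult_simps tensor_mult_closed
  have \<chi>: "?\<chi> \<in> module_hom K H HH"
    by (rule module_hom_comp[OF comult_linear tensor_lift_hom[OF module module HH_module SS]])
  \<comment> \<open>In Sweedler notation: S(x2) x3 \<otimes> S(x1) x4 = 1 \<otimes> S(x1) x2 =
    \<epsilon>(x) 1 \<otimes> 1. The map \<open>?\<chi>\<close> is the candidate for \<Delta> after
    S.\<close>
  have left: "?lift (\<lambda>y z. ?m (?\<chi> y) (\<Delta>\<^bsub>H\<^esub> z)) (\<Delta>\<^bsub>H\<^esub> x) = \<epsilon>\<^bsub>H\<^esub> x \<odot>\<^bsub>HH\<^esub> ?e" if x: "x \<in> carrier H" for x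
  proof -
    let ?T = "\<lambda>a b v. ?m (?p (?S b) (?S a)) (\<Delta>\<^bsub>H\<^esub> v)"
    have T: "trilinear K H H H HH ?T"
      by (intro trilinearI module_homI) (auto simp: lin)
    \<comment> \<open>Here \<open>a\<close> stands for the first component and \<open>w\<close> for
      the rest. The regrouping gives S(w1) w2 \<otimes> S(a) w3 = \<epsilon>(w1) 1 \<otimes> S(a) w2
      = 1 \<otimes> S(a) w.\<close>
    have inner: "?lift (?T a) (\<Delta>\<^bsub>H\<^esub> w) = ?p \<one>\<^bsub>H\<^esub> (?S a \<otimes>\<^bsub>H\<^esub> w)" if a: "a \<in> carrier H" and w: "w \<in> carrier H" for a w
    proof -
      let ?R = "\<lambda>b c d. ?p (?S b \<otimes>\<^bsub>H\<^esub> c) (?S a \<otimes>\<^bsub>H\<^esub> d)"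
      have R: "trilinear K H H H HH ?R"
        using a by (intro trilinearI module_homI) (auto simp: lin)
      have Sm: "bilinear K H H H (\<lambda>b c. ?S b \<otimes>\<^bsub>H\<^esub> c)"
        by (rule bilinear_precomp[OF mult_bilinear antipode_linear module_hom_id])
      have f: "(\<lambda>d. ?p \<one>\<^bsub>H\<^esub> (?S a \<otimes>\<^bsub>H\<^esub> d)) \<in> module_hom K H HH"
        using a by (intro module_homI) (auto simp: lin)
      have "?lift (?T a) (\<Delta>\<^bsub>H\<^esub> w) = ?lift (\<lambda>b v. ?lift (?R b) (\<Delta>\<^bsub>H\<^esub> v)) (\<Delta>\<^bsub>H\<^esub> w)"
        by (rule tensor_lift_cong[OF module module HH_module trilinearD(2)[OF T a] comult_closed[OF w]])
          (use a in \<open>simp add: tensor_mult_pure_left antipode_closed comult_closed\<close>)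
      also have "\<dots> = ?lift (\<lambda>y d. ?lift (\<lambda>b c. ?R b c d) (\<Delta>\<^bsub>H\<^esub> y)) (\<Delta>\<^bsub>H\<^esub> w)"
        by (rule coassoc_trilinear[OF HH_module R w, symmetric])
      also have "\<dots> = ?lift (\<lambda>y d. \<epsilon>\<^bsub>H\<^esub> y \<odot>\<^bsub>HH\<^esub> ?p \<one>\<^bsub>H\<^esub> (?S a \<otimes>\<^bsub>H\<^esub> d)) (\<Delta>\<^bsub>H\<^esub> w)"
      proof (rule tensor_lift_cong[OF module module HH_module bilinear_comult_left[OF HH_module module R] comult_closed[OF w]])
        fix y d assume y: "y \<in> carrier H" and d: "d \<in> carrier H"
        have g: "(\<lambda>h. ?p h (?S a \<otimes>\<^bsub>H\<^esub> d)) \<in> module_hom K H HH"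
          using a d by (intro module_homI) (auto simp: lin)
        have "?lift (\<lambda>b c. ?R b c d) (\<Delta>\<^bsub>H\<^esub> y) = ?p (tensor_lift K H (\<lambda>b c. ?S b \<otimes>\<^bsub>H\<^esub> c) (\<Delta>\<^bsub>H\<^esub> y)) (?S a \<otimes>\<^bsub>H\<^esub> d)"
          by (rule hom_tensor_lift[OF module module module HH_module Sm g comult_closed[OF y], symmetric])
        also have "\<dots> = \<epsilon>\<^bsub>H\<^esub> y \<odot>\<^bsub>HH\<^esub> ?p \<one>\<^bsub>H\<^esub> (?S a \<otimes>\<^bsub>H\<^esub> d)"
          using y a d by (simp add: antipode_left lin counit_closed)
        finally show "?lift (\<lambda>b c. ?R b c d) (\<Delta>\<^bsub>H\<^esub> y) = \<epsilon>\<^bsub>H\<^esub> y \<odot>\<^bsub>HH\<^esub> ?p \<one>\<^bsub>H\<^esub> (?S a \<otimes>\<^bsub>H\<^esub> d)" .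
      qed
      also have "\<dots> = ?p \<one>\<^bsub>H\<^esub> (?S a \<otimes>\<^bsub>H\<^esub> w)"
        by (rule counit_left_hom[OF HH_module f w])
      finally show ?thesis .
    qed
    have f: "(\<lambda>h. ?p \<one>\<^bsub>H\<^esub> h) \<in> module_hom K H HH"
      by (rule bilinear_right[OF pure_bilinear]) simp
    have Sm: "bilinear K H H H (\<lambda>b c. ?S b \<otimes>\<^bsub>H\<^esub> c)"
      by (rule bilinear_precomp[OF mult_bilinear antipode_linear module_hom_id])
    have "?lift (\<lambda>y z. ?m (?\<chi> y) (\<Delta>\<^bsub>H\<^esub> z)) (\<Delta>\<^bsub>H\<^esub> x) = ?lift (\<lambda>y z. ?lift (\<lambda>a b. ?T a b z) (\<Delta>\<^bsub>H\<^esub> y)) (\<Delta>\<^bsub>H\<^esub> x)"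
      by (rule tensor_lift_cong[OF module module HH_module
            bilinear_precomp[OF tensor_mult_bilinear \<chi> comult_linear] comult_closed[OF x]])
        (rule hom_tensor_lift[OF module module HH_module HH_module SS bilinear_left[OF tensor_mult_bilinear]],
          auto simp: comult_closed)
    also have "\<dots> = ?lift (\<lambda>a w. ?lift (?T a) (\<Delta>\<^bsub>H\<^esub> w)) (\<Delta>\<^bsub>H\<^esub> x)"
      by (rule coassoc_trilinear[OF HH_module T x])
    also have "\<dots> = ?lift (\<lambda>a w. ?p \<one>\<^bsub>H\<^esub> (?S a \<otimes>\<^bsub>H\<^esub> w)) (\<Delta>\<^bsub>H\<^esub> x)"
      by (rule tensor_lift_cong[OF module module HH_module bilinear_comult_right[OF HH_module module T] comult_closed[OF x] inner])
    also have "\<dots> = ?p \<one>\<^bsub>H\<^esub> (tensor_lift K H (\<lambda>a w. ?S a \<otimes>\<^bsub>H\<^esub> w) (\<Delta>\<^bsub>H\<^esub> x))"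
      by (rule hom_tensor_lift[OF module module module HH_module Sm f comult_closed[OF x], symmetric])
    also have "\<dots> = \<epsilon>\<^bsub>H\<^esub> x \<odot>\<^bsub>HH\<^esub> ?e"
      using x by (simp add: antipode_left lin counit_closed)
    finally show ?thesis .
  qed
  \<comment> \<open>Multiplicativity of \<Delta> suffices: \<Delta>(x1) \<Delta>(S(x2)) =
    \<Delta>(x1 S(x2)) = \<epsilon>(x) \<Delta>(1).\<close>
  have right: "?lift (\<lambda>y z. ?m (\<Delta>\<^bsub>H\<^esub> y) (\<Delta>\<^bsub>H\<^esub> (?S z))) (\<Delta>\<^bsub>H\<^esub> x) = \<epsilon>\<^bsub>H\<^esub> x \<odot>\<^bsub>HH\<^esub> ?e" if x: "x \<in> carrier H" for x
  proof -
    have mS: "bilinear K H H H (\<lambda>b c. b \<otimes>\<^bsub>H\<^esub> ?S c)"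
      by (rule bilinear_precomp[OF mult_bilinear module_hom_id antipode_linear])
    have "?lift (\<lambda>y z. ?m (\<Delta>\<^bsub>H\<^esub> y) (\<Delta>\<^bsub>H\<^esub> (?S z))) (\<Delta>\<^bsub>H\<^esub> x) = ?lift (\<lambda>y z. \<Delta>\<^bsub>H\<^esub> (y \<otimes>\<^bsub>H\<^esub> ?S z)) (\<Delta>\<^bsub>H\<^esub> x)"
      by (rule tensor_lift_cong[OF module module HH_module bilinear_precomp[OF tensor_mult_bilinear
              comult_linear module_hom_comp[OF antipode_linear comult_linear]] comult_closed[OF x]])
        (simp add: comult_mult antipode_closed)
    also have "\<dots> = \<Delta>\<^bsub>H\<^esub> (tensor_lift K H (\<lambda>y z. y \<otimes>\<^bsub>H\<^esub> ?S z) (\<Delta>\<^bsub>H\<^esub> x))"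
      by (rule hom_tensor_lift[OF module module module HH_module mS comult_linear comult_closed[OF x], symmetric])
    also have "\<dots> = \<epsilon>\<^bsub>H\<^esub> x \<odot>\<^bsub>HH\<^esub> ?e"
      using x by (simp add: antipode_right module_hom_smult[OF comult_linear] comult_one counit_closed)
    finally show ?thesis .
  qed
  have "?\<chi> x = \<Delta>\<^bsub>H\<^esub> (?S x)"
    by (rule convolution_inverse_unique[OF HH_module tensor_mult_bilinear tensor_mult_assoc
          pure_closed[OF H.one_closed H.one_closed] tensor_mult_one(1) tensor_mult_one(2) \<chi> comult_linear
          module_hom_comp[OF antipode_linear comult_linear] left right x])
  then show ?thesis ..
qed

text \<open>\<epsilon>(S(x)) = \<epsilon>(S(x1)) \<epsilon>(x2) = \<epsilon>(S(x1) x2) =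
  \<epsilon>(x) \<epsilon>(1).\<close>

lemma counit_antipode:
  assumes x: "x \<in> carrier H"
  shows "\<epsilon>\<^bsub>H\<^esub> (antipode H x) = \<epsilon>\<^bsub>H\<^esub> x"
proof -
  let ?S = "antipode H"
  \<comment> \<open>Lifts take values in modules, so the scalars are carried as multiples of the
    unit of H. Applying \<epsilon> once more at the end recovers them.\<close>
  have eta: "(\<lambda>h. \<epsilon>\<^bsub>H\<^esub> h \<odot>\<^bsub>H\<^esub> \<one>\<^bsub>H\<^esub>) \<in> module_hom K H H"
    by (rule counit_smult_hom[OF module]) simp
  have Sm: "bilinear K H H H (\<lambda>b c. ?S b \<otimes>\<^bsub>H\<^esub> c)"
    by (rule bilinear_precomp[OF mult_bilinear antipode_linear module_hom_id])
  have "\<epsilon>\<^bsub>H\<^esub> (?S x) \<odot>\<^bsub>H\<^esub> \<one>\<^bsub>H\<^esub> = tensor_lift K H (\<lambda>y z. \<epsilon>\<^bsub>H\<^esub> z \<odot>\<^bsub>H\<^esub> (\<epsilon>\<^bsub>H\<^esub> (?S y) \<odot>\<^bsub>H\<^esub> \<one>\<^bsub>H\<^esub>)) (\<Delta>\<^bsub>H\<^esub> x)"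
    by (rule counit_right_hom[OF module module_hom_comp[OF antipode_linear eta] x, symmetric])
  also have "\<dots> = tensor_lift K H (\<lambda>y z. \<epsilon>\<^bsub>H\<^esub> (?S y \<otimes>\<^bsub>H\<^esub> z) \<odot>\<^bsub>H\<^esub> \<one>\<^bsub>H\<^esub>) (\<Delta>\<^bsub>H\<^esub> x)"
    by (rule tensor_lift_cong[symmetric, OF module module module bilinear_postcomp[OF Sm eta] comult_closed[OF x]])
      (simp add: counit_mult antipode_closed counit_closed smult_assoc1[symmetric] R.m_comm)
  also have "\<dots> = \<epsilon>\<^bsub>H\<^esub> (tensor_lift K H (\<lambda>y z. ?S y \<otimes>\<^bsub>H\<^esub> z) (\<Delta>\<^bsub>H\<^esub> x)) \<odot>\<^bsub>H\<^esub> \<one>\<^bsub>H\<^esub>"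
    by (rule hom_tensor_lift[OF module module module module Sm eta comult_closed[OF x], symmetric])
  also have "\<dots> = \<epsilon>\<^bsub>H\<^esub> x \<odot>\<^bsub>H\<^esub> \<one>\<^bsub>H\<^esub>"
    using x by (simp add: antipode_left counit_smult counit_one counit_closed)
  finally have "\<epsilon>\<^bsub>H\<^esub> (\<epsilon>\<^bsub>H\<^esub> (?S x) \<odot>\<^bsub>H\<^esub> \<one>\<^bsub>H\<^esub>) = \<epsilon>\<^bsub>H\<^esub> (\<epsilon>\<^bsub>H\<^esub> x \<odot>\<^bsub>H\<^esub> \<one>\<^bsub>H\<^esub>)"
    by simp
  then show ?thesis
    using x by (simp add: counit_smult counit_one counit_closed antipode_closed)
qed

end

section \<open>Images and quotients of Hopf braces\<close>

lemma hopf_algebra_homD: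
  assumes "p \<in> hopf_algebra_hom K G H"
  shows "p \<in> module_hom K G H" "p \<in> ring_hom G H"
    and "x \<in> carrier G \<Longrightarrow> \<Delta>\<^bsub>H\<^esub> (p x) = tensor_map K H H p p (\<Delta>\<^bsub>G\<^esub> x)"
    and "x \<in> carrier G \<Longrightarrow> \<epsilon>\<^bsub>H\<^esub> (p x) = \<epsilon>\<^bsub>G\<^esub> x"
    and "x \<in> carrier G \<Longrightarrow> p (antipode G x) = antipode H (p x)"
  using assms by (auto simp: hopf_algebra_hom_def)

text \<open>The target is only a module with a linear comultiplication, because the locale serves to
  derive the coalgebra axioms of an image.\<close>

locale coalgebra_map = coalgebra K H
  for K :: "('k, 'r) ring_scheme" and H :: "('k, 'h, 'm) coalgebra_scheme" +
  fixes Q :: "('k, 'q, 'n) coalgebra_scheme" and p :: "'h \<Rightarrow> 'q"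
  assumes target_module: "module K Q"
    and target_comult_linear: "\<Delta>\<^bsub>Q\<^esub> \<in> module_hom K Q (tensor_product K Q Q)"
    and map_linear: "p \<in> module_hom K H Q"
    and map_comult: "x \<in> carrier H \<Longrightarrow> \<Delta>\<^bsub>Q\<^esub> (p x) = tensor_map K Q Q p p (\<Delta>\<^bsub>H\<^esub> x)"
begin

lemmas map_closed = module_hom_closed[OF map_linear]

text \<open>The components of p x are the images of the components of x, so a sum in
  \<open>Q\<close> is computed as a sum in \<open>H\<close>.\<close>

lemma lift_map_comult:
  assumes "module K U" "bilinear K Q Q U \<phi>" "x \<in> carrier H"
  shows "tensor_lift K U \<phi> (\<Delta>\<^bsub>Q\<^esub> (p x)) = tensor_lift K U (\<lambda>a b. \<phi> (p a) (p b)) (\<Delta>\<^bsub>H\<^esub> x)"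
  using assms(3) tensor_lift_tensor_map[OF module module target_module target_module map_linear map_linear
      assms(1,2) comult_closed[OF assms(3)]]
  by (simp add: map_comult)

lemma lift_map_comult_right:
  assumes U: "module K U" and \<phi>: "trilinear K Q Q Q U \<phi>" and x: "x \<in> carrier H"
  shows "tensor_lift K U (\<lambda>a t. tensor_lift K U (\<phi> a) (\<Delta>\<^bsub>Q\<^esub> t)) (\<Delta>\<^bsub>Q\<^esub> (p x))
    = tensor_lift K U (\<lambda>a t. tensor_lift K U (\<lambda>b c. \<phi> (p a) (p b) (p c)) (\<Delta>\<^bsub>H\<^esub> t)) (\<Delta>\<^bsub>H\<^esub> x)"
proof -
  note Q = target_module
  have b: "bilinear K Q Q U (\<lambda>a t. tensor_lift K U (\<phi> a) (\<Delta>\<^bsub>Q\<^esub> t))"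
    by (rule bilinear_precomp[OF tensor_lift_trilinear_right[OF Q Q Q U \<phi>] module_hom_id
          target_comult_linear])
  show ?thesis
    unfolding lift_map_comult[OF U b x]
    by (rule tensor_lift_cong[OF module module U bilinear_precomp[OF b map_linear map_linear]
          comult_closed[OF x]])
      (rule lift_map_comult[OF U trilinearD(2)[OF \<phi> map_closed]])
qed

lemma lift_map_comult_left:
  assumes U: "module K U" and \<phi>: "trilinear K Q Q Q U \<phi>" and x: "x \<in> carrier H"
  shows "tensor_lift K U (\<lambda>t c. tensor_lift K U (\<lambda>a b. \<phi> a b c) (\<Delta>\<^bsub>Q\<^esub> t)) (\<Delta>\<^bsub>Q\<^esub> (p x))
    = tensor_lift K U (\<lambda>t c. tensor_lift K U (\<lambda>a b. \<phi> (p a) (p b) (p c)) (\<Delta>\<^bsub>H\<^esub> t)) (\<Delta>\<^bsub>H\<^esub> x)"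
proof -
  note Q = target_module
  have b: "bilinear K Q Q U (\<lambda>t c. tensor_lift K U (\<lambda>a b. \<phi> a b c) (\<Delta>\<^bsub>Q\<^esub> t))"
    by (rule bilinear_precomp[OF tensor_lift_trilinear_left[OF Q Q Q U \<phi>]
          target_comult_linear module_hom_id])
  show ?thesis
    unfolding lift_map_comult[OF U b x]
    by (rule tensor_lift_cong[OF module module U bilinear_precomp[OF b map_linear map_linear]
          comult_closed[OF x]])
      (rule lift_map_comult[OF U trilinearD(3)[OF \<phi> map_closed]])
qed

lemma trilinear_map:
  assumes \<phi>: "trilinear K Q Q Q U \<phi>"
  shows "trilinear K H H H U (\<lambda>a b c. \<phi> (p a) (p b) (p c))"
  unfolding trilinear_def
  using bilinear_precomp[OF trilinearD(2)[OF \<phi> map_closed] map_linear map_linear]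
    module_hom_comp[OF map_linear trilinearD(1)[OF \<phi> map_closed map_closed]]
  by blast

text \<open>Both sides are pulled back to sums over the components of x in \<open>H\<close>, where
  they agree by coassociativity for the trilinear map precomposed with p.\<close>

lemma coassoc_image:
  assumes "x \<in> carrier H"
  shows "tensor_lift K (tensor_product K Q (tensor_product K Q Q)) (\<lambda>y z.
        tensor_lift K (tensor_product K Q (tensor_product K Q Q)) (\<lambda>u v.
          pure_tensor K Q (tensor_product K Q Q) u (pure_tensor K Q Q v z)) (\<Delta>\<^bsub>Q\<^esub> y)) (\<Delta>\<^bsub>Q\<^esub> (p x))
      = tensor_lift K (tensor_product K Q (tensor_product K Q Q)) (\<lambda>y z.
          pure_tensor K Q (tensor_product K Q Q) y (\<Delta>\<^bsub>Q\<^esub> z)) (\<Delta>\<^bsub>Q\<^esub> (p x))"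
proof -
  note Q = target_module
  let ?QQ = "tensor_product K Q Q"
  let ?M = "tensor_product K Q ?QQ" and ?\<phi> = "\<lambda>u v z. pure_tensor K Q ?QQ u (pure_tensor K Q Q v z)"
  have QQ: "module K ?QQ" and M: "module K ?M"
    using Q by (auto intro!: tensor_product_module)
  have \<phi>: "trilinear K Q Q Q ?M ?\<phi>"
    by (rule trilinear_pure_tensor) (rule Q)+
  have \<phi>p: "trilinear K H H H ?M (\<lambda>a b c. ?\<phi> (p a) (p b) (p c))"
    by (rule trilinear_map[OF \<phi>])
  have pb: "bilinear K Q ?QQ ?M (pure_tensor K Q ?QQ)"
    by (rule pure_tensor_bilinear[OF Q QQ])
  \<comment> \<open>This writes y \<otimes> \<Delta>(z) as a sum over the components of z, the shape
    that \<open>lift_map_comult_right\<close> expects.\<close>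
  have \<Delta>: "pure_tensor K Q ?QQ y (\<Delta>\<^bsub>Q\<^esub> z) = tensor_lift K ?M (?\<phi> y) (\<Delta>\<^bsub>Q\<^esub> z)"
    if "y \<in> carrier Q" "z \<in> carrier Q" for y z
  proof -
    note t = module_hom_closed[OF target_comult_linear that(2)]
    show ?thesis
      by (rule tensor_hom_eqI[OF Q Q bilinear_right[OF pb that(1)]
            tensor_lift_hom[OF Q Q M trilinearD(2)[OF \<phi> that(1)]] t])
        (simp add: tensor_lift_pure[OF Q Q M trilinearD(2)[OF \<phi> that(1)]])
  qed
  have b: "bilinear K Q Q ?M (\<lambda>y z. pure_tensor K Q ?QQ y (\<Delta>\<^bsub>Q\<^esub> z))"
    by (rule bilinear_precomp[OF pb module_hom_id target_comult_linear])
  have cl: "\<Delta>\<^bsub>Q\<^esub> (p x) \<in> carrier ?QQ"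
    using module_hom_closed[OF target_comult_linear map_closed] assms .
  have "tensor_lift K ?M (\<lambda>y z. pure_tensor K Q ?QQ y (\<Delta>\<^bsub>Q\<^esub> z)) (\<Delta>\<^bsub>Q\<^esub> (p x))
      = tensor_lift K ?M (\<lambda>y z. tensor_lift K ?M (?\<phi> y) (\<Delta>\<^bsub>Q\<^esub> z)) (\<Delta>\<^bsub>Q\<^esub> (p x))"
    by (rule tensor_lift_cong[OF Q Q M b cl \<Delta>])
  then show ?thesis
    unfolding lift_map_comult_right[OF M \<phi> assms] lift_map_comult_left[OF M \<phi> assms]
    using coassoc_trilinear[OF M \<phi>p assms] by simp
qed

end

section \<open>Hopf algebra structures on images, and factorization\<close>

lemma hopf_algebra_surj_image:
  assumes H: "hopf_algebra K H" and p: "p \<in> hopf_algebra_hom K H Q"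
    and surj: "p ` carrier H = carrier Q" and zero: "p \<zero>\<^bsub>H\<^esub> = \<zero>\<^bsub>Q\<^esub>"
  shows "hopf_algebra K Q"
proof -
  interpret H: hopf_algebra K H by fact
  note p_lin = hopf_algebra_homD(1)[OF p] and p_ring = hopf_algebra_homD(2)[OF p]
  note hom = module_hom_closed[OF p_lin] module_hom_add[OF p_lin, symmetric]
    module_hom_smult[OF p_lin, symmetric]
    ring_hom_mult[OF p_ring, symmetric] ring_hom_one[OF p_ring, symmetric]
    hopf_algebra_homD(4)[OF p] hopf_algebra_homD(5)[OF p, symmetric]
  note \<Delta> = hopf_algebra_homD(3)[OF p]
  have sur: "\<exists>x\<in>carrier H. y = p x" if "y \<in> carrier Q" for y
    using that surj by auto
  have Q: "module K Q"
    by (rule module_surj_image[OF H.module p_lin surj zero])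
  interpret Q: module K Q by (rule Q)
  have ring: "ring Q"
    by (rule ring_surj_image[OF H.ring p_ring surj zero])
  interpret Qr: ring Q by (rule ring)
  note t_hom = tensor_map_hom[OF H.module H.module Q Q p_lin p_lin]
  have QQ: "module K (tensor_product K Q Q)"
    by (rule tensor_product_module[OF Q Q])
  have \<Delta>_lin: "\<Delta>\<^bsub>Q\<^esub> \<in> module_hom K Q (tensor_product K Q Q)"
  proof (rule module_homI)
    fix x assume "x \<in> carrier Q"
    then obtain x' where x': "x' \<in> carrier H" "x = p x'" using sur by blast
    then show "\<Delta>\<^bsub>Q\<^esub> x \<in> carrier (tensor_product K Q Q)"
      by (simp add: \<Delta> module_hom_closed[OF t_hom] H.comult_closed)
    show "\<Delta>\<^bsub>Q\<^esub> (a \<odot>\<^bsub>Q\<^esub> x) = a \<odot>\<^bsub>tensor_product K Q Q\<^esub> \<Delta>\<^bsub>Q\<^esub> x" if "a \<in> carrier K" for a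
      using x' that by (simp add: hom \<Delta> module_hom_smult[OF t_hom] module_hom_smult[OF H.comult_linear]
          H.comult_closed)
    fix y assume "y \<in> carrier Q"
    then obtain y' where y': "y' \<in> carrier H" "y = p y'" using sur by blast
    then show "\<Delta>\<^bsub>Q\<^esub> (x \<oplus>\<^bsub>Q\<^esub> y) = \<Delta>\<^bsub>Q\<^esub> x \<oplus>\<^bsub>tensor_product K Q Q\<^esub> \<Delta>\<^bsub>Q\<^esub> y"
      using x' by (simp add: hom \<Delta> module_hom_add[OF t_hom] module_hom_add[OF H.comult_linear]
          H.comult_closed)
  qed
  interpret M: coalgebra_map K H Q p
    by unfold_locales (rule Q \<Delta>_lin p_lin \<Delta>)+
  have \<epsilon>_closed: "\<epsilon>\<^bsub>Q\<^esub> y \<in> carrier K" if "y \<in> carrier Q" for y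
    using sur[OF that] by (auto simp: hom H.counit_closed)
  have \<epsilon>_add: "\<epsilon>\<^bsub>Q\<^esub> (x \<oplus>\<^bsub>Q\<^esub> y) = \<epsilon>\<^bsub>Q\<^esub> x \<oplus>\<^bsub>K\<^esub> \<epsilon>\<^bsub>Q\<^esub> y" if "x \<in> carrier Q" "y \<in> carrier Q" for x y
    using that[THEN sur] by (auto simp: hom H.counit_add)
  have \<epsilon>_smult: "\<epsilon>\<^bsub>Q\<^esub> (a \<odot>\<^bsub>Q\<^esub> x) = a \<otimes>\<^bsub>K\<^esub> \<epsilon>\<^bsub>Q\<^esub> x" if "a \<in> carrier K" "x \<in> carrier Q" for a x
    using sur[OF that(2)] that(1) by (auto simp: hom H.counit_smult)
  have mult_left: "(a \<odot>\<^bsub>Q\<^esub> x) \<otimes>\<^bsub>Q\<^esub> y = a \<odot>\<^bsub>Q\<^esub> (x \<otimes>\<^bsub>Q\<^esub> y)"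
    if "a \<in> carrier K" "x \<in> carrier Q" "y \<in> carrier Q" for a x y
    using that(2,3)[THEN sur] that(1) by (auto simp: hom H.smult_mult_left)
  have mult_right: "x \<otimes>\<^bsub>Q\<^esub> (a \<odot>\<^bsub>Q\<^esub> y) = a \<odot>\<^bsub>Q\<^esub> (x \<otimes>\<^bsub>Q\<^esub> y)"
    if "a \<in> carrier K" "x \<in> carrier Q" "y \<in> carrier Q" for a x y
    using that(2,3)[THEN sur] that(1) by (auto simp: hom H.smult_mult_right)
  have S_lin: "antipode Q \<in> module_hom K Q Q"
  proof (rule module_homI)
    fix x assume "x \<in> carrier Q"
    then obtain x' where x': "x' \<in> carrier H" "x = p x'" using sur by blast
    then show "antipode Q x \<in> carrier Q"
      by (simp add: hom H.antipode_closed)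
    show "antipode Q (a \<odot>\<^bsub>Q\<^esub> x) = a \<odot>\<^bsub>Q\<^esub> antipode Q x" if "a \<in> carrier K" for a
      using x' that by (simp add: hom H.antipode_closed module_hom_smult[OF H.antipode_linear])
    fix y assume "y \<in> carrier Q"
    then obtain y' where y': "y' \<in> carrier H" "y = p y'" using sur by blast
    then show "antipode Q (x \<oplus>\<^bsub>Q\<^esub> y) = antipode Q x \<oplus>\<^bsub>Q\<^esub> antipode Q y"
      using x' by (simp add: hom H.antipode_closed module_hom_add[OF H.antipode_linear])
  qed
  have m: "bilinear K Q Q Q (\<lambda>x y. x \<otimes>\<^bsub>Q\<^esub> y)"
    by (intro bilinearI module_homI) (auto simp: Qr.l_distr Qr.r_distr mult_left mult_right)
  have \<epsilon>_bil: "bilinear K Q Q Q (\<lambda>y z. \<epsilon>\<^bsub>Q\<^esub> y \<odot>\<^bsub>Q\<^esub> z)"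
    by (intro bilinearI module_homI)
      (auto simp: \<epsilon>_closed \<epsilon>_add \<epsilon>_smult Q.smult_l_distr Q.smult_r_distr Q.smult_assoc1[symmetric] H.R.m_comm)
  \<comment> \<open>The counit and antipode axioms of \<open>Q\<close> are equations between single
    sums. Each is the image under p of the axiom in \<open>H\<close>, once p carries the summand
    \<psi> to the summand \<phi>.\<close>
  have transfer: "tensor_lift K Q \<phi> (\<Delta>\<^bsub>Q\<^esub> (p x)) = p (tensor_lift K H \<psi> (\<Delta>\<^bsub>H\<^esub> x))"
    if x: "x \<in> carrier H" and \<phi>: "bilinear K Q Q Q \<phi>" and \<psi>: "bilinear K H H H \<psi>"
      and eq: "\<And>a b. \<lbrakk>a \<in> carrier H; b \<in> carrier H\<rbrakk> \<Longrightarrow> \<phi> (p a) (p b) = p (\<psi> a b)" for x \<phi> \<psi>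
    unfolding M.lift_map_comult[OF Q \<phi> x] hom_tensor_lift[OF H.module H.module H.module Q \<psi> p_lin H.comult_closed[OF x]]
    by (rule tensor_lift_cong[OF H.module H.module Q bilinear_precomp[OF \<phi> p_lin p_lin] H.comult_closed[OF x] eq])
  have coalg: "coalgebra K Q"
  proof (rule coalgebra.intro[OF H.field Q \<Delta>_lin])
    show "\<epsilon>\<^bsub>Q\<^esub> \<in> hom (add_monoid Q) (add_monoid K)"
      by (auto simp: hom_def \<epsilon>_closed \<epsilon>_add)
  next
    fix x assume "x \<in> carrier Q"
    then obtain x' where x': "x' \<in> carrier H" "x = p x'" using sur by blast
    show "tensor_lift K (tensor_product K Q (tensor_product K Q Q)) (\<lambda>y z.
        tensor_lift K (tensor_product K Q (tensor_product K Q Q)) (\<lambda>u v.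
          pure_tensor K Q (tensor_product K Q Q) u (pure_tensor K Q Q v z)) (\<Delta>\<^bsub>Q\<^esub> y)) (\<Delta>\<^bsub>Q\<^esub> x)
      = tensor_lift K (tensor_product K Q (tensor_product K Q Q)) (\<lambda>y z.
          pure_tensor K Q (tensor_product K Q Q) y (\<Delta>\<^bsub>Q\<^esub> z)) (\<Delta>\<^bsub>Q\<^esub> x)"
      unfolding x'(2) by (rule M.coassoc_image[OF x'(1)])
    have \<epsilon>_H: "bilinear K H H H (\<lambda>y z. \<epsilon>\<^bsub>H\<^esub> y \<odot>\<^bsub>H\<^esub> z)"
      by (rule H.counit_smult_bilinear[OF H.module module_hom_id])
    show "tensor_lift K Q (\<lambda>y z. \<epsilon>\<^bsub>Q\<^esub> y \<odot>\<^bsub>Q\<^esub> z) (\<Delta>\<^bsub>Q\<^esub> x) = x"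
      unfolding x'(2)
      by (subst transfer[OF x'(1) \<epsilon>_bil \<epsilon>_H]) (simp_all add: hom H.counit_closed H.counit_left x')
    show "tensor_lift K Q (\<lambda>y z. \<epsilon>\<^bsub>Q\<^esub> z \<odot>\<^bsub>Q\<^esub> y) (\<Delta>\<^bsub>Q\<^esub> x) = x"
      unfolding x'(2)
      by (subst transfer[OF x'(1) bilinear_swap[OF \<epsilon>_bil] bilinear_swap[OF \<epsilon>_H]])
        (simp_all add: hom H.counit_closed H.counit_right x')
  qed (rule \<epsilon>_smult)
  note pure_hom = bilinear_simps[OF pure_tensor_bilinear[OF Q Q]] pure_tensor_closed[OF Q Q]
  \<comment> \<open>\<open>Q\<close> is not yet a Hopf algebra, so the bilinearity of its
    \<open>tensor_mult\<close> is established here directly. Then both sides are bilinear in s and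
    t, and pure tensors decide.\<close>
  have mult_map: "tensor_map K Q Q p p (tensor_mult K H s t)
      = tensor_mult K Q (tensor_map K Q Q p p s) (tensor_map K Q Q p p t)"
    if s: "s \<in> carrier H.HH" and t: "t \<in> carrier H.HH" for s t
  proof -
    let ?P = "tensor_map K Q Q p p" and ?QQ = "tensor_product K Q Q"
    let ?\<phi> = "\<lambda>a b c d. pure_tensor K Q Q (a \<otimes>\<^bsub>Q\<^esub> c) (b \<otimes>\<^bsub>Q\<^esub> d)"
    have tri1: "trilinear K Q Q Q ?QQ (\<lambda>b c d. ?\<phi> a b c d)" if "a \<in> carrier Q" for a
      by (intro trilinearI module_homI)
        (use that in \<open>simp_all add: pure_hom Qr.l_distr Qr.r_distr mult_left mult_right\<close>)
    have tri2: "trilinear K Q Q Q ?QQ (\<lambda>a c d. ?\<phi> a b c d)" if "b \<in> carrier Q" for b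
      by (intro trilinearI module_homI)
        (use that in \<open>simp_all add: pure_hom Qr.l_distr Qr.r_distr mult_left mult_right\<close>)
    \<comment> \<open>\<open>tri1\<close> fixes \<open>a\<close> and gives linearity in
      \<open>b\<close>; \<open>tri2\<close> fixes \<open>b\<close> and gives linearity in
      \<open>a\<close>.\<close>
    have outer: "bilinear K Q Q ?QQ (\<lambda>a b. tensor_lift K ?QQ (?\<phi> a b) t)"
      if "t \<in> carrier ?QQ" for t
      using bilinear_left[OF tensor_lift_trilinear_right[OF Q Q Q QQ tri1] that]
        bilinear_left[OF tensor_lift_trilinear_right[OF Q Q Q QQ tri2] that]
      by (auto intro!: bilinearI)
    have lin1: "(\<lambda>t. tensor_mult K Q s t) \<in> module_hom K ?QQ ?QQ" if "s \<in> carrier ?QQ" for s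
      unfolding tensor_mult_def
      by (rule tensor_lift_param_hom[OF Q Q QQ QQ that outer])
        (use tensor_lift_hom[OF Q Q QQ trilinearD(2)[OF tri1]] in auto)
    have lin2: "(\<lambda>s. tensor_mult K Q s t) \<in> module_hom K ?QQ ?QQ" if "t \<in> carrier ?QQ" for t
      unfolding tensor_mult_def by (rule tensor_lift_hom[OF Q Q QQ outer[OF that]])
    have bil: "bilinear K ?QQ ?QQ ?QQ (tensor_mult K Q)"
      using lin1 lin2 by (rule bilinearI)
    note P = module_hom_closed[OF t_hom] module_hom_add[OF t_hom] tensor_map_pure[OF H.module H.module Q Q p_lin p_lin]
    have pure: "?P (tensor_mult K H (pure_tensor K H H a b) (pure_tensor K H H c d))
        = tensor_mult K Q (?P (pure_tensor K H H a b)) (?P (pure_tensor K H H c d))"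
      if "a \<in> carrier H" "b \<in> carrier H" "c \<in> carrier H" "d \<in> carrier H" for a b c d
      using that
      by (simp add: P H.tensor_mult_pure ring_hom_mult[OF p_ring] tensor_mult_def[of K Q]
          tensor_lift_pure[OF Q Q QQ outer] pure_hom hom(1)
          tensor_lift_pure[OF Q Q QQ trilinearD(2)[OF tri1, of "p a" "p b"]])
    show ?thesis
      using H.module H.module s
    proof (induction s rule: tensor_induct)
      case p: (pure a b)
      show ?case
        using H.module H.module t
        by (induction t rule: tensor_induct)
          (use p in \<open>simp_all add: pure P pure_hom hom(1) bilinear_simps[OF bil] H.tensor_mult_simps H.tensor_mult_closed H.pure_closed\<close>)
    qed (use t in \<open>auto simp: P bilinear_simps[OF bil] H.tensor_mult_simps H.tensor_mult_closed\<close>)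
  qed
  have hopf_axioms: "hopf_algebra_axioms K Q"
  proof (rule hopf_algebra_axioms.intro)
    fix x y assume "x \<in> carrier Q" "y \<in> carrier Q"
    then obtain x' y' where xy: "x' \<in> carrier H" "x = p x'" "y' \<in> carrier H" "y = p y'" using sur by meson
    then show "\<Delta>\<^bsub>Q\<^esub> (x \<otimes>\<^bsub>Q\<^esub> y) = tensor_mult K Q (\<Delta>\<^bsub>Q\<^esub> x) (\<Delta>\<^bsub>Q\<^esub> y)"
      by (simp add: hom \<Delta> H.comult_mult mult_map H.comult_closed)
    show "\<epsilon>\<^bsub>Q\<^esub> (x \<otimes>\<^bsub>Q\<^esub> y) = \<epsilon>\<^bsub>Q\<^esub> x \<otimes>\<^bsub>K\<^esub> \<epsilon>\<^bsub>Q\<^esub> y"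
      using xy by (simp add: hom H.counit_mult)
  next
    show "\<Delta>\<^bsub>Q\<^esub> \<one>\<^bsub>Q\<^esub> = pure_tensor K Q Q \<one>\<^bsub>Q\<^esub> \<one>\<^bsub>Q\<^esub>"
      by (simp add: hom \<Delta> H.comult_one tensor_map_pure[OF H.module H.module Q Q p_lin p_lin])
    show "\<epsilon>\<^bsub>Q\<^esub> \<one>\<^bsub>Q\<^esub> = \<one>\<^bsub>K\<^esub>"
      by (simp add: hom H.counit_one)
  next
    fix x assume "x \<in> carrier Q"
    then obtain x' where x': "x' \<in> carrier H" "x = p x'" using sur by blast
    show "tensor_lift K Q (\<lambda>y z. antipode Q y \<otimes>\<^bsub>Q\<^esub> z) (\<Delta>\<^bsub>Q\<^esub> x) = \<epsilon>\<^bsub>Q\<^esub> x \<odot>\<^bsub>Q\<^esub> \<one>\<^bsub>Q\<^esub>"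
      unfolding x'(2)
      by (subst transfer[OF x'(1) bilinear_precomp[OF m S_lin module_hom_id]
            bilinear_precomp[OF H.mult_bilinear H.antipode_linear module_hom_id]])
        (simp_all add: hom H.antipode_closed H.antipode_left H.counit_closed x')
    show "tensor_lift K Q (\<lambda>y z. y \<otimes>\<^bsub>Q\<^esub> antipode Q z) (\<Delta>\<^bsub>Q\<^esub> x) = \<epsilon>\<^bsub>Q\<^esub> x \<odot>\<^bsub>Q\<^esub> \<one>\<^bsub>Q\<^esub>"
      unfolding x'(2)
      by (subst transfer[OF x'(1) bilinear_precomp[OF m module_hom_id S_lin]
            bilinear_precomp[OF H.mult_bilinear module_hom_id H.antipode_linear]])
        (simp_all add: hom H.antipode_closed H.antipode_right H.counit_closed x')
  qed (simp_all add: ring mult_left mult_right S_lin)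
  show ?thesis
    by (rule hopf_algebra.intro[OF coalg hopf_axioms])
qed

lemma hopf_algebra_coalgebra_map:
  assumes "hopf_algebra K H" "hopf_algebra K Q" "p \<in> hopf_algebra_hom K H Q"
  shows "coalgebra_map K H Q p"
proof -
  interpret H: hopf_algebra K H by fact
  interpret Q: hopf_algebra K Q by fact
  show ?thesis
    by unfold_locales (use hopf_algebra_homD[OF assms(3)] Q.module Q.comult_linear in auto)
qed

text \<open>Every element of \<open>Q\<close> has the form p x, and u (p x) = h x, so each
  compatibility of u is read off from those of p and h. For the comultiplication the point is that h
  \<otimes> h equals u \<otimes> u after p \<otimes> p.\<close>

lemma hopf_algebra_hom_factor:
  assumes H: "hopf_algebra K H" and Q: "hopf_algebra K Q" and C: "hopf_algebra K C"
    and p: "p \<in> hopf_algebra_hom K H Q" and surj: "p ` carrier H = carrier Q"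
    and h: "h \<in> hopf_algebra_hom K H C" and up: "\<And>x. x \<in> carrier H \<Longrightarrow> u (p x) = h x"
  shows "u \<in> hopf_algebra_hom K Q C"
proof -
  interpret H: hopf_algebra K H by fact
  interpret Q: hopf_algebra K Q by fact
  interpret C: hopf_algebra K C by fact
  interpret M: coalgebra_map K H Q p
    by (rule hopf_algebra_coalgebra_map) fact+
  note p' = hopf_algebra_homD[OF p] and h' = hopf_algebra_homD[OF h]
  note hom = module_hom_closed[OF p'(1)] module_hom_add[OF p'(1), symmetric]
    module_hom_smult[OF p'(1), symmetric]
    ring_hom_mult[OF p'(2), symmetric] ring_hom_one[OF p'(2), symmetric]
    p'(4) p'(5)[symmetric] up
    module_hom_closed[OF h'(1)] module_hom_add[OF h'(1)] module_hom_smult[OF h'(1)]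
    ring_hom_mult[OF h'(2)] ring_hom_one[OF h'(2)] h'(4,5)
  have sur: "\<exists>x\<in>carrier H. y = p x" if "y \<in> carrier Q" for y
    using that surj by auto
  have u: "u \<in> module_hom K Q C"
    by (rule module_homI) (auto dest!: sur simp: hom)
  have u_ring: "u \<in> ring_hom Q C"
    by (rule ring_hom_memI) (auto dest!: sur simp: hom)
  have \<Delta>: "\<Delta>\<^bsub>C\<^esub> (u y) = tensor_map K C C u u (\<Delta>\<^bsub>Q\<^esub> y)" if y: "y \<in> carrier Q" for y
  proof -
    obtain x where x: "x \<in> carrier H" "y = p x" using sur[OF y] by blast
    have CC: "module K (tensor_product K C C)"
      by (rule C.HH_module)
    note b = tensor_map_bilinear[OF Q.module Q.module C.module C.module u u]
    have "tensor_map K C C u u (\<Delta>\<^bsub>Q\<^esub> y)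
        = tensor_lift K (tensor_product K C C) (\<lambda>a b. pure_tensor K C C (u (p a)) (u (p b))) (\<Delta>\<^bsub>H\<^esub> x)"
      unfolding tensor_map_def x(2) by (rule M.lift_map_comult[OF CC b x(1)])
    also have "\<dots> = tensor_map K C C h h (\<Delta>\<^bsub>H\<^esub> x)"
      unfolding tensor_map_def
      by (rule tensor_lift_cong[OF H.module H.module CC bilinear_precomp[OF b p'(1) p'(1)] H.comult_closed[OF x(1)]])
        (simp add: up)
    finally show ?thesis
      using x up h'(3) by simp
  qed
  show ?thesis
    using u u_ring \<Delta> by (auto simp: hopf_algebra_hom_def dest!: sur simp: hom H.antipode_closed)
qed

text \<open>The flip of the two tensor factors commutes with p \<otimes> p.\<close>

lemma cocommutative_surj_image:
  assumes H: "hopf_algebra K H" and Q: "hopf_algebra K Q"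
    and p: "p \<in> hopf_algebra_hom K H Q" and surj: "p ` carrier H = carrier Q"
    and coc: "cocommutative K H"
  shows "cocommutative K Q"
  unfolding cocommutative_def
proof
  interpret H: hopf_algebra K H by fact
  interpret Q: hopf_algebra K Q by fact
  interpret M: coalgebra_map K H Q p
    by (rule hopf_algebra_coalgebra_map) fact+
  note p' = hopf_algebra_homD[OF p]
  note b = bilinear_swap[OF Q.pure_bilinear] and t = tensor_map_hom[OF H.module H.module Q.module Q.module p'(1) p'(1)]
  fix y assume "y \<in> carrier Q"
  then obtain x where x: "x \<in> carrier H" "y = p x" using surj by auto
  have "tensor_lift K Q.HH (\<lambda>y z. pure_tensor K Q Q z y) (\<Delta>\<^bsub>Q\<^esub> y)
      = tensor_lift K Q.HH (\<lambda>a b. pure_tensor K Q Q (p b) (p a)) (\<Delta>\<^bsub>H\<^esub> x)"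
    unfolding x(2) by (rule M.lift_map_comult[OF Q.HH_module b x(1)])
  also have "\<dots> = tensor_lift K Q.HH (\<lambda>a b. tensor_map K Q Q p p (pure_tensor K H H b a)) (\<Delta>\<^bsub>H\<^esub> x)"
    by (rule tensor_lift_cong[OF H.module H.module Q.HH_module bilinear_precomp[OF b p'(1) p'(1)] H.comult_closed[OF x(1)]])
      (simp add: tensor_map_pure[OF H.module H.module Q.module Q.module p'(1) p'(1)])
  also have "\<dots> = tensor_map K Q Q p p (tensor_lift K H.HH (\<lambda>a b. pure_tensor K H H b a) (\<Delta>\<^bsub>H\<^esub> x))"
    by (rule hom_tensor_lift[OF H.module H.module H.HH_module Q.HH_module bilinear_swap[OF H.pure_bilinear] t
          H.comult_closed[OF x(1)], symmetric])
  also have "\<dots> = \<Delta>\<^bsub>Q\<^esub> y"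
    using coc x p'(3) by (simp add: cocommutative_def)
  finally show "tensor_lift K Q.HH (\<lambda>y z. pure_tensor K Q Q z y) (\<Delta>\<^bsub>Q\<^esub> y) = \<Delta>\<^bsub>Q\<^esub> y" .
qed

subsection \<open>Hopf braces\<close>

lemma diamond_simps [simp]:
  "carrier (diamond H) = carrier H" "mult (diamond H) = dia_mult H" "one (diamond H) = dia_one H"
  "zero (diamond H) = zero H" "add (diamond H) = add H" "smult (diamond H) = smult H"
  "comult (diamond H) = comult H" "counit (diamond H) = counit H" "antipode (diamond H) = dia_antipode H"
  by (simp_all add: diamond_def)

text \<open>\<open>diamond H\<close> is a record of another type than \<open>H\<close>, although the
  two share their linear and coalgebra data. This and the next rules identify the constructions that
  read only such data, so that lemmas instantiated at \<open>diamond H\<close> speak about the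
  spaces of \<open>H\<close>.\<close>

lemma module_hom_diamond [simp]:
  "module_hom K (diamond H) V = module_hom K H V" "module_hom K V (diamond H) = module_hom K V H"
  by (auto simp: module_hom_def hom_def)

lemma bilinear_diamond [simp]:
  "bilinear K (diamond H) (diamond H) (diamond H) \<phi> = bilinear K H H H \<phi>"
  by (simp add: bilinear_def)

lemma tensor_null_diamond [simp]: "tensor_null K (diamond H) (diamond H) = tensor_null K H H"
  by (simp add: tensor_null_def bilinear_relations_def)

lemma tensor_product_diamond [simp]: "tensor_product K (diamond H) (diamond H) = tensor_product K H H"
  by (simp add: tensor_product_def)

lemma pure_tensor_diamond [simp]: "pure_tensor K (diamond H) (diamond H) = pure_tensor K H H"
  by (intro ext) (simp add: pure_tensor_def)

lemma tensor_map_diamond [simp]: "tensor_map K (diamond H) (diamond H) = tensor_map K H H"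
  by (intro ext) (simp add: tensor_map_def)

lemma submodule_diamond [simp]: "submodule N K (diamond H) = submodule N K H"
  by (simp add: submodule_def submodule_axioms_def subgroup_def m_inv_def)

lemma a_r_coset_diamond [simp]: "a_r_coset (diamond H) = a_r_coset H"
  by (intro ext) (simp add: a_r_coset_def r_coset_def)

lemma hopf_brace_surj_image:
  assumes H: "hopf_brace K H" and p: "p \<in> hopf_brace_hom K H Q"
    and surj: "p ` carrier H = carrier Q" and zero: "p \<zero>\<^bsub>H\<^esub> = \<zero>\<^bsub>Q\<^esub>"
  shows "hopf_brace K Q"
proof -
  interpret H: hopf_brace K H by fact
  have p1: "p \<in> hopf_algebra_hom K H Q" and p2: "p \<in> hopf_algebra_hom K (diamond H) (diamond Q)"
    using p by (auto simp: hopf_brace_hom_def)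
  have Q1: "hopf_algebra K Q"
    by (rule hopf_algebra_surj_image[OF H.hopf_algebra_axioms p1 surj zero])
  have Q2: "hopf_algebra K (diamond Q)"
    by (rule hopf_algebra_surj_image[OF H.diamond.hopf_algebra_axioms p2]) (simp_all add: surj zero)
  interpret Q: hopf_algebra K Q by (rule Q1)
  interpret Qd: hopf_algebra K "diamond Q" by (rule Q2)
  interpret M: coalgebra_map K H Q p
    by (rule hopf_algebra_coalgebra_map[OF H.hopf_algebra_axioms Q1 p1])
  note p_lin = hopf_algebra_homD(1)[OF p1]
  note p_ops = ring_hom_mult[OF hopf_algebra_homD(2)[OF p1]] hopf_algebra_homD(5)[OF p1]
    ring_hom_mult[OF hopf_algebra_homD(2)[OF p2], simplified]
  note dia_closed = H.diamond.H.m_closed[simplified]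
  \<comment> \<open>Stated for a general \<open>G\<close> because it is used for both
    \<open>H\<close> and \<open>Q\<close>. At this point \<open>Q\<close> carries two Hopf algebra
    structures but is not yet a Hopf brace.\<close>
  have T: "trilinear K G G G G (\<lambda>a b c. (a \<diamondop>\<^bsub>G\<^esub> y) \<otimes>\<^bsub>G\<^esub> antipode G b \<otimes>\<^bsub>G\<^esub> (c \<diamondop>\<^bsub>G\<^esub> z))"
    if G1: "hopf_algebra K G" and G2: "hopf_algebra K (diamond G)" and y: "y \<in> carrier G" and z: "z \<in> carrier G"
    for G :: "('a, 'g) hopf_brace" and y z
  proof -
    interpret G: hopf_algebra K G by (rule G1)
    interpret D: hopf_algebra K "diamond G" by (rule G2)
    note dia = bilinear_left[OF D.mult_bilinear[simplified]]
    note l = G.H.l_distr G.H.r_distr G.smult_mult_left G.smult_mult_right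
      module_hom_closed[OF dia] module_hom_add[OF dia] module_hom_smult[OF dia] G.antipode_closed
      module_hom_add[OF G.antipode_linear] module_hom_smult[OF G.antipode_linear]
    show ?thesis
      by (intro trilinearI module_homI) (use y z in \<open>simp_all add: l\<close>)
  qed
  have "x \<diamondop>\<^bsub>Q\<^esub> (y \<otimes>\<^bsub>Q\<^esub> z) =
        tensor_lift K Q (\<lambda>x\<^sub>1 x'.
          tensor_lift K Q (\<lambda>x\<^sub>2 x\<^sub>3.
            (x\<^sub>1 \<diamondop>\<^bsub>Q\<^esub> y) \<otimes>\<^bsub>Q\<^esub> antipode Q x\<^sub>2 \<otimes>\<^bsub>Q\<^esub> (x\<^sub>3 \<diamondop>\<^bsub>Q\<^esub> z)) (\<Delta>\<^bsub>Q\<^esub> x')) (\<Delta>\<^bsub>Q\<^esub> x)"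
    if Qs: "x \<in> carrier Q" "y \<in> carrier Q" "z \<in> carrier Q" for x y z
  proof -
    obtain a b c where abc: "a \<in> carrier H" "b \<in> carrier H" "c \<in> carrier H" "x = p a" "y = p b" "z = p c"
      using Qs unfolding surj[symmetric] by blast
    let ?T = "\<lambda>x y z. (x \<diamondop>\<^bsub>H\<^esub> b) \<otimes>\<^bsub>H\<^esub> antipode H y \<otimes>\<^bsub>H\<^esub> (z \<diamondop>\<^bsub>H\<^esub> c)"
    let ?R = "\<lambda>u v w. (u \<diamondop>\<^bsub>Q\<^esub> y) \<otimes>\<^bsub>Q\<^esub> antipode Q v \<otimes>\<^bsub>Q\<^esub> (w \<diamondop>\<^bsub>Q\<^esub> z)"
    note TH = T[OF H.hopf_algebra_axioms H.diamond.hopf_algebra_axioms abc(2,3)]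
    note TQ = T[OF Q1 Q2 Qs(2,3)]
    note Tb = H.bilinear_comult_right[OF H.module H.module TH]
    \<comment> \<open>p respects both products and the antipode, so it carries the summand of the
      brace identity in \<open>H\<close> to the one in \<open>Q\<close>.\<close>
    have R: "?R (p u) (p v) (p w) = p (?T u v w)" if "u \<in> carrier H" "v \<in> carrier H" "w \<in> carrier H" for u v w
      using that abc by (simp add: p_ops dia_closed H.antipode_closed)
    have inner: "tensor_lift K Q (\<lambda>v w. ?R (p u) (p v) (p w)) (\<Delta>\<^bsub>H\<^esub> t) = p (tensor_lift K H (?T u) (\<Delta>\<^bsub>H\<^esub> t))"
      if u: "u \<in> carrier H" and t: "t \<in> carrier H" for u t
      unfolding hom_tensor_lift[OF H.module H.module H.module Q.module trilinearD(2)[OF TH u] p_lin H.comult_closed[OF t]]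
      by (rule tensor_lift_cong[OF H.module H.module Q.module trilinearD(2)[OF M.trilinear_map[OF TQ] u]
            H.comult_closed[OF t] R[OF u]])
    have "x \<diamondop>\<^bsub>Q\<^esub> (y \<otimes>\<^bsub>Q\<^esub> z) = p (a \<diamondop>\<^bsub>H\<^esub> (b \<otimes>\<^bsub>H\<^esub> c))"
      using abc by (simp add: p_ops)
    also have "\<dots> = p (tensor_lift K H (\<lambda>u t. tensor_lift K H (?T u) (\<Delta>\<^bsub>H\<^esub> t)) (\<Delta>\<^bsub>H\<^esub> a))"
      using H.brace[OF abc(1,2,3)] by simp
    also have "\<dots> = tensor_lift K Q (\<lambda>u t. p (tensor_lift K H (?T u) (\<Delta>\<^bsub>H\<^esub> t))) (\<Delta>\<^bsub>H\<^esub> a)"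
      by (rule hom_tensor_lift[OF H.module H.module H.module Q.module Tb p_lin H.comult_closed[OF abc(1)]])
    also have "\<dots> = tensor_lift K Q (\<lambda>u t. tensor_lift K Q (\<lambda>v w. ?R (p u) (p v) (p w)) (\<Delta>\<^bsub>H\<^esub> t)) (\<Delta>\<^bsub>H\<^esub> a)"
      by (rule tensor_lift_cong[OF H.module H.module Q.module bilinear_postcomp[OF Tb p_lin]
            H.comult_closed[OF abc(1)] inner[symmetric]])
    also have "\<dots> = tensor_lift K Q (\<lambda>u t. tensor_lift K Q (?R u) (\<Delta>\<^bsub>Q\<^esub> t)) (\<Delta>\<^bsub>Q\<^esub> x)"
      unfolding abc(4) by (rule M.lift_map_comult_right[OF Q.module TQ abc(1), symmetric])
    finally show ?thesis .
  qed
  then show ?thesis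
    by (intro hopf_brace.intro hopf_brace_axioms.intro Q1 Q2)
qed

lemma hopf_brace_hom_factor:
  assumes "hopf_brace K H" "hopf_brace K Q" "hopf_brace K C"
    and "p \<in> hopf_brace_hom K H Q" "p ` carrier H = carrier Q"
    and "h \<in> hopf_brace_hom K H C" "\<And>x. x \<in> carrier H \<Longrightarrow> u (p x) = h x"
  shows "u \<in> hopf_brace_hom K Q C"
  using assms hopf_algebra_hom_factor[of K H Q C p h u]
    hopf_algebra_hom_factor[of K "diamond H" "diamond Q" "diamond C" p h u]
  by (auto simp: hopf_brace_hom_def hopf_brace_def)

subsection \<open>The quotient by a Hopf brace ideal\<close>

lemma hopf_brace_idealD:
  assumes "hopf_brace_ideal K H I"
  shows "submodule I K H" "ideal I H" "ideal I (diamond H)" "coideal K H I"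
    "x \<in> I \<Longrightarrow> antipode H x \<in> I" "x \<in> I \<Longrightarrow> dia_antipode H x \<in> I" "x \<in> I \<Longrightarrow> \<epsilon>\<^bsub>H\<^esub> x = \<zero>\<^bsub>K\<^esub>"
  using assms by (auto simp: hopf_brace_ideal_def hopf_ideal_def coideal_def)

text \<open>p \<otimes> p kills the generators of both spans because 0 \<otimes> v = v \<otimes> 0 =
  0. With p the projection, this makes the comultiplication of the quotient well defined.\<close>

lemma (in coalgebra) coideal_tensor_map_zero:
  assumes I: "coideal K H I" and x: "x \<in> I" and V: "module K V" and p: "p \<in> module_hom K H V"
    and zero: "\<And>i. i \<in> I \<Longrightarrow> p i = \<zero>\<^bsub>V\<^esub>"
  shows "tensor_map K V V p p (\<Delta>\<^bsub>H\<^esub> x) = \<zero>\<^bsub>tensor_product K V V\<^esub>"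
proof -
  interpret V: module K V by (rule V)
  let ?VV = "tensor_product K V V" and ?P = "tensor_map K V V p p"
  have VV: "module K ?VV"
    by (rule tensor_product_module[OF V V])
  interpret VV: module K ?VV by (rule VV)
  note P = tensor_map_hom[OF module module V V p p]
  note b = pure_tensor_bilinear[OF V V]
  let ?N = "{t \<in> carrier HH. ?P t \<in> {\<zero>\<^bsub>?VV\<^esub>}}"
  have N: "submodule ?N K HH"
    by (rule submodule_vimage[OF HH_module VV P submodule_zero_singleton[OF VV]])
  have IH: "i \<in> carrier H" if "i \<in> I" for i
    using I that submoduleE(1) by (auto simp: coideal_def)
  have z: "pure_tensor K V V \<zero>\<^bsub>V\<^esub> v = \<zero>\<^bsub>?VV\<^esub>" "pure_tensor K V V v \<zero>\<^bsub>V\<^esub> = \<zero>\<^bsub>?VV\<^esub>"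
    if "v \<in> carrier V" for v
    using module_hom_zero[OF V VV bilinear_left[OF b that]] module_hom_zero[OF V VV bilinear_right[OF b that]] .
  have "module_span K HH {pure_tensor K H H i x | i x. i \<in> I \<and> x \<in> carrier H} \<subseteq> ?N"
    by (rule module_span_least[OF N])
      (auto simp: IH pure_tensor_closed[OF module module] tensor_map_pure[OF module module V V p p] zero z
        module_hom_closed[OF p])
  moreover have "module_span K HH {pure_tensor K H H x i | i x. i \<in> I \<and> x \<in> carrier H} \<subseteq> ?N"
    by (rule module_span_least[OF N])
      (auto simp: IH pure_tensor_closed[OF module module] tensor_map_pure[OF module module V V p p] zero z
        module_hom_closed[OF p])
  moreover obtain s t where st: "\<Delta>\<^bsub>H\<^esub> x = s \<oplus>\<^bsub>HH\<^esub> t"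
      "s \<in> module_span K HH {pure_tensor K H H i x | i x. i \<in> I \<and> x \<in> carrier H}"
      "t \<in> module_span K HH {pure_tensor K H H x i | i x. i \<in> I \<and> x \<in> carrier H}"
    using I x by (auto simp: coideal_def Let_def set_add_def')
  ultimately have "s \<in> ?N" "t \<in> ?N"
    by blast+
  then show ?thesis
    unfolding st(1) by (simp add: module_hom_add[OF P])
qed

context
  fixes K :: "('k, 'r) ring_scheme" and H :: "('k, 'h) hopf_brace" and I :: "'h set"
  assumes brace: "hopf_brace K H" and ideal: "hopf_brace_ideal K H I"
begin

interpretation H: hopf_brace K H by (rule brace)
interpretation Q: module_quotient K H I
  by (intro module_quotient.intro module_quotient_axioms.intro H.module hopf_brace_idealD(1)[OF ideal])
interpretation I: ideal I H by (rule hopf_brace_idealD(2)[OF ideal])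
interpretation Id: ideal I "diamond H" by (rule hopf_brace_idealD(3)[OF ideal])

text \<open>The comultiplication of the quotient is built in the tensor square of
  \<open>quotient_module H I\<close>, while the axioms refer to the tensor square of the brace
  record itself. The two agree, since only the carrier and the linear operations enter.\<close>

lemma quotient_hopf_brace_ops:
  defines "Q \<equiv> quotient_hopf_brace K H I" and "V \<equiv> quotient_module H I"
  shows "carrier Q = carrier V" "add Q = add V" "zero Q = zero V" "smult Q = smult V"
    "module_hom K W Q = module_hom K W V" "tensor_map K Q Q = tensor_map K V V"
    "tensor_product K Q Q = tensor_product K V V"
proof -
  show *: "carrier Q = carrier V" "add Q = add V" "zero Q = zero V" "smult Q = smult V"
    by (simp_all add: Q_def V_def quotient_hopf_brace_def Let_def)
  show "module_hom K W Q = module_hom K W V"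
    by (simp add: module_hom_def hom_def *)
  have n: "tensor_null K Q Q = tensor_null K V V"
    by (simp add: tensor_null_def bilinear_relations_def *)
  show t: "tensor_product K Q Q = tensor_product K V V"
    by (simp add: tensor_product_def n *)
  have "pure_tensor K Q Q = pure_tensor K V V"
    by (intro ext) (simp add: pure_tensor_def n *)
  then show "tensor_map K Q Q = tensor_map K V V"
    by (intro ext) (simp add: tensor_map_def t)
qed

lemma coset_zero: "x \<in> I \<Longrightarrow> I +>\<^bsub>H\<^esub> x = \<zero>\<^bsub>quotient_module H I\<^esub>"
  using Q.coset_eq_iff[of x "\<zero>\<^bsub>H\<^esub>"] Q.N.a_subset by (simp add: Q.quotient_zero a_minus_def)

lemma quotient_comult:
  assumes "x \<in> carrier H"
  shows "\<Delta>\<^bsub>quotient_hopf_brace K H I\<^esub> (I +>\<^bsub>H\<^esub> x)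
    = tensor_map K (quotient_module H I) (quotient_module H I) (\<lambda>x. I +>\<^bsub>H\<^esub> x) (\<lambda>x. I +>\<^bsub>H\<^esub> x) (\<Delta>\<^bsub>H\<^esub> x)"
proof -
  note V = Q.quotient_is_module and p = Q.projection_hom
  note VV = tensor_product_module[OF V V]
  note t = module_hom_comp[OF H.comult_linear tensor_map_hom[OF H.module H.module V V p p]]
  show ?thesis
    unfolding quotient_hopf_brace_def Let_def
    using Q.image_coset_hom[OF VV t H.coideal_tensor_map_zero[OF hopf_brace_idealD(4)[OF ideal] _ V p coset_zero] assms]
    by simp
qed

lemma quotient_counit:
  assumes "x \<in> carrier H"
  shows "\<epsilon>\<^bsub>quotient_hopf_brace K H I\<^esub> (I +>\<^bsub>H\<^esub> x) = \<epsilon>\<^bsub>H\<^esub> x"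
proof -
  have "the_elem (\<epsilon>\<^bsub>H\<^esub> ` (I +>\<^bsub>H\<^esub> x)) = \<epsilon>\<^bsub>H\<^esub> x"
  \<comment> \<open>\<open>image_coset_hom\<close> requires a module as target and the counit takes
    values in the ring \<open>K\<close>, so the argument by differences is repeated.\<close>
  proof (rule Q.image_coset[OF assms])
    fix y assume y: "y \<in> carrier H" "I +>\<^bsub>H\<^esub> y = I +>\<^bsub>H\<^esub> x"
    then have "\<epsilon>\<^bsub>H\<^esub> (y \<ominus>\<^bsub>H\<^esub> x) = \<zero>\<^bsub>K\<^esub>"
      using Q.coset_eq_iff assms hopf_brace_idealD(7)[OF ideal] by blast
    then show "\<epsilon>\<^bsub>H\<^esub> y = \<epsilon>\<^bsub>H\<^esub> x"
      using y assms H.R.minus_eq_zero_iff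
      by (simp add: a_minus_def H.counit_add H.counit_a_inv H.counit_closed)
  qed
  then show ?thesis
    by (simp add: quotient_hopf_brace_def Let_def)
qed

lemma quotient_antipodes:
  assumes "x \<in> carrier H"
  shows "antipode (quotient_hopf_brace K H I) (I +>\<^bsub>H\<^esub> x) = I +>\<^bsub>H\<^esub> antipode H x"
    and "dia_antipode (quotient_hopf_brace K H I) (I +>\<^bsub>H\<^esub> x) = I +>\<^bsub>H\<^esub> dia_antipode H x"
  using Q.image_coset_hom[OF Q.quotient_is_module module_hom_comp[OF H.antipode_linear Q.projection_hom] _ assms]
    Q.image_coset_hom[OF Q.quotient_is_module
      module_hom_comp[OF H.diamond.antipode_linear[simplified] Q.projection_hom] _ assms]
    hopf_brace_idealD(5,6)[OF ideal]
  by (simp_all add: quotient_hopf_brace_def Let_def coset_zero)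

lemma quotient_projection_surj:
  "(\<lambda>x. I +>\<^bsub>H\<^esub> x) ` carrier H = carrier (quotient_hopf_brace K H I)"
  by (simp add: quotient_hopf_brace_ops Q.quotient_carrier)

lemma quotient_projection_hom:
  "(\<lambda>x. I +>\<^bsub>H\<^esub> x) \<in> hopf_brace_hom K H (quotient_hopf_brace K H I)"
proof -
  let ?Q = "quotient_hopf_brace K H I" and ?p = "\<lambda>x. I +>\<^bsub>H\<^esub> x"
  have p: "?p \<in> module_hom K H ?Q"
    using Q.projection_hom by (simp add: quotient_hopf_brace_ops)
  have "?p \<in> ring_hom H ?Q"
    by (rule ring_hom_memI)
      (auto simp: quotient_hopf_brace_ops Q.quotient_carrier Q.quotient_add,
       simp_all add: quotient_hopf_brace_def Let_def I.rcoset_mult_add)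
  moreover have "?p \<in> ring_hom (diamond H) (diamond ?Q)"
    by (rule ring_hom_memI)
      (auto simp: quotient_hopf_brace_ops Q.quotient_carrier Q.quotient_add,
       use Id.rcoset_mult_add in \<open>simp_all add: quotient_hopf_brace_def Let_def\<close>)
  ultimately show ?thesis
    using p by (auto simp: hopf_brace_hom_def hopf_algebra_hom_def quotient_comult quotient_counit
        quotient_antipodes quotient_hopf_brace_ops)
qed

lemma quotient_is_hopf_brace: "hopf_brace K (quotient_hopf_brace K H I)"
  by (rule hopf_brace_surj_image[OF brace quotient_projection_hom quotient_projection_surj])
    (simp add: quotient_hopf_brace_ops Q.quotient_zero)

lemma quotient_universal_property:
  assumes C: "hopf_brace K C" and h: "h \<in> hopf_brace_hom K H C"
    and zero: "\<And>x. x \<in> I \<Longrightarrow> h x = \<zero>\<^bsub>C\<^esub>"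
  shows "\<exists>!u. u \<in> hopf_brace_hom K (quotient_hopf_brace K H I) C
    \<and> u \<in> extensional (carrier (quotient_hopf_brace K H I))
    \<and> (\<forall>b\<in>carrier H. u (I +>\<^bsub>H\<^esub> b) = h b)"
proof (rule ex1I)
  let ?Q = "quotient_hopf_brace K H I"
  interpret C: hopf_brace K C by (rule C)
  have h': "h \<in> module_hom K H C"
    using h by (auto simp: hopf_brace_hom_def hopf_algebra_hom_def)
  \<comment> \<open>h is constant on cosets because it kills \<open>I\<close>. The restriction makes
    u extensional, which selects one function among all that represent the same morphism.\<close>
  define u where "u = restrict (\<lambda>X. the_elem (h ` X)) (carrier ?Q)"
  have u: "u (I +>\<^bsub>H\<^esub> b) = h b" if "b \<in> carrier H" for b
    using Q.image_coset_hom[OF C.module h' zero that] that quotient_projection_surj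
    by (auto simp: u_def)
  have "u \<in> hopf_brace_hom K ?Q C"
    by (rule hopf_brace_hom_factor[OF brace quotient_is_hopf_brace C quotient_projection_hom
          quotient_projection_surj h u])
  then show "u \<in> hopf_brace_hom K ?Q C \<and> u \<in> extensional (carrier ?Q) \<and> (\<forall>b\<in>carrier H. u (I +>\<^bsub>H\<^esub> b) = h b)"
    using u by (auto simp: u_def)
  fix v assume v: "v \<in> hopf_brace_hom K ?Q C \<and> v \<in> extensional (carrier ?Q)
    \<and> (\<forall>b\<in>carrier H. v (I +>\<^bsub>H\<^esub> b) = h b)"
  show "v = u"
  proof (rule extensionalityI[of _ "carrier ?Q"])
    fix X assume "X \<in> carrier ?Q"
    then obtain b where "b \<in> carrier H" "X = I +>\<^bsub>H\<^esub> b"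
      unfolding quotient_projection_surj[symmetric] by blast
    then show "v X = u X"
      using v u by simp
  qed (use v in \<open>auto simp: u_def\<close>)
qed

end

section \<open>The iterative procedure\<close>

text \<open>\<open>tensor_ideal K H I\<close> is \<open>I \<otimes> H + H \<otimes> I\<close>.\<close>

definition tensor_ideal ::
  "('k, 'r) ring_scheme \<Rightarrow> ('k, 'h, 'm) module_scheme \<Rightarrow> 'h set \<Rightarrow> ('k, 'h, 'h) tensor set"
  where "tensor_ideal K H I = module_span K (tensor_product K H H)
    ({pure_tensor K H H i x | i x. i \<in> I \<and> x \<in> carrier H} \<union>
     {pure_tensor K H H x i | i x. i \<in> I \<and> x \<in> carrier H})"

text \<open>These elements satisfy the coideal condition relative to \<open>I\<close> but need not
  lie in \<open>I\<close>. A submodule contained in its own core is a coideal.\<close>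

definition coideal_core ::
  "('k, 'r) ring_scheme \<Rightarrow> ('k, 'h, 'm) coalgebra_scheme \<Rightarrow> 'h set \<Rightarrow> 'h set"
  where "coideal_core K H I =
    {x \<in> carrier H. \<Delta>\<^bsub>H\<^esub> x \<in> tensor_ideal K H I \<and> \<epsilon>\<^bsub>H\<^esub> x = \<zero>\<^bsub>K\<^esub>}"

lemma tensor_idealI:
  "i \<in> I \<Longrightarrow> x \<in> carrier H \<Longrightarrow> pure_tensor K H H i x \<in> tensor_ideal K H I"
  "i \<in> I \<Longrightarrow> x \<in> carrier H \<Longrightarrow> pure_tensor K H H x i \<in> tensor_ideal K H I"
  unfolding tensor_ideal_def by (rule subsetD[OF module_span_incl], blast)+

section \<open>Tensor ideals and coideal cores\<close>

context coalgebra
begin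

lemma tensor_ideal_submodule:
  assumes "I \<subseteq> carrier H"
  shows "submodule (tensor_ideal K H I) K HH"
  unfolding tensor_ideal_def
  by (rule module_span_submodule[OF HH_module])
    (use assms pure_tensor_closed[OF module module] in blast)

text \<open>An induction principle for I \<otimes> H + H \<otimes> I: a linear map preserves this
  space if it does so on the two kinds of generators.\<close>

lemma tensor_ideal_vimage:
  assumes I: "I \<subseteq> carrier H" and L: "L \<in> module_hom K HH HH"
    and gen: "\<And>i x. \<lbrakk>i \<in> I; x \<in> carrier H\<rbrakk> \<Longrightarrow> L (pure_tensor K H H i x) \<in> tensor_ideal K H I"
      "\<And>i x. \<lbrakk>i \<in> I; x \<in> carrier H\<rbrakk> \<Longrightarrow> L (pure_tensor K H H x i) \<in> tensor_ideal K H I"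
    and t: "t \<in> tensor_ideal K H I"
  shows "L t \<in> tensor_ideal K H I"
proof -
  let ?N = "{t \<in> carrier HH. L t \<in> tensor_ideal K H I}"
  have "submodule ?N K HH"
    by (rule submodule_vimage[OF HH_module HH_module L tensor_ideal_submodule[OF I]])
  then have "module_span K HH
      ({pure_tensor K H H i x | i x. i \<in> I \<and> x \<in> carrier H} \<union>
       {pure_tensor K H H x i | i x. i \<in> I \<and> x \<in> carrier H}) \<subseteq> ?N"
    by (rule module_span_least) (use I gen pure_tensor_closed[OF module module] in blast)
  then show ?thesis
    using t tensor_ideal_def[of K H I] by blast
qed

lemma coideal_core_submodule:
  assumes "I \<subseteq> carrier H"
  shows "submodule (coideal_core K H I) K H"
proof -
  have "coideal_core K H I
      = {x \<in> carrier H. \<Delta>\<^bsub>H\<^esub> x \<in> tensor_ideal K H I} \<inter> {x \<in> carrier H. \<epsilon>\<^bsub>H\<^esub> x = \<zero>\<^bsub>K\<^esub>}"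
    by (auto simp: coideal_core_def)
  then show ?thesis
    using submodule_Int[OF module submodule_vimage[OF module HH_module comult_linear
          tensor_ideal_submodule[OF assms]] counit_kernel_submodule]
    by simp
qed

text \<open>\<open>tensor_ideal\<close> is a single span, whereas \<open>coideal\<close> asks for a
  sum of two spans. The sum is a submodule containing both kinds of generators, so it contains the
  single span.\<close>

lemma coidealI:
  assumes "submodule I K H" "I \<subseteq> coideal_core K H I"
  shows "coideal K H I"
proof -
  let ?IH = "module_span K HH {pure_tensor K H H i x | i x. i \<in> I \<and> x \<in> carrier H}"
  let ?HI = "module_span K HH {pure_tensor K H H x i | i x. i \<in> I \<and> x \<in> carrier H}"
  have I: "I \<subseteq> carrier H"
    using assms(2) by (auto simp: coideal_core_def)
  have sub: "submodule ?IH K HH" "submodule ?HI K HH"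
    using I pure_tensor_closed[OF module module] by (intro module_span_submodule[OF HH_module]; blast)+
  have "tensor_ideal K H I \<subseteq> ?IH <+>\<^bsub>HH\<^esub> ?HI"
    unfolding tensor_ideal_def
    by (intro module_span_least[OF submodule_set_add[OF HH_module sub]] Un_least
        order.trans[OF module_span_incl subset_set_add(1)[OF HH_module sub]]
        order.trans[OF module_span_incl subset_set_add(2)[OF HH_module sub]])
  then show ?thesis
    using assms by (auto simp: coideal_def Let_def coideal_core_def)
qed

end

section \<open>Coideal cores under products, antipodes and morphisms\<close>

context hopf_algebra
begin

text \<open>Ring ideals absorb scalars because a x = (a 1) x. The stages are generated as ring
  ideals, and this makes them subspaces.\<close>

lemma ideal_submodule:
  assumes "ideal I H"
  shows "submodule I K H"
proof -
  interpret I: ideal I H by fact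
  show ?thesis
  proof (rule submoduleI)
    fix a x assume a: "a \<in> carrier K" and x: "x \<in> I"
    have "a \<odot>\<^bsub>H\<^esub> x = (a \<odot>\<^bsub>H\<^esub> \<one>\<^bsub>H\<^esub>) \<otimes>\<^bsub>H\<^esub> x"
      using a I.a_Hcarr[OF x] by (simp add: smult_mult_left)
    then show "a \<odot>\<^bsub>H\<^esub> x \<in> I"
      using a x I.I_l_closed[of x "a \<odot>\<^bsub>H\<^esub> \<one>\<^bsub>H\<^esub>"] by simp
  qed (use I.a_subset in auto)
qed

text \<open>For a pure factor, (i \<otimes> x) (c \<otimes> d) = i c \<otimes> x d with i c again in
  \<open>I\<close>, and likewise for the other generators and the other side. Induction on
  \<open>s\<close> handles general factors.\<close>

lemma tensor_ideal_mult:
  assumes I: "ideal I H" and t: "t \<in> tensor_ideal K H I" and s: "s \<in> carrier HH"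
  shows "tensor_mult K H t s \<in> tensor_ideal K H I" "tensor_mult K H s t \<in> tensor_ideal K H I"
proof -
  interpret I: ideal I H by fact
  have IH: "I \<subseteq> carrier H"
    by (rule I.a_subset)
  note sub = tensor_ideal_submodule[OF IH]
  interpret HH: module K HH by (rule HH_module)
  have cl: "r \<in> carrier HH" if "r \<in> tensor_ideal K H I" for r
    using HH.submoduleE(1)[OF sub] that by blast
  note add = HH.submoduleE(5)[OF sub]
  have tc: "t \<in> carrier HH"
    by (rule cl[OF t])
  show "tensor_mult K H t s \<in> tensor_ideal K H I"
    using module module s
  proof (induction s rule: tensor_induct)
    case (pure c d)
    have L: "(\<lambda>r. tensor_mult K H r (pure_tensor K H H c d)) \<in> module_hom K HH HH"
      by (rule bilinear_left[OF tensor_mult_bilinear pure_closed[OF pure]])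
    show ?case
      by (rule tensor_ideal_vimage[OF IH L _ _ t])
        (use pure IH in \<open>simp_all add: subset_iff tensor_mult_pure tensor_idealI I.I_r_closed\<close>)
  qed (simp add: tensor_mult_simps tc add)
  show "tensor_mult K H s t \<in> tensor_ideal K H I"
    using module module s
  proof (induction s rule: tensor_induct)
    case (pure c d)
    have L: "(\<lambda>r. tensor_mult K H (pure_tensor K H H c d) r) \<in> module_hom K HH HH"
      by (rule bilinear_right[OF tensor_mult_bilinear pure_closed[OF pure]])
    show ?case
      by (rule tensor_ideal_vimage[OF IH L _ _ t])
        (use pure IH in \<open>simp_all add: subset_iff tensor_mult_pure tensor_idealI I.I_l_closed\<close>)
  qed (simp add: tensor_mult_simps tc add)
qed

text \<open>The core is the preimage under \<Delta> of an ideal of H \<otimes> H, intersected with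
  the kernel of \<epsilon>, and \<Delta> and \<epsilon> are multiplicative.\<close>

lemma coideal_core_ideal:
  assumes I: "ideal I H"
  shows "ideal (coideal_core K H I) H"
proof (rule idealI[OF ring])
  interpret I: ideal I H by fact
  show "subgroup (coideal_core K H I) (add_monoid H)"
    by (rule submodule.axioms(1)[OF coideal_core_submodule[OF I.a_subset]])
qed (auto simp: coideal_core_def comult_mult counit_mult counit_closed comult_closed tensor_ideal_mult[OF I])

text \<open>By \<open>comult_antipode\<close> the two factors are exchanged, so generators in I
  \<otimes> H go to H \<otimes> I and conversely. The symmetric form of \<open>tensor_ideal\<close>
  absorbs the exchange.\<close>

lemma coideal_core_antipode:
  assumes I: "I \<subseteq> carrier H" "antipode H ` I \<subseteq> I" and x: "x \<in> coideal_core K H I"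
  shows "antipode H x \<in> coideal_core K H I"
proof -
  have *: "x \<in> carrier H" "\<Delta>\<^bsub>H\<^esub> x \<in> tensor_ideal K H I" "\<epsilon>\<^bsub>H\<^esub> x = \<zero>\<^bsub>K\<^esub>"
    using x by (auto simp: coideal_core_def)
  note b = antipode_swap_bilinear
  have "\<Delta>\<^bsub>H\<^esub> (antipode H x) \<in> tensor_ideal K H I"
    unfolding comult_antipode[OF *(1)]
    by (rule tensor_ideal_vimage[OF I(1) tensor_lift_hom[OF module module HH_module b] _ _ *(2)])
      (use I in \<open>simp_all add: subset_iff image_subset_iff tensor_lift_pure[OF module module HH_module b]
         antipode_closed tensor_idealI\<close>)
  then show ?thesis
    using * by (simp add: coideal_core_def antipode_closed counit_antipode)
qed

lemma difference_mem_coideal_core: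
  assumes A: "hopf_algebra K A" and f: "f \<in> hopf_algebra_hom K A H" and g: "g \<in> hopf_algebra_hom K A H"
    and I: "submodule I K H" "\<And>a. a \<in> carrier A \<Longrightarrow> f a \<ominus>\<^bsub>H\<^esub> g a \<in> I" and a: "a \<in> carrier A"
  shows "f a \<ominus>\<^bsub>H\<^esub> g a \<in> coideal_core K H I"
proof -
  interpret A: hopf_algebra K A by (rule A)
  interpret HH: module K HH by (rule HH_module)
  note f' = hopf_algebra_homD[OF f] and g' = hopf_algebra_homD[OF g]
  note fc = module_hom_closed[OF f'(1)] and gc = module_hom_closed[OF g'(1)]
  have IH: "I \<subseteq> carrier H"
    by (rule submoduleE(1)[OF I(1)])
  note sub = tensor_ideal_submodule[OF IH]
  note F = tensor_map_hom[OF A.module A.module module module f'(1) f'(1)]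
  note G = tensor_map_hom[OF A.module A.module module module g'(1) g'(1)]
  \<comment> \<open>Claimed for all tensors over \<open>A\<close> and not just for
    comultiplications: both sides of the difference are linear in t, and the telescoping is a
    computation on pure tensors.\<close>
  have diff: "tensor_map K H H f f t \<ominus>\<^bsub>HH\<^esub> tensor_map K H H g g t \<in> tensor_ideal K H I"
    if t: "t \<in> carrier A.HH" for t
    using A.module A.module t
  proof (induction t rule: tensor_induct)
    case (pure b c)
    note * = fc[OF pure(1)] fc[OF pure(2)] gc[OF pure(1)] gc[OF pure(2)]
    have l: "pure_tensor K H H (f b \<ominus>\<^bsub>H\<^esub> g b) (f c)
        = pure_tensor K H H (f b) (f c) \<ominus>\<^bsub>HH\<^esub> pure_tensor K H H (g b) (f c)"
      by (rule module_hom_minus[OF module HH_module bilinear_left[OF pure_bilinear *(2)] *(1,3)])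
    have r: "pure_tensor K H H (g b) (f c \<ominus>\<^bsub>H\<^esub> g c)
        = pure_tensor K H H (g b) (f c) \<ominus>\<^bsub>HH\<^esub> pure_tensor K H H (g b) (g c)"
      by (rule module_hom_minus[OF module HH_module bilinear_right[OF pure_bilinear *(3)] *(2,4)])
    have "tensor_map K H H f f (pure_tensor K A A b c) \<ominus>\<^bsub>HH\<^esub> tensor_map K H H g g (pure_tensor K A A b c)
        = pure_tensor K H H (f b \<ominus>\<^bsub>H\<^esub> g b) (f c) \<oplus>\<^bsub>HH\<^esub> pure_tensor K H H (g b) (f c \<ominus>\<^bsub>H\<^esub> g c)"
      unfolding l r using pure *
      by (simp add: tensor_map_pure[OF A.module A.module module module f'(1) f'(1)]
          tensor_map_pure[OF A.module A.module module module g'(1) g'(1)] pure_closed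
          a_minus_def HH.M.a_assoc HH.M.r_neg1)
    also have "\<dots> \<in> tensor_ideal K H I"
      using pure * I(2) by (intro HH.submoduleE(5)[OF sub] tensor_idealI) auto
    finally show ?case .
  next
    case (add s t)
    note cl = module_hom_closed[OF F add(1)] module_hom_closed[OF F add(2)]
      module_hom_closed[OF G add(1)] module_hom_closed[OF G add(2)]
    have "tensor_map K H H f f (s \<oplus>\<^bsub>A.HH\<^esub> t) \<ominus>\<^bsub>HH\<^esub> tensor_map K H H g g (s \<oplus>\<^bsub>A.HH\<^esub> t)
        = (tensor_map K H H f f s \<ominus>\<^bsub>HH\<^esub> tensor_map K H H g g s) \<oplus>\<^bsub>HH\<^esub>
          (tensor_map K H H f f t \<ominus>\<^bsub>HH\<^esub> tensor_map K H H g g t)"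
      using add(1,2) cl by (simp add: module_hom_add[OF F] module_hom_add[OF G] a_minus_def
          HH.M.minus_add HH.M.add.m_ac)
    then show ?case
      using HH.submoduleE(5)[OF sub add(3,4)] by simp
  qed
  have "\<Delta>\<^bsub>H\<^esub> (f a \<ominus>\<^bsub>H\<^esub> g a) = tensor_map K H H f f (\<Delta>\<^bsub>A\<^esub> a) \<ominus>\<^bsub>HH\<^esub> tensor_map K H H g g (\<Delta>\<^bsub>A\<^esub> a)"
    using a by (simp add: module_hom_minus[OF module HH_module comult_linear] fc gc f'(3) g'(3))
  moreover have "\<epsilon>\<^bsub>H\<^esub> (f a \<ominus>\<^bsub>H\<^esub> g a) = \<zero>\<^bsub>K\<^esub>"
    using a by (simp add: a_minus_def counit_add counit_a_inv fc gc f'(4) g'(4) A.counit_closed R.r_neg)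
  ultimately show ?thesis
    using diff[OF A.comult_closed[OF a]] a by (simp add: coideal_core_def fc gc)
qed

end

lemma tensor_ideal_diamond [simp]: "tensor_ideal K (diamond H) I = tensor_ideal K H I"
  by (simp add: tensor_ideal_def)

lemma coideal_core_diamond [simp]: "coideal_core K (diamond H) I = coideal_core K H I"
  by (simp add: coideal_core_def)

lemma coideal_diamond [simp]: "coideal K (diamond H) I = coideal K H I"
  by (simp add: coideal_def)

text \<open>Only cofinally many members are assumed to be ideals, since the stages alternate between
  the two products. Any two elements of the union lie in a common member that is an ideal.\<close>

lemma ideal_chain_Union:
  fixes J :: "nat \<Rightarrow> 'a set"
  assumes "ring R" "mono J" "\<And>n. \<exists>m\<ge>n. ideal (J m) R"
  shows "ideal (\<Union>n. J n) R"
proof (rule idealI[OF assms(1)])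
  interpret R: ring R by fact
  have ex: "\<exists>m. ideal (J m) R \<and> x \<in> J m \<and> y \<in> J m" if xy: "x \<in> (\<Union>n. J n)" "y \<in> (\<Union>n. J n)" for x y
  proof -
    obtain i j where ij: "x \<in> J i" "y \<in> J j"
      using xy by blast
    obtain m where m: "m \<ge> max i j" "ideal (J m) R"
      using assms(3) by blast
    then have "J i \<subseteq> J m" "J j \<subseteq> J m"
      using assms(2) by (auto dest: monoD)
    then show ?thesis
      using ij m(2) by blast
  qed
  obtain m0 where m0: "ideal (J m0) R"
    using assms(3) by blast
  show "subgroup (\<Union>n. J n) (add_monoid R)"
  proof (rule R.add.subgroupI)
    show "(\<Union>n. J n) \<subseteq> carrier R"
    proof
      fix x assume "x \<in> (\<Union>n. J n)"
      then obtain m where "ideal (J m) R" "x \<in> J m"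
        using ex by blast
      then show "x \<in> carrier R"
        by (rule ideal.Icarr)
    qed
    show "(\<Union>n. J n) \<noteq> {}"
      using additive_subgroup.zero_closed[OF ideal.axioms(1)[OF m0]] by blast
    show "\<ominus>\<^bsub>R\<^esub> x \<in> (\<Union>n. J n)" if x: "x \<in> (\<Union>n. J n)" for x
    proof -
      obtain m where "ideal (J m) R" "x \<in> J m"
        using ex[OF x x] by blast
      then have "\<ominus>\<^bsub>R\<^esub> x \<in> J m"
        by (rule additive_subgroup.a_inv_closed[OF ideal.axioms(1)])
      then show ?thesis by blast
    qed
    show "x \<oplus>\<^bsub>R\<^esub> y \<in> (\<Union>n. J n)" if xy: "x \<in> (\<Union>n. J n)" "y \<in> (\<Union>n. J n)" for x y
    proof -
      obtain m where "ideal (J m) R" "x \<in> J m" "y \<in> J m"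
        using ex[OF xy] by blast
      then have "x \<oplus>\<^bsub>R\<^esub> y \<in> J m"
        by (rule additive_subgroup.a_closed[OF ideal.axioms(1)])
      then show ?thesis by blast
    qed
  qed
  show "y \<otimes>\<^bsub>R\<^esub> x \<in> (\<Union>n. J n)" "x \<otimes>\<^bsub>R\<^esub> y \<in> (\<Union>n. J n)"
    if x: "x \<in> (\<Union>n. J n)" and y: "y \<in> carrier R" for x y
  proof -
    obtain m where "ideal (J m) R" "x \<in> J m"
      using ex[OF x x] by blast
    then show "y \<otimes>\<^bsub>R\<^esub> x \<in> (\<Union>n. J n)" "x \<otimes>\<^bsub>R\<^esub> y \<in> (\<Union>n. J n)"
      using ideal.I_l_closed[of "J m" R x y] ideal.I_r_closed[of "J m" R x y] y by blast+
  qed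
qed

lemma funpow_image_subset:
  assumes "f ` P \<subseteq> P" "X \<subseteq> P"
  shows "(\<Union>m. (f ^^ m) ` X) \<subseteq> P"
proof -
  have "(f ^^ m) x \<in> P" if "x \<in> X" for m x
    using that assms by (induction m) auto
  then show ?thesis by auto
qed

section \<open>The closure produced by the iterative procedure\<close>

context hopf_brace
begin

text \<open>Used with two choices of \<open>P\<close>: the coideal core of the closure itself, and
  the kernel of a morphism.\<close>

lemma brace_closure_least:
  assumes "J \<subseteq> P" "ideal P H" "ideal P (diamond H)" "antipode H ` P \<subseteq> P" "dia_antipode H ` P \<subseteq> P"
  shows "brace_closure H J \<subseteq> P"
proof -
  have "brace_stage H J n \<subseteq> P" for n
  proof (induction n)
    case (Suc n)
    have "(\<Union>m. (antipode H ^^ m) ` brace_stage H J n) \<subseteq> P"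
      "(\<Union>m. (dia_antipode H ^^ m) ` brace_stage H J n) \<subseteq> P"
      by (rule funpow_image_subset[OF assms(4) Suc] funpow_image_subset[OF assms(5) Suc])+
    then show ?case
      using H.genideal_minimal[OF assms(2)] diamond.H.genideal_minimal[OF assms(3)] by simp
  qed (simp add: assms(1))
  then show ?thesis
    by (auto simp: brace_closure_def)
qed

lemma antipode_orbit_carrier:
  assumes "X \<subseteq> carrier H"
  shows "(\<Union>m. (antipode H ^^ m) ` X) \<subseteq> carrier H" "(\<Union>m. (dia_antipode H ^^ m) ` X) \<subseteq> carrier H"
  using antipode_closed diamond.antipode_closed assms by (intro funpow_image_subset; auto)+

context
  fixes J assumes J: "J \<subseteq> carrier H"
begin

lemma brace_stage_carrier: "brace_stage H J n \<subseteq> carrier H"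
proof (induction n)
  case (Suc n)
  note antipode_orbit_carrier[OF Suc]
  then show ?case
    using H.genideal_minimal[OF H.oneideal] diamond.H.genideal_minimal[OF diamond.H.oneideal] by simp
qed (simp add: J)

lemma brace_stage_generators:
  "even n \<Longrightarrow> (\<Union>m. (antipode H ^^ m) ` brace_stage H J n) \<subseteq> brace_stage H J (Suc n)"
  "odd n \<Longrightarrow> (\<Union>m. (dia_antipode H ^^ m) ` brace_stage H J n) \<subseteq> brace_stage H J (Suc n)"
proof -
  note carr = antipode_orbit_carrier[OF brace_stage_carrier, of n]
  show "even n \<Longrightarrow> (\<Union>m. (antipode H ^^ m) ` brace_stage H J n) \<subseteq> brace_stage H J (Suc n)"
    using H.genideal_self[OF carr(1)] by simp
  show "odd n \<Longrightarrow> (\<Union>m. (dia_antipode H ^^ m) ` brace_stage H J n) \<subseteq> brace_stage H J (Suc n)"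
    using diamond.H.genideal_self carr(2) by simp
qed

lemma brace_stage_antipode:
  "\<lbrakk>even n; x \<in> brace_stage H J n\<rbrakk> \<Longrightarrow> antipode H x \<in> brace_stage H J (Suc n)"
  "\<lbrakk>odd n; x \<in> brace_stage H J n\<rbrakk> \<Longrightarrow> dia_antipode H x \<in> brace_stage H J (Suc n)"
  \<comment> \<open>The power m = 1 in the union of iterates gives the antipode of x; the power m =
    0 will give x itself in \<open>brace_stage_Suc\<close>.\<close>
  using brace_stage_generators(1)[THEN subsetD, OF _ UN_I[OF UNIV_I[of 1]], of n "antipode H x"]
    brace_stage_generators(2)[THEN subsetD, OF _ UN_I[OF UNIV_I[of 1]], of n "dia_antipode H x"]
  by simp_all

lemma brace_stage_Suc: "brace_stage H J n \<subseteq> brace_stage H J (Suc n)"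
proof
  fix x assume "x \<in> brace_stage H J n"
  then show "x \<in> brace_stage H J (Suc n)"
    using brace_stage_generators(1)[THEN subsetD, OF _ UN_I[OF UNIV_I[of 0]], of n x]
      brace_stage_generators(2)[THEN subsetD, OF _ UN_I[OF UNIV_I[of 0]], of n x]
    by (cases "even n") simp_all
qed

lemma brace_stage_mono: "mono (brace_stage H J)"
  using brace_stage_Suc by (rule mono_iff_le_Suc[THEN iffD2, OF allI])

lemma brace_stage_ideal:
  "even n \<Longrightarrow> ideal (brace_stage H J (Suc n)) H"
  "odd n \<Longrightarrow> ideal (brace_stage H J (Suc n)) (diamond H)"
proof -
  note carr = antipode_orbit_carrier[OF brace_stage_carrier, of n]
  show "even n \<Longrightarrow> ideal (brace_stage H J (Suc n)) H"
    using H.genideal_ideal[OF carr(1)] by simp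
  show "odd n \<Longrightarrow> ideal (brace_stage H J (Suc n)) (diamond H)"
    using diamond.H.genideal_ideal carr(2) by simp
qed

lemma brace_closure_ideal: "ideal (brace_closure H J) H" "ideal (brace_closure H J) (diamond H)"
proof -
  \<comment> \<open>Odd indices are the ideals for the first product, and 2 n + 1 is an odd index
    beyond n.\<close>
  have "\<exists>m\<ge>n. ideal (brace_stage H J m) H" for n
    using brace_stage_ideal(1)[of "2 * n"] by (intro exI[of _ "Suc (2 * n)"]) simp
  then show "ideal (brace_closure H J) H"
    unfolding brace_closure_def by (intro ideal_chain_Union ring brace_stage_mono)
  \<comment> \<open>The even index 2 n + 2; stage 0 is even too but is merely
    \<open>J\<close>.\<close>
  have "\<exists>m\<ge>n. ideal (brace_stage H J m) (diamond H)" for n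
    using brace_stage_ideal(2)[of "2 * n + 1"] by (intro exI[of _ "Suc (2 * n + 1)"]) simp
  then show "ideal (brace_closure H J) (diamond H)"
    unfolding brace_closure_def by (intro ideal_chain_Union diamond.ring brace_stage_mono)
qed

lemma brace_closure_antipode:
  "antipode H ` brace_closure H J \<subseteq> brace_closure H J"
  "dia_antipode H ` brace_closure H J \<subseteq> brace_closure H J"
proof -
  have "antipode H x \<in> brace_closure H J" "dia_antipode H x \<in> brace_closure H J"
    if "x \<in> brace_stage H J n" for x n
  proof -
    \<comment> \<open>Each antipode is applied only at stages of one parity. An element of stage n
      lies in stage n + 1 as well, and one of these two indices has the right parity.\<close>
    have x: "x \<in> brace_stage H J (Suc n)"
      using that brace_stage_Suc by blast
    show "antipode H x \<in> brace_closure H J" "dia_antipode H x \<in> brace_closure H J"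
      unfolding brace_closure_def
      using brace_stage_antipode[OF _ that] brace_stage_antipode[OF _ x]
      by (cases "even n"; force simp del: brace_stage.simps)+
  qed
  then show "antipode H ` brace_closure H J \<subseteq> brace_closure H J"
    "dia_antipode H ` brace_closure H J \<subseteq> brace_closure H J"
    unfolding brace_closure_def by blast+
qed

lemma brace_closure_superset: "J \<subseteq> brace_closure H J"
  using UN_upper[of 0 UNIV "brace_stage H J"] by (simp add: brace_closure_def)

lemma brace_closure_hopf_brace_ideal:
  assumes "J \<subseteq> coideal_core K H (brace_closure H J)"
  shows "hopf_brace_ideal K H (brace_closure H J)"
proof -
  let ?I = "brace_closure H J"
  note I = brace_closure_ideal
  have IH: "?I \<subseteq> carrier H"
    using ideal.Icarr[OF I(1)] by blast
  \<comment> \<open>Here the union pays off: it is an ideal for both products and stable under both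
    antipodes, so its core has all four closure properties at once.\<close>
  have core: "?I \<subseteq> coideal_core K H ?I"
    using coideal_core_antipode[OF IH brace_closure_antipode(1)]
      diamond.coideal_core_antipode[simplified, OF IH brace_closure_antipode(2)]
      coideal_core_ideal[OF I(1)] diamond.coideal_core_ideal[OF I(2)]
    by (intro brace_closure_least[OF assms]) auto
  have "coideal K H ?I"
    by (rule coidealI[OF ideal_submodule[OF I(1)] core])
  then show ?thesis
    using I brace_closure_antipode by (simp add: hopf_brace_ideal_def hopf_ideal_def)
qed

lemma hom_brace_closure_zero:
  assumes C: "hopf_brace K C" and h: "h \<in> hopf_brace_hom K H C"
    and zero: "\<And>x. x \<in> J \<Longrightarrow> h x = \<zero>\<^bsub>C\<^esub>" and x: "x \<in> brace_closure H J"
  shows "h x = \<zero>\<^bsub>C\<^esub>"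
proof -
  interpret C: hopf_brace K C by (rule C)
  have h1: "h \<in> hopf_algebra_hom K H C" and h2: "h \<in> hopf_algebra_hom K (diamond H) (diamond C)"
    using h by (auto simp: hopf_brace_hom_def)
  interpret h: ring_hom_ring H C h
    by (rule ring_hom_ringI2[OF ring C.ring hopf_algebra_homD(2)[OF h1]])
  interpret hd: ring_hom_ring "diamond H" "diamond C" h
    by (rule ring_hom_ringI2[OF diamond.ring C.diamond.ring hopf_algebra_homD(2)[OF h2]])
  let ?P = "{x \<in> carrier H. h x = \<zero>\<^bsub>C\<^esub>}"
  \<comment> \<open>The two structures share carrier and zero, so h has the same kernel for both,
    and this one set is an ideal for both products.\<close>
  have ker: "a_kernel H C h = ?P" "a_kernel (diamond H) (diamond C) h = ?P"
    unfolding a_kernel_def' by (rule refl, simp only: diamond_simps)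
  \<comment> \<open>Since h commutes with the antipodes, stability of the kernel reduces to
    antipodes fixing 0, which is linearity.\<close>
  have S0: "antipode C \<zero>\<^bsub>C\<^esub> = \<zero>\<^bsub>C\<^esub>" "dia_antipode C \<zero>\<^bsub>C\<^esub> = \<zero>\<^bsub>C\<^esub>"
    using module_hom_zero[OF C.module C.module C.antipode_linear]
      module_hom_zero[OF C.module C.module C.diamond.antipode_linear[simplified]] .
  have "brace_closure H J \<subseteq> ?P"
  proof (rule brace_closure_least)
    show "ideal ?P H"
      using h.kernel_is_ideal by (simp add: ker)
    show "ideal ?P (diamond H)"
      using hd.kernel_is_ideal by (simp add: ker)
  qed (use J zero in \<open>auto simp: antipode_closed diamond.antipode_closed[simplified]
      hopf_algebra_homD(5)[OF h1] hopf_algebra_homD(5)[OF h2, simplified] S0\<close>)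
  then show ?thesis
    using x by blast
qed

end

end

section \<open>The coequalizer\<close>

theorem mainTheorem7:
  fixes K :: "('k, 'r) ring_scheme"
    and A :: "('k, 'a) hopf_brace" and B :: "('k, 'b) hopf_brace"
    and f g :: "'a \<Rightarrow> 'b" and I\<^sub>0 I :: "'b set"
  assumes "field K"
    and "hopf_brace K A" and "hopf_brace K B"
    and "f \<in> hopf_brace_hom K A B" and "g \<in> hopf_brace_hom K A B"
    and "I\<^sub>0 = module_span K B {f a \<ominus>\<^bsub>B\<^esub> g a | a. a \<in> carrier A}"
    and "I = brace_closure B I\<^sub>0"
  shows "hopf_brace_ideal K B I \<and>
    hopf_brace_coequalizer TYPE('c) K A B f g
      (quotient_hopf_brace K B I) (\<lambda>b. I +>\<^bsub>B\<^esub> b) \<and>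
    (cocommutative K A \<and> cocommutative K B \<longrightarrow>
      cocommutative_hopf_brace_coequalizer TYPE('c) K A B f g
        (quotient_hopf_brace K B I) (\<lambda>b. I +>\<^bsub>B\<^esub> b))"
proof -
  interpret A: hopf_brace K A by fact
  interpret B: hopf_brace K B by fact
  let ?D = "{f a \<ominus>\<^bsub>B\<^esub> g a | a. a \<in> carrier A}"
  let ?Q = "quotient_hopf_brace K B I" and ?p = "\<lambda>b. I +>\<^bsub>B\<^esub> b"
  have f: "f \<in> hopf_algebra_hom K A B" and g: "g \<in> hopf_algebra_hom K A B"
    using assms(4,5) by (auto simp: hopf_brace_hom_def)
  note fg = module_hom_closed[OF hopf_algebra_homD(1)[OF f]] module_hom_closed[OF hopf_algebra_homD(1)[OF g]]
  have D: "?D \<subseteq> carrier B"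
    using fg by auto
  have I0: "I\<^sub>0 \<subseteq> carrier B"
    unfolding assms(6) by (rule B.submoduleE(1)[OF module_span_submodule[OF B.module D]])
  have D_I: "f a \<ominus>\<^bsub>B\<^esub> g a \<in> I" if "a \<in> carrier A" for a
  proof -
    have "f a \<ominus>\<^bsub>B\<^esub> g a \<in> I\<^sub>0"
      unfolding assms(6) by (rule subsetD[OF module_span_incl]) (use that in blast)
    then show ?thesis
      unfolding assms(7) using B.brace_closure_superset[OF I0] by blast
  qed
  have I_sub: "submodule I K B"
    unfolding assms(7) by (rule B.ideal_submodule[OF B.brace_closure_ideal(1)[OF I0]])
  have "I\<^sub>0 \<subseteq> coideal_core K B I"
    unfolding assms(6)
  \<comment> \<open>The core is a subspace, so the differences that span \<open>I\<^sub>0\<close>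
    are enough.\<close>
  proof (rule module_span_least)
    show "submodule (coideal_core K B I) K B"
      by (rule B.coideal_core_submodule[OF B.submoduleE(1)[OF I_sub]])
    show "?D \<subseteq> coideal_core K B I"
      using B.difference_mem_coideal_core[OF A.hopf_algebra_axioms f g I_sub D_I] by blast
  qed
  then have ideal: "hopf_brace_ideal K B I"
    unfolding assms(7) by (rule B.brace_closure_hopf_brace_ideal[OF I0])
  note Q = quotient_is_hopf_brace[OF assms(3) ideal] and p = quotient_projection_hom[OF assms(3) ideal]
  interpret Q: module_quotient K B I
    by (intro module_quotient.intro module_quotient_axioms.intro B.module I_sub)
  \<comment> \<open>Equality of the two cosets is membership of f a - g a in
    \<open>I\<close>.\<close>
  have eq: "\<forall>a\<in>carrier A. ?p (f a) = ?p (g a)"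
    using D_I fg by (simp add: Q.coset_eq_iff)
  have univ: "\<exists>!u. u \<in> hopf_brace_hom K ?Q C \<and> u \<in> extensional (carrier ?Q) \<and> (\<forall>b\<in>carrier B. u (?p b) = h b)"
    if C: "hopf_brace K C" and h: "h \<in> hopf_brace_hom K B C" and hfg: "\<forall>a\<in>carrier A. h (f a) = h (g a)"
    for C :: "('k, 'c) hopf_brace" and h
  proof (rule quotient_universal_property[OF assms(3) ideal C h])
    interpret C: hopf_brace K C by (rule C)
    have h': "h \<in> module_hom K B C"
      using h by (auto simp: hopf_brace_hom_def hopf_algebra_hom_def)
    let ?N = "{x \<in> carrier B. h x \<in> {\<zero>\<^bsub>C\<^esub>}}"
    \<comment> \<open>The kernel of a morphism that equalizes f and g contains the differences,
      hence their span; \<open>hom_brace_closure_zero\<close> extends this from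
      \<open>I\<^sub>0\<close> to \<open>I\<close>.\<close>
    have "I\<^sub>0 \<subseteq> ?N"
      unfolding assms(6)
    proof (rule module_span_least)
      show "submodule ?N K B"
        by (rule submodule_vimage[OF B.module C.module h' submodule_zero_singleton[OF C.module]])
      show "?D \<subseteq> ?N"
        using fg hfg by (auto simp: module_hom_minus[OF B.module C.module h'] C.minus_eq_zero_iff
            module_hom_closed[OF h'])
    qed
    then show "h x = \<zero>\<^bsub>C\<^esub>" if "x \<in> I" for x
      using B.hom_brace_closure_zero[OF I0 C h, of x] that assms(7) by blast
  qed
  \<comment> \<open>For cocommutative braces only the membership of the quotient in the full
    subcategory is new: the test objects there are among those covered by
    \<open>univ\<close>.\<close>
  have coc: "cocommutative K ?Q" if "cocommutative K B"
  proof (rule cocommutative_surj_image[OF B.hopf_algebra_axioms _ _ quotient_projection_surj[OF assms(3) ideal] that])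
    show "hopf_algebra K ?Q"
      using Q by (rule hopf_brace.axioms(1))
    show "?p \<in> hopf_algebra_hom K B ?Q"
      using p by (simp add: hopf_brace_hom_def)
  qed
  show ?thesis
    unfolding hopf_brace_coequalizer_def cocommutative_hopf_brace_coequalizer_def
    using ideal Q p eq univ coc by blast
qed

end
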